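(* Let $\lambda$ be a cardinal with $0<\lambda\le\omega$. The group $\mathrm{Gal}_L^{\mathrm{fix},\lambda}(\Sigma(\mathcal M))$ (so in particular $\mathrm{Gal}_L^{\mathrm{fix}}(\Sigma(\mathcal M))$) does not depend, up to isomorphism, on the choice of the monster model $\mathcal M$ of $T$.
   Context: $T$ is a complete theory, $\mathcal M=\mathcal M^{\mathrm{eq}}$ a monster model (large, saturated) of $T$, $\Sigma(\bar x)$ a partial type over $\emptyset$ ($\bar x$ possibly infinite). $\mathrm{Autf}(\mathcal M)$ is the subgroup of $\mathrm{Aut}(\mathcal M)$ generated by the automorphisms fixing pointwise some small elementary submodel; $\bar a\equiv^L\bar b$ means $\bar b=\sigma(\bar a)$ for some $\sigma\in\mathrm{Autf}(\mathcal M)$. $\mathrm{Aut}(\Sigma(\mathcal M))=\{\sigma\restriction\Sigma(\mathcal M):\sigma\in\mathrm{Aut}(\mathcal M)\}$. For a cardinal $\lambda>0$, $\mathrm{Autf}^{\lambda}_{\mathrm{fix}}(\Sigma(\mathcal M))$ is the (normal) subgroup of $\mathrm{Aut}(\Sigma(\mathcal M))$ of all $\sigma\restriction\Sigma(\mathcal M)$ with $\sigma\in\mathrm{Aut}(\mathcal M)$ such that for all realizations $a_i\models\Sigma$ ($i<\lambda$) and $\bar a=(a_i)_{i<\lambda}$, $\bar a\equiv^L\sigma(\bar a)$; $\mathrm{Gal}_L^{\mathrm{fix},\lambda}(\Sigma(\mathcal M))=\mathrm{Aut}(\Sigma(\mathcal M))/\mathrm{Autf}^{\lambda}_{\mathrm{fix}}(\Sigma(\mathcal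 M))$. $\mathrm{Autf}_{\mathrm{fix}}(\Sigma(\mathcal M))$ is the analogous subgroup defined by requiring $\bar a\equiv^L\sigma(\bar a)$ for an enumeration $\bar a$ of all of $\Sigma(\mathcal M)$; it equals $\mathrm{Autf}^{\omega}_{\mathrm{fix}}(\Sigma(\mathcal M))$, and $\mathrm{Gal}_L^{\mathrm{fix}}(\Sigma(\mathcal M))=\mathrm{Aut}(\Sigma(\mathcal M))/\mathrm{Autf}_{\mathrm{fix}}(\Sigma(\mathcal M))$. *)

theory Defs
  imports "HOL-Algebra.Bij" "HOL-Algebra.Generated_Groups" "HOL-Library.Extended_Nat"
begin

section \<open>Many-sorted first-order logic\<close>

text \<open>
  The sorts are the elements of the type \<open>'s\<close>. A variable is a pair of a name and a sort, so
  there are variables \<open>(x, s) :: 'v \<times> 's\<close> of every sort. The type \<open>'v\<close> of names is arbitrary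
  (to be assumed infinite), which makes room for tuples of variables of any length.
\<close>

datatype ('f, 'x) tm = Var 'x | Fn 'f "('f, 'x) tm list"

datatype ('f, 'p, 'x) fm =
    Eq "('f, 'x) tm" "('f, 'x) tm"
  | Rel 'p "('f, 'x) tm list"
  | Neg "('f, 'p, 'x) fm"
  | Conj "('f, 'p, 'x) fm" "('f, 'p, 'x) fm"
  | Ex 'x "('f, 'p, 'x) fm"

record ('f, 'p, 's) lang =
  funs :: "'f set"
  rels :: "'p set"
  fdom :: "'f \<Rightarrow> 's list"
  fcod :: "'f \<Rightarrow> 's"
  rdom :: "'p \<Rightarrow> 's list"

primrec tm_sort :: "('f, 'p, 's) lang \<Rightarrow> ('f, 'v \<times> 's) tm \<Rightarrow> 's" where
  "tm_sort L (Var x) = snd x"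
| "tm_sort L (Fn f ts) = fcod L f"

primrec wf_tm :: "('f, 'p, 's) lang \<Rightarrow> ('f, 'v \<times> 's) tm \<Rightarrow> bool" where
  "wf_tm L (Var x) \<longleftrightarrow> True"
| "wf_tm L (Fn f ts) \<longleftrightarrow>
     f \<in> funs L \<and> map (tm_sort L) ts = fdom L f \<and> list_all (wf_tm L) ts"

primrec wf_fm :: "('f, 'p, 's) lang \<Rightarrow> ('f, 'p, 'v \<times> 's) fm \<Rightarrow> bool" where
  "wf_fm L (Eq t u) \<longleftrightarrow> wf_tm L t \<and> wf_tm L u \<and> tm_sort L t = tm_sort L u"
| "wf_fm L (Rel p ts) \<longleftrightarrow>
     p \<in> rels L \<and> map (tm_sort L) ts = rdom L p \<and> list_all (wf_tm L) ts"
| "wf_fm L (Neg \<phi>) \<longleftrightarrow> wf_fm L \<phi>"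
| "wf_fm L (Conj \<phi> \<psi>) \<longleftrightarrow> wf_fm L \<phi> \<and> wf_fm L \<psi>"
| "wf_fm L (Ex x \<phi>) \<longleftrightarrow> wf_fm L \<phi>"

primrec tm_vars :: "('f, 'x) tm \<Rightarrow> 'x set" where
  "tm_vars (Var x) = {x}"
| "tm_vars (Fn f ts) = \<Union> (set (map tm_vars ts))"

primrec fv :: "('f, 'p, 'x) fm \<Rightarrow> 'x set" where
  "fv (Eq t u) = tm_vars t \<union> tm_vars u"
| "fv (Rel p ts) = \<Union> (set (map tm_vars ts))"
| "fv (Neg \<phi>) = fv \<phi>"
| "fv (Conj \<phi> \<psi>) = fv \<phi> \<union> fv \<psi>"
| "fv (Ex x \<phi>) = fv \<phi> - {x}"

record ('f, 'p, 's, 'm) struct =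
  car :: "'s \<Rightarrow> 'm set"
  fint :: "'f \<Rightarrow> 'm list \<Rightarrow> 'm"
  rint :: "'p \<Rightarrow> 'm list \<Rightarrow> bool"

definition universe :: "('f, 'p, 's, 'm) struct \<Rightarrow> 'm set" where
  "universe M = (\<Union>s. car M s)"

definition tuples :: "('f, 'p, 's, 'm) struct \<Rightarrow> 's list \<Rightarrow> 'm list set" where
  "tuples M ss = {as. list_all2 (\<lambda>a s. a \<in> car M s) as ss}"

text \<open>
  The carriers of different sorts are disjoint, so a sort-preserving family of maps is the
  same thing as one map on \<^term>\<open>universe M\<close>.
\<close>

definition is_structure :: "('f, 'p, 's) lang \<Rightarrow> ('f, 'p, 's, 'm) struct \<Rightarrow> bool" where
  "is_structure L M \<longleftrightarrow>
     (\<forall>s. car M s \<noteq> {}) \<and>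
     (\<forall>s t. s \<noteq> t \<longrightarrow> car M s \<inter> car M t = {}) \<and>
     (\<forall>f\<in>funs L. \<forall>as\<in>tuples M (fdom L f). fint M f as \<in> car M (fcod L f))"

primrec tm_val :: "('f, 'p, 's, 'm) struct \<Rightarrow> ('x \<Rightarrow> 'm) \<Rightarrow> ('f, 'x) tm \<Rightarrow> 'm" where
  "tm_val M v (Var x) = v x"
| "tm_val M v (Fn f ts) = fint M f (map (tm_val M v) ts)"

primrec sat ::
  "('f, 'p, 's, 'm) struct \<Rightarrow> ('v \<times> 's \<Rightarrow> 'm) \<Rightarrow> ('f, 'p, 'v \<times> 's) fm \<Rightarrow> bool" where
  "sat M v (Eq t u) \<longleftrightarrow> tm_val M v t = tm_val M v u"
| "sat M v (Rel p ts) \<longleftrightarrow> rint M p (map (tm_val M v) ts)"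
| "sat M v (Neg \<phi>) \<longleftrightarrow> \<not> sat M v \<phi>"
| "sat M v (Conj \<phi> \<psi>) \<longleftrightarrow> sat M v \<phi> \<and> sat M v \<psi>"
| "sat M v (Ex x \<phi>) \<longleftrightarrow> (\<exists>a\<in>car M (snd x). sat M (v(x := a)) \<phi>)"

definition assignments :: "('f, 'p, 's, 'm) struct \<Rightarrow> ('v \<times> 's \<Rightarrow> 'm) set" where
  "assignments M = {v. \<forall>x. v x \<in> car M (snd x)}"

definition sentences :: "('f, 'p, 's) lang \<Rightarrow> ('f, 'p, 'v \<times> 's) fm set" where
  "sentences L = {\<phi>. wf_fm L \<phi> \<and> fv \<phi> = {}}"

text \<open>
  A complete theory is identified with its deductive closure, i.e. with a set of sentences
  that decides every sentence; its consistency comes from its having models.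
\<close>

definition complete_theory ::
  "('f, 'p, 's) lang \<Rightarrow> ('f, 'p, 'v \<times> 's) fm set \<Rightarrow> bool" where
  "complete_theory L T \<longleftrightarrow>
     T \<subseteq> sentences L \<and> (\<forall>\<phi>\<in>sentences L. \<phi> \<in> T \<longleftrightarrow> Neg \<phi> \<notin> T)"

definition is_model ::
  "('f, 'p, 's) lang \<Rightarrow> ('f, 'p, 'v \<times> 's) fm set \<Rightarrow> ('f, 'p, 's, 'm) struct \<Rightarrow> bool" where
  "is_model L T M \<longleftrightarrow>
     is_structure L M \<and> (\<forall>\<phi>\<in>T. \<forall>v\<in>assignments M. sat M v \<phi>)"

text \<open>
  \<open>K\<close> is an elementary submodel of \<open>M\<close>. The type of the variable names has to be passed
  explicitly. Applying the condition to atomic formulas shows that \<open>K\<close> is a substructure.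
\<close>

definition elem_submodel ::
  "'v itself \<Rightarrow> ('f, 'p, 's) lang \<Rightarrow> ('f, 'p, 's, 'm) struct \<Rightarrow> ('f, 'p, 's, 'm) struct \<Rightarrow> bool"
  where
  "elem_submodel _ L K M \<longleftrightarrow>
     is_structure L K \<and> is_structure L M \<and> (\<forall>s. car K s \<subseteq> car M s) \<and>
     (\<forall>\<phi> :: ('f, 'p, 'v \<times> 's) fm. wf_fm L \<phi> \<longrightarrow>
        (\<forall>v\<in>assignments K. sat K v \<phi> \<longleftrightarrow> sat M v \<phi>))"


section \<open>Monster models\<close>

definition small :: "('f, 'p, 's, 'm) struct \<Rightarrow> 'a set \<Rightarrow> bool" where
  "small M A \<longleftrightarrow> (card_of A, card_of (universe M)) \<in> ordLess"

text \<open>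
  A set \<open>p\<close> of formulas in the single variable \<open>x\<close> with parameters from \<open>A\<close> is encoded as a
  set of pairs \<open>(\<phi>, v)\<close>, where \<open>v\<close> gives the parameters of \<open>\<phi>\<close>, i.e. the values in \<open>A\<close> of the
  free variables other than \<open>x\<close>.
\<close>

definition saturated ::
  "'v itself \<Rightarrow> ('f, 'p, 's) lang \<Rightarrow> ('f, 'p, 's, 'm) struct \<Rightarrow> bool" where
  "saturated _ L M \<longleftrightarrow>
     (\<forall>A (x :: 'v \<times> 's) (p :: (('f, 'p, 'v \<times> 's) fm \<times> ('v \<times> 's \<Rightarrow> 'm)) set).
        A \<subseteq> universe M \<and> small M A \<and>
        (\<forall>(\<phi>, v)\<in>p. wf_fm L \<phi> \<and> v \<in> assignments M \<and> (\<forall>y\<in>fv \<phi> - {x}. v y \<in> A)) \<and>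
        (\<forall>q. finite q \<and> q \<subseteq> p \<longrightarrow>
           (\<exists>c\<in>car M (snd x). \<forall>(\<phi>, v)\<in>q. sat M (v(x := c)) \<phi>))
        \<longrightarrow> (\<exists>c\<in>car M (snd x). \<forall>(\<phi>, v)\<in>p. sat M (v(x := c)) \<phi>))"

text \<open>\<open>D \<subseteq> tuples M ss\<close> is definable without parameters.\<close>

definition definable ::
  "'v itself \<Rightarrow> ('f, 'p, 's) lang \<Rightarrow> ('f, 'p, 's, 'm) struct \<Rightarrow> 's list \<Rightarrow> 'm list set \<Rightarrow> bool"
  where
  "definable _ L M ss D \<longleftrightarrow>
     (\<exists>(\<phi> :: ('f, 'p, 'v \<times> 's) fm) xs. wf_fm L \<phi> \<and> distinct xs \<and> map snd xs = ss \<and> fv \<phi> \<subseteq> set xs \<and>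
        D = {map v xs | v. v \<in> assignments M \<and> sat M v \<phi>})"

text \<open>
  \<open>M = M\<^sup>e\<^sup>q\<close>: every class of a definable equivalence relation on tuples is an element of
  some sort. That is, every such relation is the kernel of a definable surjection onto a sort.
\<close>

definition eq_closed ::
  "'v itself \<Rightarrow> ('f, 'p, 's) lang \<Rightarrow> ('f, 'p, 's, 'm) struct \<Rightarrow> bool" where
  "eq_closed V L M \<longleftrightarrow>
     (\<forall>ss E. equiv (tuples M ss) E \<and> definable V L M (ss @ ss) {as @ bs | as bs. (as, bs) \<in> E} \<longrightarrow>
        (\<exists>s \<pi>. \<pi> ` tuples M ss = car M s \<and>
           definable V L M (ss @ [s]) {as @ [\<pi> as] | as. as \<in> tuples M ss} \<and>
           (\<forall>as\<in>tuples M ss. \<forall>bs\<in>tuples M ss. (as, bs) \<in> E \<longleftrightarrow> \<pi> as = \<pi> bs)))"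

text \<open>
  A monster model is saturated (in its own cardinality) and larger than the language
  (symbols, sorts and \<open>\<aleph>\<^sub>0\<close>).
\<close>

definition monster ::
  "('f, 'p, 's) lang \<Rightarrow> ('f, 'p, 'v \<times> 's) fm set \<Rightarrow> ('f, 'p, 's, 'm) struct \<Rightarrow> bool" where
  "monster L T M \<longleftrightarrow>
     is_model L T M \<and> saturated TYPE('v) L M \<and> eq_closed TYPE('v) L M \<and>
     small M (UNIV :: nat set) \<and> small M (UNIV :: 's set) \<and> small M (funs L) \<and> small M (rels L)"


section \<open>Automorphisms and Lascar types\<close>

definition auts :: "('f, 'p, 's) lang \<Rightarrow> ('f, 'p, 's, 'm) struct \<Rightarrow> ('m \<Rightarrow> 'm) set" where
  "auts L M = {\<sigma> \<in> Bij (universe M).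
     (\<forall>s. \<sigma> ` car M s = car M s) \<and>
     (\<forall>f\<in>funs L. \<forall>as\<in>tuples M (fdom L f). \<sigma> (fint M f as) = fint M f (map \<sigma> as)) \<and>
     (\<forall>p\<in>rels L. \<forall>as\<in>tuples M (rdom L p). rint M p (map \<sigma> as) \<longleftrightarrow> rint M p as)}"

definition Aut :: "('f, 'p, 's) lang \<Rightarrow> ('f, 'p, 's, 'm) struct \<Rightarrow> ('m \<Rightarrow> 'm) monoid" where
  "Aut L M = (BijGroup (universe M))\<lparr>carrier := auts L M\<rparr>"

definition Autf ::
  "'v itself \<Rightarrow> ('f, 'p, 's) lang \<Rightarrow> ('f, 'p, 's, 'm) struct \<Rightarrow> ('m \<Rightarrow> 'm) set" where
  "Autf V L M = generate (Aut L M)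
     {\<sigma> \<in> auts L M. \<exists>K. elem_submodel V L K M \<and> small M (universe K) \<and>
        (\<forall>a\<in>universe K. \<sigma> a = a)}"

text \<open>
  The variables \<open>\<bar>x\<close> form a set \<open>X\<close>, and an \<open>\<bar>x\<close>-tuple of elements is an extensional
  function on \<open>X\<close>. A map \<open>\<sigma>\<close> takes the tuple \<open>a\<close> to \<^term>\<open>compose X \<sigma> a\<close>.
\<close>

definition partial_type ::
  "('f, 'p, 's) lang \<Rightarrow> ('f, 'p, 's, 'm) struct \<Rightarrow> ('v \<times> 's) set \<Rightarrow> ('f, 'p, 'v \<times> 's) fm set \<Rightarrow> bool"
  where
  "partial_type L M X \<Sigma> \<longleftrightarrow>
     (\<forall>\<phi>\<in>\<Sigma>. wf_fm L \<phi> \<and> fv \<phi> \<subseteq> X) \<and>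
     (\<forall>F. finite F \<and> F \<subseteq> \<Sigma> \<longrightarrow> (\<exists>v\<in>assignments M. \<forall>\<phi>\<in>F. sat M v \<phi>))"

definition realizations ::
  "('f, 'p, 's, 'm) struct \<Rightarrow> ('v \<times> 's) set \<Rightarrow> ('f, 'p, 'v \<times> 's) fm set \<Rightarrow> ('v \<times> 's \<Rightarrow> 'm) set" where
  "realizations M X \<Sigma> = {a \<in> (\<Pi>\<^sub>E x\<in>X. car M (snd x)). \<forall>\<phi>\<in>\<Sigma>. sat M a \<phi>}"

text \<open>
  Equality of Lascar types in \<open>M\<close> of the long tuples \<open>(a j)\<^bsub>j \<in> J\<^esub>\<close> and \<open>(b j)\<^bsub>j \<in> J\<^esub>\<close>, whose
  entries are \<open>\<bar>x\<close>-tuples.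
\<close>

definition lascar_eq ::
  "('f, 'p, 's) lang \<Rightarrow> ('f, 'p, 's, 'm) struct \<Rightarrow> ('v \<times> 's) set \<Rightarrow> 'j set \<Rightarrow>
   ('j \<Rightarrow> 'v \<times> 's \<Rightarrow> 'm) \<Rightarrow> ('j \<Rightarrow> 'v \<times> 's \<Rightarrow> 'm) \<Rightarrow> bool" where
  "lascar_eq L M X J a b \<longleftrightarrow>
     (\<exists>\<tau>\<in>Autf TYPE('v) L M. \<forall>j\<in>J. b j = compose X \<tau> (a j))"


section \<open>Relativized Lascar Galois groups\<close>

definition restr ::
  "('f, 'p, 's, 'm) struct \<Rightarrow> ('v \<times> 's) set \<Rightarrow> ('f, 'p, 'v \<times> 's) fm set \<Rightarrow>
   ('m \<Rightarrow> 'm) \<Rightarrow> ('v \<times> 's \<Rightarrow> 'm) \<Rightarrow> ('v \<times> 's \<Rightarrow> 'm)" where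
  "restr M X \<Sigma> \<sigma> = (\<lambda>a\<in>realizations M X \<Sigma>. compose X \<sigma> a)"

definition Aut_real ::
  "('f, 'p, 's) lang \<Rightarrow> ('f, 'p, 's, 'm) struct \<Rightarrow> ('v \<times> 's) set \<Rightarrow> ('f, 'p, 'v \<times> 's) fm set \<Rightarrow>
   (('v \<times> 's \<Rightarrow> 'm) \<Rightarrow> ('v \<times> 's \<Rightarrow> 'm)) monoid" where
  "Aut_real L M X \<Sigma> =
     (BijGroup (realizations M X \<Sigma>))\<lparr>carrier := restr M X \<Sigma> ` auts L M\<rparr>"

text \<open>The cardinals \<open>\<lambda> \<le> \<omega>\<close> are the elements of \<^typ>\<open>enat\<close>, with \<open>\<omega>\<close> being \<open>\<infinity>\<close>.\<close>

definition Autf_fix_upto ::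
  "enat \<Rightarrow> ('f, 'p, 's) lang \<Rightarrow> ('f, 'p, 's, 'm) struct \<Rightarrow> ('v \<times> 's) set \<Rightarrow>
   ('f, 'p, 'v \<times> 's) fm set \<Rightarrow> (('v \<times> 's \<Rightarrow> 'm) \<Rightarrow> ('v \<times> 's \<Rightarrow> 'm)) set" where
  "Autf_fix_upto l L M X \<Sigma> = {restr M X \<Sigma> \<sigma> | \<sigma>. \<sigma> \<in> auts L M \<and>
     (\<forall>a :: nat \<Rightarrow> 'v \<times> 's \<Rightarrow> 'm. (\<forall>i. enat i < l \<longrightarrow> a i \<in> realizations M X \<Sigma>) \<longrightarrow>
        lascar_eq L M X {i. enat i < l} a (\<lambda>i. compose X \<sigma> (a i)))}"

definition Gal_fix_upto ::
  "enat \<Rightarrow> ('f, 'p, 's) lang \<Rightarrow> ('f, 'p, 's, 'm) struct \<Rightarrow> ('v \<times> 's) set \<Rightarrow>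
   ('f, 'p, 'v \<times> 's) fm set \<Rightarrow> (('v \<times> 's \<Rightarrow> 'm) \<Rightarrow> ('v \<times> 's \<Rightarrow> 'm)) set monoid" where
  "Gal_fix_upto l L M X \<Sigma> = Aut_real L M X \<Sigma> Mod Autf_fix_upto l L M X \<Sigma>"

text \<open>
  The enumeration of all of \<open>\<Sigma>(M)\<close> is not a small tuple of \<open>M\<close>. As usual for such tuples, its
  Lascar type is computed in a monster model \<open>N\<close>, an elementary extension of \<open>M\<close> in which it
  is small. (In \<open>M\<close> itself, fewer tuples may be found to have the same Lascar type: if \<open>R\<close> is
  a random bipartite graph between sorts \<open>P\<close>, \<open>Q\<close>, and \<open>E\<close> an equivalence relation with two
  generic classes on \<open>Q\<close>, then an automorphism exchanging the classes is determined by its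
  restriction to \<open>P\<close>. That restriction is not induced by an element of \<open>Autf(M)\<close>, although it
  preserves the Lascar types of all small tuples from \<open>P\<close>.)
\<close>

definition Autf_fix ::
  "('f, 'p, 's) lang \<Rightarrow> ('f, 'p, 's, 'm) struct \<Rightarrow> ('f, 'p, 's, 'm) struct \<Rightarrow> ('v \<times> 's) set \<Rightarrow>
   ('f, 'p, 'v \<times> 's) fm set \<Rightarrow> (('v \<times> 's \<Rightarrow> 'm) \<Rightarrow> ('v \<times> 's \<Rightarrow> 'm)) set" where
  "Autf_fix L M N X \<Sigma> = {restr M X \<Sigma> \<sigma> | \<sigma>. \<sigma> \<in> auts L M \<and>
     lascar_eq L N X (realizations M X \<Sigma>) (\<lambda>a. a) (\<lambda>a. compose X \<sigma> a)}"

definition Gal_fix ::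
  "('f, 'p, 's) lang \<Rightarrow> ('f, 'p, 's, 'm) struct \<Rightarrow> ('f, 'p, 's, 'm) struct \<Rightarrow> ('v \<times> 's) set \<Rightarrow>
   ('f, 'p, 'v \<times> 's) fm set \<Rightarrow> (('v \<times> 's \<Rightarrow> 'm) \<Rightarrow> ('v \<times> 's \<Rightarrow> 'm)) set monoid" where
  "Gal_fix L M N X \<Sigma> = Aut_real L M X \<Sigma> Mod Autf_fix L M N X \<Sigma>"

end

theory Submission
  imports Defs "HOL-Algebra.Free_Abelian_Groups"
begin

text \<open>
  Types over small sets are realized in monster models, and small elementary maps extend to
  automorphisms. So two monster models of the complete theory \<open>T\<close> see the same small
  configurations, and the task is to express the Galois groups through them, without comparing
  the sizes of the two models.

  Both models have elementary submodels of cardinality at most that of the language, and these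
  can be chosen to correspond under an elementary bijection \<open>E\<close> (\<open>ex_common_submodel\<close>). An
  automorphism \<open>\<sigma>\<close> of \<open>M\<close> is determined modulo Lascar strong automorphisms by the type of the
  image of the submodel over the submodel. Call \<open>\<sigma>\<close> and an automorphism \<open>\<tau>\<close> of \<open>M'\<close> corresponding
  if \<open>E\<close> matches these types. This relation is total on both sides by saturation and homogeneity
  (\<open>corresponding_total\<close>), it is multiplicative modulo Lascar strong automorphisms
  (\<open>corresponding_mult\<close>), and it respects the subgroup of the automorphisms that move all
  \<open>l\<close>-tuples of realizations within their Lascar types (\<open>corresponding_fix_auts\<close>). Hence it induces an
  isomorphism of the quotients (\<open>quotient_iso_of_relation\<close>).

  The last property rests on the transfer of Lascar strong automorphisms along small elementary
  maps (\<open>transfer_words\<close>). A Lascar strong automorphism is a product of automorphisms each of which fixes a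
  small submodel, but this submodel of \<open>M\<close> need not be small in \<open>M'\<close>. By compactness it may be replaced by
  a conjugate of any prescribed small set \<open>C\<close>: if \<open>\<sigma>\<close> fixes the submodel \<open>D\<close>, then
  every finite part of the type of \<open>C\<close> is realized in \<open>D\<close>, and over elements of \<open>D\<close> a tuple and its
  image under \<open>\<sigma>\<close> satisfy the same formulas. The same argument shows that being moved by a
  product of \<open>n\<close> such automorphisms is a property of finite subtuples (\<open>realize_words\<close>).

  For the group \<open>Gal_fix\<close> it remains to see that the Lascar type of the enumeration of all
  realizations is controlled by countable tuples (\<open>Autf_fix_eq_upto\<close>). If all countable tuples are
  moved within their Lascar types, then the number of factors is bounded for all finite tuples
  (\<open>bounded_Lascar_distance\<close>), and \<open>realize_words\<close> applies in the larger monster model.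
\<close>

text \<open>Free abelian groups are imported for the cardinal arithmetic that their theory is based on.\<close>

unbundle cardinal_syntax

section \<open>Substitution and quantifier prefixes\<close>

lemma tm_val_cong: "(\<And>x. x \<in> tm_vars t \<Longrightarrow> v x = w x) \<Longrightarrow> tm_val M v t = tm_val M w t"
proof (induction t)
  case (Fn f ts)
  then have "map (tm_val M v) ts = map (tm_val M w) ts" by auto
  then show ?case by (simp only: tm_val.simps)
qed simp

lemma sat_cong: "(\<And>x. x \<in> fv \<phi> \<Longrightarrow> v x = w x) \<Longrightarrow> sat M v \<phi> = sat M w \<phi>"
proof (induction \<phi> arbitrary: v w)
  case (Eq t u)
  then show ?case by (simp add: tm_val_cong[of t v w] tm_val_cong[of u v w])
next
  case (Rel p ts)
  then have "map (tm_val M v) ts = map (tm_val M w) ts"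
    by (auto intro!: tm_val_cong)
  then show ?case by (simp only: sat.simps)
next
  case (Neg \<phi>)
  then show ?case by (metis fv.simps(3) sat.simps(3))
next
  case (Conj \<phi>1 \<phi>2)
  then show ?case by (metis Un_iff fv.simps(4) sat.simps(4))
next
  case (Ex x \<phi>)
  have "sat M (v(x := a)) \<phi> = sat M (w(x := a)) \<phi>" for a
    by (rule Ex.IH) (use Ex.prems in auto)
  then show ?case by simp
qed

lemma finite_tm_vars [simp]: "finite (tm_vars t)"
  by (induction t) auto

lemma finite_fv [simp]: "finite (fv \<phi>)"
  by (induction \<phi>) auto

text \<open>
  Capture-avoiding substitution of variables for variables, possibly with names from another
  type. A bound variable is replaced by some variable of the same sort outside the range of
  the substitution on the remaining free variables; hence the new type of names has to be infinite.
\<close>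

primrec sub :: "('f, 'p, 'u \<times> 's) fm \<Rightarrow> ('u \<times> 's \<Rightarrow> 'w \<times> 's) \<Rightarrow> ('f, 'p, 'w \<times> 's) fm" where
  "sub (Eq t u) = (\<lambda>\<theta>. Eq (map_tm (\<lambda>f. f) \<theta> t) (map_tm (\<lambda>f. f) \<theta> u))"
| "sub (Rel p ts) = (\<lambda>\<theta>. Rel p (map (map_tm (\<lambda>f. f) \<theta>) ts))"
| "sub (Neg \<phi>) = (\<lambda>\<theta>. Neg (sub \<phi> \<theta>))"
| "sub (Conj \<phi> \<psi>) = (\<lambda>\<theta>. Conj (sub \<phi> \<theta>) (sub \<psi> \<theta>))"
| "sub (Ex x \<phi>) = (\<lambda>\<theta>. let y = (SOME y. y \<notin> \<theta> ` (fv \<phi> - {x}) \<and> snd y = snd x)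
     in Ex y (sub \<phi> (\<theta>(x := y))))"

lemma fresh_var:
  fixes F :: "('w \<times> 's) set"
  assumes "infinite (UNIV :: 'w set)" "finite F"
  shows "(SOME y. y \<notin> F \<and> snd y = s) \<notin> F \<and> snd (SOME y. y \<notin> F \<and> snd y = s) = s"
proof (rule someI_ex)
  obtain n where "n \<notin> fst ` F"
    using ex_new_if_finite[OF assms(1), of "fst ` F"] assms(2) by blast
  then have "(n, s) \<notin> F" by force
  then show "\<exists>y. y \<notin> F \<and> snd y = s" by (intro exI[of _ "(n, s)"]) simp
qed

lemma tm_vars_map: "tm_vars (map_tm (\<lambda>f. f) \<theta> t) = \<theta> ` tm_vars t"
  by (induction t) auto

lemma tm_val_map: "tm_val M v (map_tm (\<lambda>f. f) \<theta> t) = tm_val M (v \<circ> \<theta>) t"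
proof (induction t)
  case (Fn f ts)
  then have "map (tm_val M v) (map (map_tm (\<lambda>f. f) \<theta>) ts) = map (tm_val M (v \<circ> \<theta>)) ts" by (auto simp: comp_def)
  then show ?case by (simp only: tm_val.simps tm.map)
qed simp

lemma tm_sort_map: "(\<And>y. y \<in> tm_vars t \<Longrightarrow> snd (\<theta> y) = snd y) \<Longrightarrow> tm_sort L (map_tm (\<lambda>f. f) \<theta> t) = tm_sort L t"
  by (cases t) auto

lemma wf_tm_map:
  "(\<And>y. y \<in> tm_vars t \<Longrightarrow> snd (\<theta> y) = snd y) \<Longrightarrow> wf_tm L t \<Longrightarrow> wf_tm L (map_tm (\<lambda>f. f) \<theta> t)"
proof (induction t)
  case (Fn f ts)
  have "map (tm_sort L) (map (map_tm (\<lambda>f. f) \<theta>) ts) = map (tm_sort L) ts"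
    using Fn.prems(1) by (auto intro!: tm_sort_map)
  moreover have "wf_tm L (map_tm (\<lambda>f. f) \<theta> t)" if "t \<in> set ts" for t
    using Fn that by (auto simp: list_all_iff)
  ultimately show ?case using Fn.prems(2) by (auto simp: list_all_iff simp del: map_map)
qed simp

lemma fv_sub:
  fixes \<theta> :: "'u \<times> 's \<Rightarrow> 'w \<times> 's"
  assumes "infinite (UNIV :: 'w set)"
  shows "fv (sub \<phi> \<theta>) = \<theta> ` fv \<phi>"
proof (induction \<phi> arbitrary: \<theta>)
  case (Ex x \<phi>)
  define y where "y = (SOME y. y \<notin> \<theta> ` (fv \<phi> - {x}) \<and> snd y = snd x)"
  have "y \<notin> \<theta> ` (fv \<phi> - {x})"
    using fresh_var[OF assms, of "\<theta> ` (fv \<phi> - {x})"] by (simp add: y_def)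
  then show ?case by (auto simp: Let_def Ex.IH y_def[symmetric])
qed (auto simp: tm_vars_map)

lemma wf_sub:
  fixes \<theta> :: "'u \<times> 's \<Rightarrow> 'w \<times> 's"
  assumes inf: "infinite (UNIV :: 'w set)"
  shows "wf_fm L \<phi> \<Longrightarrow> (\<And>y. y \<in> fv \<phi> \<Longrightarrow> snd (\<theta> y) = snd y) \<Longrightarrow> wf_fm L (sub \<phi> \<theta>)"
proof (induction \<phi> arbitrary: \<theta>)
  case (Rel p ts)
  have "map (\<lambda>t. tm_sort L (map_tm (\<lambda>f. f) \<theta> t)) ts = map (tm_sort L) ts"
    using Rel.prems(2) by (auto intro!: tm_sort_map)
  with Rel show ?case by (auto simp: list_all_iff comp_def intro!: wf_tm_map)
next
  case (Ex x \<phi>)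
  define y where "y = (SOME y. y \<notin> \<theta> ` (fv \<phi> - {x}) \<and> snd y = snd x)"
  have y: "snd y = snd x"
    using fresh_var[OF inf, of "\<theta> ` (fv \<phi> - {x})"] by (simp add: y_def)
  have "wf_fm L (sub \<phi> (\<theta>(x := y)))"
    by (rule Ex.IH) (use Ex.prems y in auto)
  then show ?case by (simp add: Let_def y_def[symmetric])
qed (auto intro!: wf_tm_map simp: tm_sort_map)

lemma sat_sub:
  fixes \<theta> :: "'u \<times> 's \<Rightarrow> 'w \<times> 's"
  assumes inf: "infinite (UNIV :: 'w set)"
  shows "sat M v (sub \<phi> \<theta>) = sat M (v \<circ> \<theta>) \<phi>"
proof (induction \<phi> arbitrary: \<theta> v)
  case (Rel p ts)
  have "map (tm_val M v) (map (map_tm (\<lambda>f. f) \<theta>) ts) = map (tm_val M (v \<circ> \<theta>)) ts"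
    by (simp add: tm_val_map)
  then show ?case by (simp only: sat.simps sub.simps)
next
  case (Ex x \<phi>)
  define y where "y = (SOME y. y \<notin> \<theta> ` (fv \<phi> - {x}) \<and> snd y = snd x)"
  have y: "y \<notin> \<theta> ` (fv \<phi> - {x})" "snd y = snd x"
    using fresh_var[OF inf, of "\<theta> ` (fv \<phi> - {x})"] by (simp_all add: y_def)
  have "sat M (v(y := a) \<circ> \<theta>(x := y)) \<phi> = sat M ((v \<circ> \<theta>)(x := a)) \<phi>" for a
    by (rule sat_cong) (use y in auto)
  then show ?case by (simp only: sub.simps Let_def y_def[symmetric] Ex.IH y(2) sat.simps)
qed (auto simp: tm_val_map)

text \<open>
  Quantification over a list of variables, and conjunctions of lists of formulas. The conjunction
  starts from \<open>x = x\<close>, so that the empty one is true.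
\<close>

definition exs :: "'x list \<Rightarrow> ('f, 'p, 'x) fm \<Rightarrow> ('f, 'p, 'x) fm" where
  "exs xs \<phi> = foldr Ex xs \<phi>"

definition conjs :: "'x \<Rightarrow> ('f, 'p, 'x) fm list \<Rightarrow> ('f, 'p, 'x) fm" where
  "conjs x \<phi>s = foldr Conj \<phi>s (Eq (Var x) (Var x))"

lemma wf_exs [simp]: "wf_fm L (exs xs \<phi>) \<longleftrightarrow> wf_fm L \<phi>"
  by (induction xs) (auto simp: exs_def)

lemma fv_exs [simp]: "fv (exs xs \<phi>) = fv \<phi> - set xs"
  by (induction xs) (auto simp: exs_def)

lemma wf_conjs [simp]: "wf_fm L (conjs x \<phi>s) \<longleftrightarrow> (\<forall>\<phi>\<in>set \<phi>s. wf_fm L \<phi>)"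
  by (induction \<phi>s) (auto simp: conjs_def)

lemma fv_conjs [simp]: "fv (conjs x \<phi>s) = insert x (\<Union> (fv ` set \<phi>s))"
  by (induction \<phi>s) (auto simp: conjs_def)

lemma sat_conjs [simp]: "sat M v (conjs x \<phi>s) \<longleftrightarrow> (\<forall>\<phi>\<in>set \<phi>s. sat M v \<phi>)"
  by (induction \<phi>s) (auto simp: conjs_def)

lemma exs_Cons: "exs (x # xs) \<phi> = Ex x (exs xs \<phi>)"
  by (simp add: exs_def)

lemma exs_Nil: "exs [] \<phi> = \<phi>"
  by (simp add: exs_def)

lemma sat_exs:
  "sat M v (exs xs \<phi>) \<longleftrightarrow>
     (\<exists>w. (\<forall>x. x \<notin> set xs \<longrightarrow> w x = v x) \<and> (\<forall>x\<in>set xs. w x \<in> car M (snd x)) \<and> sat M w \<phi>)"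
proof (induction xs arbitrary: v)
  case Nil
  have "(\<forall>x. w x = v x) \<longleftrightarrow> w = v" for w by auto
  then show ?case by (simp add: exs_Nil)
next
  case (Cons x xs)
  show ?case (is "?l = ?r")
  proof
    assume ?l
    then obtain a w where w: "a \<in> car M (snd x)" "\<And>y. y \<notin> set xs \<Longrightarrow> w y = (v(x := a)) y"
      "\<forall>y\<in>set xs. w y \<in> car M (snd y)" "sat M w \<phi>"
      unfolding exs_Cons sat.simps Cons.IH by blast
    have "w x \<in> car M (snd x)"
      using w by (cases "x \<in> set xs") auto
    with w show ?r by (intro exI[of _ w]) simp
  next
    assume ?r
    then obtain w where w: "\<forall>y. y \<notin> set (x # xs) \<longrightarrow> w y = v y"
      "\<forall>y\<in>set (x # xs). w y \<in> car M (snd y)" "sat M w \<phi>" by auto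
    have "sat M (v(x := w x)) (exs xs \<phi>)"
      unfolding Cons.IH by (rule exI[of _ w]) (use w in auto)
    then show ?l using w by (auto simp: exs_Cons)
  qed
qed

text \<open>Finitely many variables can be given names in any infinite type, one of them freely chosen.\<close>

lemma fresh_names:
  fixes x :: "'u \<times> 's" and x0 :: "'w \<times> 's"
  assumes inf: "infinite (UNIV :: 'w set)" and "finite F" and "snd x0 = snd x"
  obtains \<theta> :: "'u \<times> 's \<Rightarrow> 'w \<times> 's" and \<eta> :: "'w \<times> 's \<Rightarrow> 'u \<times> 's"
  where "\<theta> x = x0" "\<And>y. snd (\<theta> y) = snd y" "\<And>z. snd (\<eta> z) = snd z"
    "\<And>y. y \<in> insert x F \<Longrightarrow> \<eta> (\<theta> y) = y"
proof -
  define N where "N = fst ` F - {fst x}"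
  have "infinite (UNIV - {fst x0})" using inf by simp
  then obtain B where B: "finite B" "card B = card N" "B \<subseteq> UNIV - {fst x0}"
    using infinite_arbitrarily_large by blast
  have "finite N" using assms(2) by (simp add: N_def)
  then obtain h where "bij_betw h N B"
    using B finite_same_card_bij[of N B] by metis
  then have h: "inj_on h N" "h ` N \<subseteq> UNIV - {fst x0}"
    using B(3) by (auto simp: bij_betw_def)
  define k where "k = h(fst x := fst x0)"
  have k: "inj_on k (insert (fst x) (fst ` F))"
  proof -
    have "insert (fst x) (fst ` F) = insert (fst x) N" by (auto simp: N_def)
    moreover have "inj_on k N"
      using h(1) by (rule inj_on_cong[THEN iffD1, rotated]) (auto simp: k_def N_def)
    moreover have "k (fst x) \<notin> k ` N"
      using h(2) by (auto simp: k_def N_def)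
    moreover have "fst x \<notin> N" by (simp add: N_def)
    ultimately show ?thesis by simp
  qed
  define \<theta> :: "'u \<times> 's \<Rightarrow> 'w \<times> 's" where "\<theta> = (\<lambda>y. (k (fst y), snd y))"
  define \<eta> :: "'w \<times> 's \<Rightarrow> 'u \<times> 's"
    where "\<eta> = (\<lambda>z. (inv_into (insert (fst x) (fst ` F)) k (fst z), snd z))"
  show ?thesis
  proof (rule that)
    show "\<theta> x = x0" using assms(3) by (simp add: \<theta>_def k_def prod_eq_iff)
    show "\<eta> (\<theta> y) = y" if "y \<in> insert x F" for y
      using inv_into_f_f[OF k, of "fst y"] that by (auto simp: \<theta>_def \<eta>_def)
  qed (simp_all add: \<theta>_def \<eta>_def)
qed

section \<open>Small sets\<close>

lemma monsterD:
  assumes "monster L T M"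
  shows "is_structure L M" "infinite (universe M)"
  using assms infinite_iff_card_of_nat ordLess_imp_ordLeq
  by (auto simp: monster_def is_model_def small_def)

lemma small_mono: "small M B \<Longrightarrow> A \<subseteq> B \<Longrightarrow> small M A"
  unfolding small_def using card_of_mono1 ordLeq_ordLess_trans by blast

lemma small_image: "small M A \<Longrightarrow> small M (f ` A)"
  unfolding small_def using card_of_image ordLeq_ordLess_trans by blast

lemma small_image_mono: "small M A \<Longrightarrow> B \<subseteq> f ` A \<Longrightarrow> small M B"
  using small_image small_mono by blast

lemma small_Un: "infinite (universe M) \<Longrightarrow> small M A \<Longrightarrow> small M B \<Longrightarrow> small M (A \<union> B)"
  unfolding small_def by (rule card_of_Un_ordLess_infinite)

lemma small_Plus: "infinite (universe M) \<Longrightarrow> small M A \<Longrightarrow> small M B \<Longrightarrow> small M (A <+> B)"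
  unfolding small_def by (rule card_of_Plus_ordLess_infinite)

lemma small_Times: "infinite (universe M) \<Longrightarrow> small M A \<Longrightarrow> small M B \<Longrightarrow> small M (A \<times> B)"
  unfolding small_def by (rule card_of_Times_ordLess_infinite)

lemma small_finite: "infinite (universe M) \<Longrightarrow> finite A \<Longrightarrow> small M A"
  unfolding small_def
  using finite_ordLess_infinite[of "|A|" "|universe M|"]
  by (simp add: card_of_Well_order Field_card_of)

section \<open>Realizing types in many variables\<close>

lemma car_disjoint: "is_structure L M \<Longrightarrow> a \<in> car M s \<Longrightarrow> a \<in> car M t \<Longrightarrow> s = t"
  unfolding is_structure_def by blast

text \<open>
  The assignment \<open>v\<close> respects the sorts of the variables in \<open>I\<close>.
\<close>

definition srt :: "('f, 'p, 's, 'm) struct \<Rightarrow> ('u \<times> 's \<Rightarrow> 'm) \<Rightarrow> ('u \<times> 's) set \<Rightarrow> bool" where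
  "srt M v I \<longleftrightarrow> (\<forall>x\<in>I. v x \<in> car M (snd x))"

text \<open>
  An arbitrary element of each sort, used to complete partial assignments.
\<close>

definition some_elem :: "('f, 'p, 's, 'm) struct \<Rightarrow> 's \<Rightarrow> 'm" where
  "some_elem M s = (SOME a. a \<in> car M s)"

lemma some_elem_in: "is_structure L M \<Longrightarrow> some_elem M s \<in> car M s"
  unfolding some_elem_def is_structure_def by (meson all_not_in_conv someI_ex)

text \<open>
  Saturation speaks about formulas with names in \<open>'v\<close>. As only finitely many variables occur
  in each formula, it extends to formulas with names in any other type.
\<close>

lemma saturated_names:
  fixes T :: "('f, 'p, 'v \<times> 's) fm set" and M :: "('f, 'p, 's, 'm) struct"
    and x :: "'u \<times> 's" and p :: "('f, 'p, 'u \<times> 's) fm set"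
  assumes inf: "infinite (UNIV :: 'v set)" and M: "monster L T M"
    and I: "small M I" "srt M v I"
    and p: "\<And>\<phi>. \<phi> \<in> p \<Longrightarrow> wf_fm L \<phi> \<and> fv \<phi> \<subseteq> insert x I"
    and fin: "\<And>q. finite q \<Longrightarrow> q \<subseteq> p \<Longrightarrow> \<exists>c\<in>car M (snd x). \<forall>\<phi>\<in>q. sat M (v(x := c)) \<phi>"
  shows "\<exists>c\<in>car M (snd x). \<forall>\<phi>\<in>p. sat M (v(x := c)) \<phi>"
proof -
  note str = monsterD(1)[OF M]
  define x0 :: "'v \<times> 's" where "x0 = (undefined, snd x)"
  have snd_x0 [simp]: "snd x0 = snd x" by (simp add: x0_def)
  have "\<exists>\<theta> \<eta>. \<theta> x = x0 \<and> (\<forall>y. snd (\<theta> y) = snd y) \<and> (\<forall>z. snd (\<eta> z) = snd z) \<and>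
      (\<forall>y\<in>insert x (fv \<phi>). \<eta> (\<theta> y) = y)" for \<phi> :: "('f, 'p, 'u \<times> 's) fm"
    by (rule fresh_names[OF inf finite_fv[of \<phi>], of x0 x]) (simp, blast)
  then have "\<exists>\<Theta>. \<forall>\<phi> :: ('f, 'p, 'u \<times> 's) fm. \<exists>\<eta>. \<Theta> \<phi> x = x0 \<and> (\<forall>y. snd (\<Theta> \<phi> y) = snd y) \<and>
      (\<forall>z. snd (\<eta> z) = snd z) \<and> (\<forall>y\<in>insert x (fv \<phi>). \<eta> (\<Theta> \<phi> y) = y)"
    by (intro choice allI)
  then obtain \<Theta> where "\<forall>\<phi> :: ('f, 'p, 'u \<times> 's) fm. \<exists>\<eta>. \<Theta> \<phi> x = x0 \<and> (\<forall>y. snd (\<Theta> \<phi> y) = snd y) \<and>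
      (\<forall>z. snd (\<eta> z) = snd z) \<and> (\<forall>y\<in>insert x (fv \<phi>). \<eta> (\<Theta> \<phi> y) = y)" ..
  then have "\<exists>H. \<forall>\<phi> :: ('f, 'p, 'u \<times> 's) fm. \<Theta> \<phi> x = x0 \<and> (\<forall>y. snd (\<Theta> \<phi> y) = snd y) \<and>
      (\<forall>z. snd (H \<phi> z) = snd z) \<and> (\<forall>y\<in>insert x (fv \<phi>). H \<phi> (\<Theta> \<phi> y) = y)"
    by (rule choice)
  then obtain H where *: "\<And>\<phi>. \<Theta> \<phi> x = x0 \<and> (\<forall>y. snd (\<Theta> \<phi> y) = snd y) \<and>
      (\<forall>z. snd (H \<phi> z) = snd z) \<and> (\<forall>y\<in>insert x (fv \<phi>). H \<phi> (\<Theta> \<phi> y) = y)"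
    for \<phi> :: "('f, 'p, 'u \<times> 's) fm" by blast
  define w where "w \<phi> z = (if z \<in> \<Theta> \<phi> ` (fv \<phi> - {x}) then v (H \<phi> z) else some_elem M (snd z))"
    for \<phi> z
  have key: "sat M ((w \<phi>)(x0 := c)) (sub \<phi> (\<Theta> \<phi>)) = sat M (v(x := c)) \<phi>" for \<phi> c
  proof -
    have "sat M ((w \<phi>)(x0 := c)) (sub \<phi> (\<Theta> \<phi>)) = sat M ((w \<phi>)(x0 := c) \<circ> \<Theta> \<phi>) \<phi>"
      by (rule sat_sub[OF inf])
    also have "\<dots> = sat M (v(x := c)) \<phi>"
    proof (rule sat_cong)
      fix y assume y: "y \<in> fv \<phi>"
      show "((w \<phi>)(x0 := c) \<circ> \<Theta> \<phi>) y = (v(x := c)) y"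
      proof (cases "y = x")
        case True
        then show ?thesis using * by simp
      next
        case False
        with y * have "\<Theta> \<phi> y \<noteq> x0" by (metis insert_iff)
        then show ?thesis using False y * by (auto simp: w_def)
      qed
    qed
    finally show ?thesis .
  qed
  define p' where "p' = (\<lambda>\<phi>. (sub \<phi> (\<Theta> \<phi>), w \<phi>)) ` p"
  have "saturated TYPE('v) L M" using M by (simp add: monster_def)
  from this[unfolded saturated_def, THEN spec, of "v ` I", THEN spec, of x0, THEN spec, of p']
  have "\<lbrakk>v ` I \<subseteq> universe M; small M (v ` I);
        \<forall>(\<phi>, v')\<in>p'. wf_fm L \<phi> \<and> v' \<in> assignments M \<and> (\<forall>y\<in>fv \<phi> - {x0}. v' y \<in> v ` I);
        \<forall>q. finite q \<and> q \<subseteq> p' \<longrightarrow>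
           (\<exists>c\<in>car M (snd x0). \<forall>(\<phi>, v)\<in>q. sat M (v(x0 := c)) \<phi>)\<rbrakk>
        \<Longrightarrow> \<exists>c\<in>car M (snd x0). \<forall>(\<phi>, v)\<in>p'. sat M (v(x0 := c)) \<phi>"
    by (elim mp) (intro conjI)
  moreover have "v ` I \<subseteq> universe M" using I(2) by (auto simp: srt_def universe_def)
  moreover have "small M (v ` I)" using I(1) by (rule small_image)
  moreover have "wf_fm L (sub \<phi> (\<Theta> \<phi>)) \<and> w \<phi> \<in> assignments M \<and>
      (\<forall>y\<in>fv (sub \<phi> (\<Theta> \<phi>)) - {x0}. w \<phi> y \<in> v ` I)" if "\<phi> \<in> p" for \<phi>
  proof (intro conjI ballI)
    show "wf_fm L (sub \<phi> (\<Theta> \<phi>))" using p[OF that] * by (auto intro!: wf_sub[OF inf])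
    have "w \<phi> z \<in> car M (snd z)" for z
    proof (cases "z \<in> \<Theta> \<phi> ` (fv \<phi> - {x})")
      case True
      then obtain y where y: "y \<in> fv \<phi> - {x}" "z = \<Theta> \<phi> y" by auto
      with p[OF that] have "y \<in> I" by auto
      then have "v y \<in> car M (snd y)" using I(2) by (auto simp: srt_def)
      moreover have "snd z = snd y" "H \<phi> z = y" using *[of \<phi>] y by blast+
      ultimately show ?thesis using True by (simp add: w_def)
    qed (simp add: w_def some_elem_in[OF str])
    then show "w \<phi> \<in> assignments M" unfolding assignments_def by blast
    fix z assume "z \<in> fv (sub \<phi> (\<Theta> \<phi>)) - {x0}"
    then obtain y where y: "y \<in> fv \<phi> - {x}" "z = \<Theta> \<phi> y"
      using * by (auto simp: fv_sub[OF inf])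
    with p[OF that] have "y \<in> I" by auto
    then show "w \<phi> z \<in> v ` I" using y * by (simp add: w_def)
  qed
  moreover have "\<exists>c\<in>car M (snd x0). \<forall>(\<phi>, v)\<in>q. sat M (v(x0 := c)) \<phi>"
    if q: "finite q" "q \<subseteq> p'" for q
  proof -
    obtain q0 where q0: "q0 \<subseteq> p" "finite q0" "q = (\<lambda>\<phi>. (sub \<phi> (\<Theta> \<phi>), w \<phi>)) ` q0"
      using finite_subset_image[OF q(1)] q(2) unfolding p'_def by blast
    then show ?thesis using fin[of q0] by (auto simp: key)
  qed
  ultimately have "\<exists>c\<in>car M (snd x0). \<forall>(\<phi>, v)\<in>p'. sat M (v(x0 := c)) \<phi>"
    by (auto simp: p'_def)
  then show ?thesis by (auto simp: p'_def key)
qed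

lemma finite_chain_max:
  assumes "finite V" "V \<noteq> {}" "trans R" "\<And>y z. y \<in> V \<Longrightarrow> z \<in> V \<Longrightarrow> y = z \<or> (y, z) \<in> R \<or> (z, y) \<in> R"
  shows "\<exists>y\<in>V. \<forall>z\<in>V. z = y \<or> (z, y) \<in> R"
  using assms
proof (induction V rule: finite_ne_induct)
  case (insert x F)
  then obtain y where y: "y \<in> F" "\<forall>z\<in>F. z = y \<or> (z, y) \<in> R" by blast
  then have "x = y \<or> (x, y) \<in> R \<or> (y, x) \<in> R" using insert.prems by blast
  then show ?case
  proof (elim disjE)
    assume "(y, x) \<in> R"
    then have "\<forall>z\<in>insert x F. z = x \<or> (z, x) \<in> R"
      using y(2) insert.prems(1) by (auto dest: transD)
    then show ?thesis by blast
  qed (use y in auto)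
qed simp

lemma strict_card_order:
  defines "R A \<equiv> |A| - Id"
  shows "wf (R A)" "trans (R A)" "\<And>y z. y \<in> A \<Longrightarrow> z \<in> A \<Longrightarrow> y = z \<or> (y, z) \<in> R A \<or> (z, y) \<in> R A"
    "\<And>x. {y. (y, x) \<in> R A} \<subseteq> A" "\<And>x. x \<in> A \<Longrightarrow> |{y. (y, x) \<in> R A}| <o |A|"
proof -
  have wo: "well_order_on A |A|" by (rule card_of_well_order_on)
  then show "wf (R A)" by (simp add: R_def well_order_on_def)
  have "linear_order_on A |A|" using wo by (simp add: well_order_on_def)
  then have po: "trans |A|" "antisym |A|" "total_on A |A|"
    by (auto simp: linear_order_on_def partial_order_on_def preorder_on_def)
  show "trans (R A)" unfolding R_def using po(1,2) by (rule trans_diff_Id)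
  show "y = z \<or> (y, z) \<in> R A \<or> (z, y) \<in> R A" if "y \<in> A" "z \<in> A" for y z
    using po(3) that by (auto simp: total_on_def R_def)
  show "{y. (y, x) \<in> R A} \<subseteq> A" for x
    using FieldI1[of _ x "|A|"] unfolding R_def Field_card_of by blast
  show "|{y. (y, x) \<in> R A}| <o |A|" if "x \<in> A" for x
  proof -
    have "{y. (y, x) \<in> R A} = underS |A| x" by (auto simp: R_def underS_def)
    then show ?thesis using card_of_underS[OF card_of_Card_order, of x A] that by (simp add: Field_card_of)
  qed
qed

text \<open>
  A finitely satisfiable small type in many variables, over fixed values of some of them, is
  realized. The values are found one at a time, so that the type remains finitely
  satisfiable over the values already chosen.
\<close>

lemma realize_type:
  fixes T :: "('f, 'p, 'v \<times> 's) fm set" and M :: "('f, 'p, 's, 'm) struct"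
    and \<Gamma> :: "('f, 'p, 'u \<times> 's) fm set" and v :: "'u \<times> 's \<Rightarrow> 'm"
  assumes inf: "infinite (UNIV :: 'v set)" and M: "monster L T M"
    and J: "small M J" "I \<subseteq> J" "srt M v I"
    and wf\<Gamma>: "\<And>\<phi>. \<phi> \<in> \<Gamma> \<Longrightarrow> wf_fm L \<phi> \<and> fv \<phi> \<subseteq> J"
    and fin: "\<And>\<Gamma>0. finite \<Gamma>0 \<Longrightarrow> \<Gamma>0 \<subseteq> \<Gamma> \<Longrightarrow>
      \<exists>w. srt M w J \<and> (\<forall>i\<in>I. w i = v i) \<and> (\<forall>\<phi>\<in>\<Gamma>0. sat M w \<phi>)"
  shows "\<exists>w. srt M w J \<and> (\<forall>i\<in>I. w i = v i) \<and> (\<forall>\<phi>\<in>\<Gamma>. sat M w \<phi>)"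
proof -
  note str = monsterD(1)[OF M]
  define FS where "FS D F \<longleftrightarrow> (\<forall>\<Gamma>0. finite \<Gamma>0 \<and> \<Gamma>0 \<subseteq> \<Gamma> \<longrightarrow>
      (\<exists>w. srt M w J \<and> (\<forall>i\<in>I. w i = v i) \<and> (\<forall>i\<in>D. w i = F i) \<and> (\<forall>\<phi>\<in>\<Gamma>0. sat M w \<phi>)))"
    for D and F :: "'u \<times> 's \<Rightarrow> 'm"
  define R where "R = |J - I| - Id"
  define B where "B x = {y. (y, x) \<in> R}" for x
  note wfR = strict_card_order(1)[of "J - I", folded R_def]
    and trR = strict_card_order(2)[of "J - I", folded R_def]
    and totR = strict_card_order(3)[of _ "J - I", folded R_def]
    and BJ = strict_card_order(4)[of _ "J - I", folded R_def, folded B_def]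
  \<comment> \<open>Finite satisfiability only depends on finitely many of the chosen values.\<close>
  have limit: "FS D F"
    if D: "D \<subseteq> J - I" and FSy: "\<And>y. y \<in> D \<Longrightarrow> FS (insert y (B y)) F" for D F
    unfolding FS_def
  proof (intro allI impI, elim conjE)
    fix \<Gamma>0 assume \<Gamma>0: "finite \<Gamma>0" "\<Gamma>0 \<subseteq> \<Gamma>"
    define V where "V = (\<Union>(fv ` \<Gamma>0)) \<inter> D"
    have "finite V" using \<Gamma>0 by (auto simp: V_def)
    have "\<exists>w. srt M w J \<and> (\<forall>i\<in>I. w i = v i) \<and> (\<forall>i\<in>V. w i = F i) \<and> (\<forall>\<phi>\<in>\<Gamma>0. sat M w \<phi>)"
    proof (cases "V = {}")
      case True
      then show ?thesis using fin[OF \<Gamma>0] by simp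
    next
      case False
      have "\<exists>y\<in>V. \<forall>z\<in>V. z = y \<or> (z, y) \<in> R"
        by (rule finite_chain_max[OF \<open>finite V\<close> False trR]) (use totR D V_def in blast)
      then obtain y where "y \<in> V" "V \<subseteq> insert y (B y)" by (auto simp: B_def)
      moreover from this have "FS (insert y (B y)) F" using FSy by (auto simp: V_def)
      ultimately show ?thesis using \<Gamma>0 unfolding FS_def by (metis in_mono)
    qed
    then obtain w where w: "srt M w J" "\<forall>i\<in>I. w i = v i" "\<forall>i\<in>V. w i = F i" "\<forall>\<phi>\<in>\<Gamma>0. sat M w \<phi>"
      by blast
    have F: "F i \<in> car M (snd i)" if "i \<in> D" for i
    proof -
      have "i \<in> J" using that D by auto
      moreover have "\<exists>w. srt M w J \<and> w i = F i"
        using FSy[OF that] unfolding FS_def by (metis empty_subsetI finite.emptyI insertI1)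
      ultimately show ?thesis by (auto simp: srt_def)
    qed
    define w' where "w' i = (if i \<in> D then F i else w i)" for i
    have "sat M w' \<phi> = sat M w \<phi>" if "\<phi> \<in> \<Gamma>0" for \<phi>
    proof (rule sat_cong)
      fix i assume "i \<in> fv \<phi>"
      then have "i \<in> V" if "i \<in> D" using that \<open>\<phi> \<in> \<Gamma>0\<close> by (auto simp: V_def)
      then show "w' i = w i" using w(3) by (simp add: w'_def)
    qed
    moreover have "\<forall>i\<in>I. w' i = v i" using D w(2) by (auto simp: w'_def)
    moreover have "srt M w' J" using F w(1) by (auto simp: srt_def w'_def)
    ultimately show "\<exists>w. srt M w J \<and> (\<forall>i\<in>I. w i = v i) \<and> (\<forall>i\<in>D. w i = F i) \<and> (\<forall>\<phi>\<in>\<Gamma>0. sat M w \<phi>)"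
      using w(4) by (intro exI[of _ w']) (auto simp: w'_def)
  qed
  \<comment> \<open>The value at \<open>x\<close> realizes the existential consequences of the finite parts of \<open>\<Gamma>\<close>.\<close>
  have step: "\<exists>c. FS (insert x (B x)) (F(x := c))"
    if x: "x \<in> J - I" and FSx: "FS (B x) F" for x F
  proof -
    have xB: "x \<notin> B x" by (simp add: B_def R_def)
    define K where "K = insert x (I \<union> B x)"
    define v1 where "v1 i = (if i \<in> I then v i else F i)" for i
    obtain w0 where w0: "srt M w0 J" "\<forall>i\<in>B x. w0 i = F i"
      using FSx unfolding FS_def by (metis empty_subsetI finite.emptyI)
    have v1: "srt M v1 (I \<union> B x)"
      using w0 BJ[of x] J(3) unfolding srt_def v1_def by (metis (no_types) DiffD1 Un_iff in_mono)
    define p where "p = {exs xs (conjs x \<psi>s) | xs \<psi>s.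
        set \<psi>s \<subseteq> \<Gamma> \<and> set xs = \<Union>(fv ` set \<psi>s) - K}"
    have "\<exists>c\<in>car M (snd x). \<forall>\<phi>\<in>p. sat M (v1(x := c)) \<phi>"
    proof (rule saturated_names[OF inf M _ v1])
      show "small M (I \<union> B x)" using J(1,2) BJ[of x] by (auto intro: small_mono)
      show "wf_fm L \<phi> \<and> fv \<phi> \<subseteq> insert x (I \<union> B x)" if "\<phi> \<in> p" for \<phi>
      proof -
        obtain xs \<psi>s where "\<phi> = exs xs (conjs x \<psi>s)" "set \<psi>s \<subseteq> \<Gamma>"
            "set xs = \<Union>(fv ` set \<psi>s) - K"
          using \<open>\<phi> \<in> p\<close> unfolding p_def by blast
        moreover from this have "\<forall>\<psi>\<in>set \<psi>s. wf_fm L \<psi>" using wf\<Gamma> by blast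
        ultimately show ?thesis by (auto simp: K_def)
      qed
      fix q assume q: "finite q" "q \<subseteq> p"
      then have "\<forall>\<phi>\<in>q. \<exists>xs \<psi>s. \<phi> = exs xs (conjs x \<psi>s) \<and> set \<psi>s \<subseteq> \<Gamma> \<and>
          set xs = \<Union>(fv ` set \<psi>s) - K" by (auto simp: p_def)
      then obtain xs \<psi>s where q': "\<And>\<phi>. \<phi> \<in> q \<Longrightarrow> \<phi> = exs (xs \<phi>) (conjs x (\<psi>s \<phi>)) \<and>
          set (\<psi>s \<phi>) \<subseteq> \<Gamma> \<and> set (xs \<phi>) = \<Union>(fv ` set (\<psi>s \<phi>)) - K" by metis
      define \<Gamma>0 where "\<Gamma>0 = (\<Union>\<phi>\<in>q. set (\<psi>s \<phi>))"
      have "finite \<Gamma>0" "\<Gamma>0 \<subseteq> \<Gamma>" using q q' by (auto simp: \<Gamma>0_def)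
      then obtain w where w: "srt M w J" "\<forall>i\<in>I. w i = v i" "\<forall>i\<in>B x. w i = F i"
          "\<forall>\<phi>\<in>\<Gamma>0. sat M w \<phi>"
        using FSx unfolding FS_def by metis
      have "sat M (v1(x := w x)) \<phi>" if "\<phi> \<in> q" for \<phi>
      proof -
        define w' where "w' i = (if i \<in> set (xs \<phi>) then w i else (v1(x := w x)) i)" for i
        have w': "w' i = w i" if "i \<in> K \<union> set (xs \<phi>)" for i
          using that w(2,3) by (auto simp: w'_def K_def v1_def)
        have "sat M w' \<psi>" if "\<psi> \<in> set (\<psi>s \<phi>)" for \<psi>
        proof -
          have "sat M w' \<psi> = sat M w \<psi>"
            by (rule sat_cong, rule w') (use that q'[OF \<open>\<phi> \<in> q\<close>] in blast)
          then show ?thesis using w(4) that \<open>\<phi> \<in> q\<close> by (auto simp: \<Gamma>0_def)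
        qed
        moreover have "\<forall>i\<in>set (xs \<phi>). w' i \<in> car M (snd i)"
        proof
          fix i assume "i \<in> set (xs \<phi>)"
          moreover from this have "i \<in> J" using q'[OF \<open>\<phi> \<in> q\<close>] wf\<Gamma> by blast
          ultimately show "w' i \<in> car M (snd i)" using w(1) by (auto simp: w'_def srt_def)
        qed
        ultimately have "sat M (v1(x := w x)) (exs (xs \<phi>) (conjs x (\<psi>s \<phi>)))"
          unfolding sat_exs by (intro exI[of _ w']) (auto simp: w'_def)
        then show ?thesis using q'[OF that] by simp
      qed
      moreover have "w x \<in> car M (snd x)" using w(1) x by (auto simp: srt_def)
      ultimately show "\<exists>c\<in>car M (snd x). \<forall>\<phi>\<in>q. sat M (v1(x := c)) \<phi>" by blast
    qed
    then obtain c where c: "c \<in> car M (snd x)" "\<And>\<phi>. \<phi> \<in> p \<Longrightarrow> sat M (v1(x := c)) \<phi>" by blast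
    have "FS (insert x (B x)) (F(x := c))"
      unfolding FS_def
    proof (intro allI impI, elim conjE)
      fix \<Gamma>0 assume \<Gamma>0: "finite \<Gamma>0" "\<Gamma>0 \<subseteq> \<Gamma>"
      then obtain \<psi>s where \<psi>s: "set \<psi>s = \<Gamma>0" using finite_list by blast
      obtain xs where xs: "set xs = \<Union>(fv ` set \<psi>s) - K"
        using finite_list[of "\<Union>(fv ` set \<psi>s) - K"] by auto
      have "sat M (v1(x := c)) (exs xs (conjs x \<psi>s))"
        by (rule c(2)) (use \<psi>s xs \<Gamma>0 in \<open>auto simp: p_def\<close>)
      then obtain w where w: "\<And>y. y \<notin> set xs \<Longrightarrow> w y = (v1(x := c)) y"
          "\<forall>y\<in>set xs. w y \<in> car M (snd y)" "\<forall>\<phi>\<in>\<Gamma>0. sat M w \<phi>"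
        unfolding sat_exs using \<psi>s by auto
      define w' where "w' i = (if i \<in> K \<union> set xs then w i else some_elem M (snd i))" for i
      have "sat M w' \<phi> = sat M w \<phi>" if "\<phi> \<in> \<Gamma>0" for \<phi>
        by (rule sat_cong) (use that xs \<psi>s in \<open>auto simp: w'_def\<close>)
      moreover have "srt M w' J"
      proof -
        have "w i \<in> car M (snd i)" if "i \<in> K" for i
          using that v1 c(1) w(1)[of i] xs by (auto simp: K_def srt_def split: if_splits)
        then show ?thesis using w(2) some_elem_in[OF str] by (auto simp: srt_def w'_def)
      qed
      moreover have "\<forall>i\<in>I. w' i = v i" "\<forall>i\<in>insert x (B x). w' i = (F(x := c)) i"
        using x xs w(1) xB BJ[of x] by (auto simp: w'_def K_def v1_def)
      ultimately show "\<exists>w. srt M w J \<and> (\<forall>i\<in>I. w i = v i) \<and>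
          (\<forall>i\<in>insert x (B x). w i = (F(x := c)) i) \<and> (\<forall>\<phi>\<in>\<Gamma>0. sat M w \<phi>)"
        using w(3) by blast
    qed
    then show ?thesis by blast
  qed
  have "\<exists>F. \<forall>x. x \<in> J - I \<longrightarrow> FS (insert x (B x)) (F(x := F x))"
  proof (rule dependent_wf_choice[OF wfR])
    show "(x \<in> J - I \<longrightarrow> FS (insert x (B x)) (f(x := r))) =
        (x \<in> J - I \<longrightarrow> FS (insert x (B x)) (g(x := r)))"
      if "\<And>z. (z, x) \<in> R \<Longrightarrow> f z = g z" for f g x r
    proof -
      have "(\<forall>i\<in>insert x (B x). w i = (f(x := r)) i) = (\<forall>i\<in>insert x (B x). w i = (g(x := r)) i)" for w
        using that by (auto simp: B_def)
      then show ?thesis unfolding FS_def by simp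
    qed
    show "\<exists>r. x \<in> J - I \<longrightarrow> FS (insert x (B x)) (f(x := r))"
      if "\<And>y. (y, x) \<in> R \<Longrightarrow> y \<in> J - I \<longrightarrow> FS (insert y (B y)) (f(y := f y))" for x f
    proof (cases "x \<in> J - I")
      case True
      have "FS (B x) f"
      proof (rule limit[OF BJ])
        fix y assume y: "y \<in> B x"
        with BJ have "y \<in> J - I" by blast
        with that[of y] y show "FS (insert y (B y)) f" by (simp add: B_def)
      qed
      then show ?thesis using step[OF True] by blast
    qed blast
  qed
  then obtain F where "\<And>x. x \<in> J - I \<Longrightarrow> FS (insert x (B x)) F" by auto
  then have FS: "FS (J - I) F" by (rule limit[OF subset_refl])
  define w where "w i = (if i \<in> I then v i else F i)" for i
  have "sat M w \<phi> \<and> srt M w J" if "\<phi> \<in> \<Gamma> \<or> sat M w \<phi>" for \<phi>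
  proof -
    obtain w' where w': "srt M w' J" "\<forall>i\<in>I. w' i = v i" "\<forall>i\<in>J - I. w' i = F i"
        "\<phi> \<in> \<Gamma> \<longrightarrow> sat M w' \<phi>"
      using FS[unfolded FS_def, rule_format, of "{\<phi>} \<inter> \<Gamma>"] by auto
    have eq: "w i = w' i" if "i \<in> J" for i using w' that by (auto simp: w_def)
    have "sat M w \<phi> = sat M w' \<phi>" if "\<phi> \<in> \<Gamma>"
      by (rule sat_cong) (use eq wf\<Gamma>[OF that] in blast)
    then show ?thesis using w' eq that by (auto simp: srt_def)
  qed
  moreover have "srt M w J"
  proof -
    obtain w' where "srt M w' J" "\<forall>i\<in>I. w' i = v i" "\<forall>i\<in>J - I. w' i = F i"
      using FS[unfolded FS_def, rule_format, of "{}"] by auto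
    then show ?thesis unfolding srt_def w_def by (metis DiffI)
  qed
  ultimately show ?thesis by (intro exI[of _ w]) (auto simp: w_def)
qed

section \<open>Elementary relations\<close>

text \<open>
  A relation between the elements of two structures is elementary if corresponding tuples have
  the same type. It is then the graph of a partial elementary map, but as a relation it is
  inverted, composed and extended more easily. The type \<open>'v\<close> of the names of variables is
  passed explicitly; it does not matter, as long as it is infinite.
\<close>

definition elem_rel ::
  "'v itself \<Rightarrow> ('f, 'p, 's) lang \<Rightarrow> ('f, 'p, 's, 'm) struct \<Rightarrow> ('f, 'p, 's, 'n) struct \<Rightarrow>
   ('m \<times> 'n) set \<Rightarrow> bool" where
  "elem_rel _ L M M' G \<longleftrightarrow>
     (\<forall>a b. (a, b) \<in> G \<longrightarrow> (\<exists>s. a \<in> car M s \<and> b \<in> car M' s)) \<and>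
     (\<forall>(\<phi> :: ('f, 'p, 'v \<times> 's) fm) v v'. wf_fm L \<phi> \<longrightarrow> srt M v (fv \<phi>) \<longrightarrow> srt M' v' (fv \<phi>) \<longrightarrow>
        (\<forall>x\<in>fv \<phi>. (v x, v' x) \<in> G) \<longrightarrow> (sat M v \<phi> \<longleftrightarrow> sat M' v' \<phi>))"

lemma elem_rel_sorted:
  "elem_rel V L M M' G \<Longrightarrow> (a, b) \<in> G \<Longrightarrow> \<exists>s. a \<in> car M s \<and> b \<in> car M' s"
  unfolding elem_rel_def by blast

lemma elem_relD:
  fixes \<phi> :: "('f, 'p, 'v \<times> 's) fm"
  assumes "elem_rel TYPE('v) L M M' G" "wf_fm L \<phi>" "srt M v (fv \<phi>)" "srt M' v' (fv \<phi>)"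
    "\<forall>x\<in>fv \<phi>. (v x, v' x) \<in> G"
  shows "sat M v \<phi> \<longleftrightarrow> sat M' v' \<phi>"
  using assms unfolding elem_rel_def by blast

lemma elem_rel_universe:
  "elem_rel V L M M' G \<Longrightarrow> (a, b) \<in> G \<Longrightarrow> a \<in> universe M \<and> b \<in> universe M'"
  unfolding elem_rel_def universe_def by blast

lemma elem_rel_car1:
  assumes "elem_rel V L M M' G" "(a, b) \<in> G" "is_structure L M" "a \<in> car M s"
  shows "b \<in> car M' s"
  using elem_rel_sorted[OF assms(1,2)] car_disjoint[OF assms(3)] assms(4) by metis

lemma elem_rel_car2:
  assumes "elem_rel V L M M' G" "(a, b) \<in> G" "is_structure L M'" "b \<in> car M' s"
  shows "a \<in> car M s"
  using elem_rel_sorted[OF assms(1,2)] car_disjoint[OF assms(3)] assms(4) by metis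

lemma elem_rel_mono: "elem_rel V L M M' G \<Longrightarrow> H \<subseteq> G \<Longrightarrow> elem_rel V L M M' H"
  unfolding elem_rel_def by (meson subsetD)

lemma elem_rel_converse: "elem_rel V L M M' G \<Longrightarrow> elem_rel V L M' M (G\<inverse>)"
  unfolding elem_rel_def by (metis converseD)

lemma elem_rel_comp:
  fixes L :: "('f, 'p, 's) lang"
  assumes G: "elem_rel (V :: 'v itself) L M M' G" and H: "elem_rel V L M' M'' H" and M: "is_structure L M" and M': "is_structure L M'"
  shows "elem_rel V L M M'' (G O H)"
  unfolding elem_rel_def
proof (intro conjI allI impI)
  fix a c assume "(a, c) \<in> G O H"
  then obtain b where b: "(a, b) \<in> G" "(b, c) \<in> H" by blast
  then show "\<exists>s. a \<in> car M s \<and> c \<in> car M'' s"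
    using elem_rel_sorted[OF G b(1)] elem_rel_car1[OF H b(2) M'] by blast
next
  fix \<phi> :: "('f, 'p, 'v \<times> 's) fm" and v v''
  assume *: "wf_fm L \<phi>" "srt M v (fv \<phi>)" "srt M'' v'' (fv \<phi>)" "\<forall>x\<in>fv \<phi>. (v x, v'' x) \<in> G O H"
  then have "\<forall>x\<in>fv \<phi>. \<exists>b. (v x, b) \<in> G \<and> (b, v'' x) \<in> H" by blast
  then obtain v' where v': "\<forall>x\<in>fv \<phi>. (v x, v' x) \<in> G \<and> (v' x, v'' x) \<in> H" by metis
  then have "srt M' v' (fv \<phi>)"
    using *(2) elem_rel_car1[OF G _ M] unfolding srt_def by blast
  then show "sat M v \<phi> \<longleftrightarrow> sat M'' v'' \<phi>"
    using * v' G H unfolding elem_rel_def by metis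
qed

lemma elem_rel_sat:
  fixes \<phi> :: "('f, 'p, 'u \<times> 's) fm"
  assumes inf: "infinite (UNIV :: 'v set)" and G: "elem_rel TYPE('v) L M M' G"
    and \<phi>: "wf_fm L \<phi>" "srt M v (fv \<phi>)" "srt M' v' (fv \<phi>)" "\<And>x. x \<in> fv \<phi> \<Longrightarrow> (v x, v' x) \<in> G"
  shows "sat M v \<phi> \<longleftrightarrow> sat M' v' \<phi>"
proof -
  define x :: "'u \<times> 's" where "x = undefined"
  define x0 :: "'v \<times> 's" where "x0 = (undefined, snd x)"
  obtain \<theta> \<eta> where *: "\<And>y. snd (\<theta> y) = snd y" "\<And>z. snd (\<eta> z) = snd z"
      "\<And>y. y \<in> insert x (fv \<phi>) \<Longrightarrow> \<eta> (\<theta> y :: 'v \<times> 's) = y"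
    by (rule fresh_names[OF inf finite_fv[of \<phi>], of x0 x]) (simp add: x0_def, blast)
  have "sat M v \<phi> = sat M (v \<circ> \<eta>) (sub \<phi> \<theta>)"
    unfolding sat_sub[OF inf] by (rule sat_cong) (use * in simp)
  also have "\<dots> = sat M' (v' \<circ> \<eta>) (sub \<phi> \<theta>)"
  proof -
    have "wf_fm L (sub \<phi> \<theta>)" using \<phi>(1) * by (intro wf_sub[OF inf])
    moreover have "srt M (v \<circ> \<eta>) (fv (sub \<phi> \<theta>))" "srt M' (v' \<circ> \<eta>) (fv (sub \<phi> \<theta>))"
        "\<forall>x\<in>fv (sub \<phi> \<theta>). ((v \<circ> \<eta>) x, (v' \<circ> \<eta>) x) \<in> G"
      using \<phi>(2-4) * unfolding srt_def fv_sub[OF inf] by (simp_all add: ball_simps)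
    ultimately show ?thesis using G unfolding elem_rel_def by blast
  qed
  also have "\<dots> = sat M' v' \<phi>"
    unfolding sat_sub[OF inf] by (rule sat_cong) (use * in simp)
  finally show ?thesis .
qed

text \<open>
  A relation can be checked on an enumeration: its pairs are named by the variables in \<open>J\<close>, and
  only formulas in these variables have to be considered. Substituting variables for variables
  covers tuples with repetitions.
\<close>

lemma elem_rel_of_assignments:
  fixes v :: "'u \<times> 's \<Rightarrow> 'm" and w :: "'u \<times> 's \<Rightarrow> 'n" and M :: "('f, 'p, 's, 'm) struct"
  assumes inf: "infinite (UNIV :: 'u set)" and M: "is_structure L M"
    and srt: "srt M v J" "srt M' w J"
    and sat: "\<And>\<phi> :: ('f, 'p, 'u \<times> 's) fm. wf_fm L \<phi> \<Longrightarrow> fv \<phi> \<subseteq> J \<Longrightarrow> sat M v \<phi> \<Longrightarrow> sat M' w \<phi>"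
  shows "elem_rel V L M M' {(v x, w x) | x. x \<in> J}"
proof -
  have sat': "sat M v \<phi> = sat M' w \<phi>" if "wf_fm L \<phi>" "fv \<phi> \<subseteq> J" for \<phi> :: "('f, 'p, 'u \<times> 's) fm"
    using sat[of \<phi>] sat[of "Neg \<phi>"] that by auto
  show ?thesis
    unfolding elem_rel_def
  proof (intro conjI allI impI)
    show "\<exists>s. a \<in> car M s \<and> b \<in> car M' s" if "(a, b) \<in> {(v x, w x) | x. x \<in> J}" for a b
      using that srt unfolding srt_def by blast
    fix \<phi> :: "('f, 'p, 'c \<times> 's) fm" and u u'
    assume *: "wf_fm L \<phi>" "srt M u (fv \<phi>)" "srt M' u' (fv \<phi>)"
      "\<forall>x\<in>fv \<phi>. (u x, u' x) \<in> {(v x, w x) | x. x \<in> J}"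
    then have "\<forall>y\<in>fv \<phi>. \<exists>x. x \<in> J \<and> u y = v x \<and> u' y = w x" by blast
    then obtain \<theta> where \<theta>: "\<And>y. y \<in> fv \<phi> \<Longrightarrow> \<theta> y \<in> J \<and> u y = v (\<theta> y) \<and> u' y = w (\<theta> y)" by metis
    have sorts: "snd (\<theta> y) = snd y" if "y \<in> fv \<phi>" for y
    proof (rule car_disjoint[OF M])
      show "u y \<in> car M (snd (\<theta> y))" using \<theta>[OF that] srt(1) by (simp add: srt_def)
      show "u y \<in> car M (snd y)" using *(2) that by (simp add: srt_def)
    qed
    have "sat M u \<phi> = sat M v (sub \<phi> \<theta>)"
      unfolding sat_sub[OF inf] by (rule sat_cong) (use \<theta> in simp)
    also have "\<dots> = sat M' w (sub \<phi> \<theta>)"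
      using \<theta> by (intro sat' wf_sub[OF inf] sorts *(1)) (auto simp: fv_sub[OF inf])
    also have "\<dots> = sat M' u' \<phi>"
      unfolding sat_sub[OF inf] by (rule sat_cong) (use \<theta> in simp)
    finally show "sat M u \<phi> = sat M' u' \<phi>" .
  qed
qed

lemma elem_rel_limit:
  fixes L :: "('f, 'p, 's) lang"
  assumes "\<And>F. finite F \<Longrightarrow> F \<subseteq> G \<Longrightarrow> \<exists>G'. F \<subseteq> G' \<and> elem_rel (V :: 'v itself) L M M' G'"
  shows "elem_rel V L M M' G"
  unfolding elem_rel_def
proof (intro conjI allI impI)
  show "\<exists>s. a \<in> car M s \<and> b \<in> car M' s" if "(a, b) \<in> G" for a b
    using assms[of "{(a, b)}"] that elem_rel_sorted[of V L M M' _ a b] by auto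
  fix \<phi> :: "('f, 'p, 'v \<times> 's) fm" and v v'
  assume *: "wf_fm L \<phi>" "srt M v (fv \<phi>)" "srt M' v' (fv \<phi>)" "\<forall>x\<in>fv \<phi>. (v x, v' x) \<in> G"
  obtain G' where G': "(\<lambda>x. (v x, v' x)) ` fv \<phi> \<subseteq> G'" "elem_rel V L M M' G'"
    using assms[of "(\<lambda>x. (v x, v' x)) ` fv \<phi>"] *(4) by auto
  have "\<forall>x\<in>fv \<phi>. (v x, v' x) \<in> G'" using G'(1) by blast
  then show "sat M v \<phi> \<longleftrightarrow> sat M' v' \<phi>"
    using G'(2) * unfolding elem_rel_def by blast
qed

lemma elem_rel_inj:
  assumes inf: "infinite (UNIV :: 'v set)" and G: "elem_rel TYPE('v) L M M' G"
    and M: "is_structure L M" "is_structure L M'" and ab: "(a, b) \<in> G" "(a', b') \<in> G"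
  shows "a = a' \<longleftrightarrow> b = b'"
proof -
  obtain s where s: "a \<in> car M s" "b \<in> car M' s" using elem_rel_sorted[OF G ab(1)] by blast
  obtain t where t: "a' \<in> car M t" "b' \<in> car M' t" using elem_rel_sorted[OF G ab(2)] by blast
  have ?thesis if "s = t"
  proof -
    define \<phi> :: "('a, 'b, nat \<times> 'c) fm" where "\<phi> = Eq (Var (0, s)) (Var (1, s))"
    have "sat M (\<lambda>(n, _). if n = 0 then a else a') \<phi> = sat M' (\<lambda>(n, _). if n = 0 then b else b') \<phi>"
      by (rule elem_rel_sat[OF inf G]) (use s t that ab in \<open>auto simp: \<phi>_def srt_def\<close>)
    then show ?thesis by (simp add: \<phi>_def)
  qed
  moreover have "a \<noteq> a' \<and> b \<noteq> b'" if "s \<noteq> t"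
    using that s t car_disjoint[OF M(1)] car_disjoint[OF M(2)] by metis
  ultimately show ?thesis by blast
qed

text \<open>
  In a saturated structure, the domain of a small elementary relation can be enlarged by any
  small set: a type with parameters in the range of the relation is realized.
\<close>

lemma elem_rel_extend:
  fixes T :: "('f, 'p, 'v \<times> 's) fm set" and M' :: "('f, 'p, 's, 'n) struct"
    and M :: "('f, 'p, 's, 'm) struct"
  assumes inf: "infinite (UNIV :: 'v set)" and M: "is_structure L M" "infinite (universe M)"
    and M': "monster L T M'"
    and G: "elem_rel TYPE('v) L M M' G" "small M' G" and B: "B \<subseteq> universe M" "small M' B"
  shows "\<exists>H h. elem_rel TYPE('v) L M M' H \<and> G \<subseteq> H \<and> B \<subseteq> Domain H \<and> H \<subseteq> h ` (G <+> B)"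
proof -
  note str' = monsterD(1)[OF M']
  define srt1 where "srt1 a = (SOME s. a \<in> car M s)" for a
  have srt1: "a \<in> car M (srt1 a)" if "a \<in> universe M" for a
    using that unfolding srt1_def universe_def by (auto intro: someI)
  define nm :: "('m \<times> 'n) + 'm \<Rightarrow> (('m \<times> 'n) + 'm) \<times> 's" where
    "nm u = (u, case u of Inl (a, b) \<Rightarrow> srt1 a | Inr a \<Rightarrow> srt1 a)" for u
  define I where "I = nm ` Inl ` G"
  define J where "J = nm ` (G <+> B)"
  define v :: "(('m \<times> 'n) + 'm) \<times> 's \<Rightarrow> 'm" where
    "v x = (case fst x of Inl (a, b) \<Rightarrow> a | Inr a \<Rightarrow> a)" for x
  define v' :: "(('m \<times> 'n) + 'm) \<times> 's \<Rightarrow> 'n" where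
    "v' x = (case fst x of Inl (a, b) \<Rightarrow> b | Inr a \<Rightarrow> some_elem M' (snd x))" for x
  have GU: "a \<in> car M (srt1 a)" "b \<in> car M' (srt1 a)" if "(a, b) \<in> G" for a b
    using elem_rel_universe[OF G(1) that] srt1 elem_rel_car1[OF G(1) that M(1)] by auto
  have IJ: "I \<subseteq> J" by (auto simp: I_def J_def)
  have inf_names: "infinite (UNIV :: (('m \<times> 'n) + 'm) set)"
    using M(2) finite_Plus_UNIV_iff finite_subset[of "universe M" UNIV] by auto
  have srtv: "srt M v J"
    using GU(1) srt1 B(1) by (auto simp: srt_def J_def nm_def v_def)
  have srtv': "srt M' v' J"
    using GU(2) some_elem_in[OF str'] by (auto simp: srt_def J_def nm_def v'_def)
  define \<Gamma> where "\<Gamma> = {\<phi> :: ('f, 'p, (('m \<times> 'n) + 'm) \<times> 's) fm. wf_fm L \<phi> \<and> fv \<phi> \<subseteq> J \<and> sat M v \<phi>}"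
  have "\<exists>w. srt M' w J \<and> (\<forall>i\<in>I. w i = v' i) \<and> (\<forall>\<phi>\<in>\<Gamma>. sat M' w \<phi>)"
  proof (rule realize_type[OF inf M' _ IJ])
    show "small M' J"
      unfolding J_def by (intro small_image small_Plus monsterD[OF M'] G(2) B(2))
    show "srt M' v' I" using srtv' IJ by (auto simp: srt_def)
    show "wf_fm L \<phi> \<and> fv \<phi> \<subseteq> J" if "\<phi> \<in> \<Gamma>" for \<phi> using that by (simp add: \<Gamma>_def)
    fix \<Gamma>0 assume \<Gamma>0: "finite \<Gamma>0" "\<Gamma>0 \<subseteq> \<Gamma>"
    obtain \<psi>s where \<psi>s: "set \<psi>s = \<Gamma>0" using \<Gamma>0 finite_list by blast
    obtain xs where xs: "set xs = \<Union>(fv ` set \<psi>s) - I"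
      using finite_list[of "\<Union>(fv ` set \<psi>s) - I"] by auto
    show "\<exists>w. srt M' w J \<and> (\<forall>i\<in>I. w i = v' i) \<and> (\<forall>\<phi>\<in>\<Gamma>0. sat M' w \<phi>)"
    proof (cases "\<Union>(fv ` \<Gamma>0) = {}")
      case True
      have "sat M' v' \<phi>" if "\<phi> \<in> \<Gamma>0" for \<phi>
      proof -
        have "sat M v \<phi> = sat M' v' \<phi>"
          by (rule elem_rel_sat[OF inf G(1)]) (use that \<Gamma>0 True in \<open>auto simp: \<Gamma>_def srt_def\<close>)
        then show ?thesis using that \<Gamma>0 by (auto simp: \<Gamma>_def)
      qed
      then show ?thesis using srtv' by (intro exI[of _ v']) simp
    next
      case False
      then obtain y where y: "y \<in> \<Union>(fv ` \<Gamma>0)" by blast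
      have xsJ: "set xs \<subseteq> J" using xs \<psi>s \<Gamma>0(2) by (auto simp: \<Gamma>_def)
      let ?\<phi> = "exs xs (conjs y \<psi>s)"
      have fvI: "fv ?\<phi> \<subseteq> I" using y xs \<psi>s by auto
      have "sat M v ?\<phi>"
        unfolding sat_exs
        using srtv xsJ \<psi>s \<Gamma>0(2) by (intro exI[of _ v]) (auto simp: \<Gamma>_def srt_def)
      moreover have "sat M v ?\<phi> = sat M' v' ?\<phi>"
      proof (rule elem_rel_sat[OF inf G(1)])
        show "wf_fm L ?\<phi>" using \<psi>s \<Gamma>0(2) by (auto simp: \<Gamma>_def)
        show "srt M v (fv ?\<phi>)" using srtv fvI IJ unfolding srt_def by blast
        show "srt M' v' (fv ?\<phi>)" using srtv' fvI IJ unfolding srt_def by blast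
        show "(v x, v' x) \<in> G" if "x \<in> fv ?\<phi>" for x
          using that fvI by (auto simp: I_def nm_def v_def v'_def)
      qed
      ultimately obtain w where w: "\<And>x. x \<notin> set xs \<Longrightarrow> w x = v' x"
          "\<forall>x\<in>set xs. w x \<in> car M' (snd x)" "\<forall>\<phi>\<in>\<Gamma>0. sat M' w \<phi>"
        unfolding sat_exs using \<psi>s by auto
      have "srt M' w J" using srtv' w(1,2) unfolding srt_def by metis
      moreover have "\<forall>i\<in>I. w i = v' i" using w(1) xs by auto
      ultimately show ?thesis using w(3) by blast
    qed
  qed
  then obtain w where w: "srt M' w J" "\<forall>i\<in>I. w i = v' i" "\<forall>\<phi>\<in>\<Gamma>. sat M' w \<phi>" by blast
  define H where "H = {(v x, w x) | x. x \<in> J}"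
  have "elem_rel TYPE('v) L M M' H"
    unfolding H_def by (rule elem_rel_of_assignments[OF inf_names M(1) srtv w(1)])
      (use w(3) in \<open>auto simp: \<Gamma>_def\<close>)
  moreover have "G \<subseteq> H"
  proof
    fix g assume g: "g \<in> G"
    then have I: "nm (Inl g) \<in> I" by (simp add: I_def)
    have "g = (v (nm (Inl g)), v' (nm (Inl g)))" by (cases g) (simp add: v_def v'_def nm_def)
    also have "\<dots> = (v (nm (Inl g)), w (nm (Inl g)))" using w(2) I by simp
    finally show "g \<in> H" using I IJ unfolding H_def by blast
  qed
  moreover have "B \<subseteq> Domain H"
  proof
    fix b assume "b \<in> B"
    then have "nm (Inr b) \<in> J" unfolding J_def by (intro imageI InrI)
    then have "(v (nm (Inr b)), w (nm (Inr b))) \<in> H" unfolding H_def by blast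
    moreover have "v (nm (Inr b)) = b" by (simp add: v_def nm_def)
    ultimately show "b \<in> Domain H" by (metis DomainI)
  qed
  moreover have "H \<subseteq> (\<lambda>u. (v (nm u), w (nm u))) ` (G <+> B)"
    by (auto simp: H_def J_def)
  ultimately show ?thesis by blast
qed

section \<open>Automorphisms and homogeneity\<close>

lemma auts_Bij: "\<sigma> \<in> auts L M \<Longrightarrow> \<sigma> \<in> Bij (universe M)"
  by (simp add: auts_def)

lemma auts_car: "\<sigma> \<in> auts L M \<Longrightarrow> a \<in> car M s \<Longrightarrow> \<sigma> a \<in> car M s"
  unfolding auts_def by blast

lemma auts_universe: "\<sigma> \<in> auts L M \<Longrightarrow> a \<in> universe M \<Longrightarrow> \<sigma> a \<in> universe M"
  by (auto simp: universe_def intro: auts_car)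

lemma auts_inj: "\<sigma> \<in> auts L M \<Longrightarrow> a \<in> universe M \<Longrightarrow> b \<in> universe M \<Longrightarrow> \<sigma> a = \<sigma> b \<longleftrightarrow> a = b"
  using auts_Bij[of \<sigma> L M] inj_on_eq_iff[of \<sigma> "universe M" a b] by (simp add: Bij_def bij_betw_def)

lemma auts_image: "\<sigma> \<in> auts L M \<Longrightarrow> \<sigma> ` universe M = universe M"
  using auts_Bij[of \<sigma> L M] by (simp add: Bij_def bij_betw_def)

lemma map_tuples: "(\<And>t. t \<in> set ts \<Longrightarrow> g t \<in> car M (h t)) \<Longrightarrow> map g ts \<in> tuples M (map h ts)"
  by (simp add: tuples_def list_all2_conv_all_nth)

lemma tm_val_car:
  assumes M: "is_structure L M" and v: "v \<in> assignments M"
  shows "wf_tm L t \<Longrightarrow> tm_val M v t \<in> car M (tm_sort L t)"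
proof (induction t)
  case (Var x)
  then show ?case using v unfolding assignments_def tm_val.simps tm_sort.simps by blast
next
  case (Fn f ts)
  have "map (tm_val M v) ts \<in> tuples M (map (tm_sort L) ts)"
    by (rule map_tuples) (use Fn in \<open>auto simp: list_all_iff\<close>)
  then show ?case using M Fn.prems by (auto simp: is_structure_def)
qed

lemma aut_tm_val:
  assumes M: "is_structure L M" and v: "v \<in> assignments M" and \<sigma>: "\<sigma> \<in> auts L M"
  shows "wf_tm L t \<Longrightarrow> tm_val M (\<sigma> \<circ> v) t = \<sigma> (tm_val M v t)"
proof (induction t)
  case (Fn f ts)
  have "map (tm_val M v) ts \<in> tuples M (map (tm_sort L) ts)"
    by (rule map_tuples, rule tm_val_car[OF M v]) (use Fn.prems in \<open>auto simp: list_all_iff\<close>)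
  then have "\<sigma> (fint M f (map (tm_val M v) ts)) = fint M f (map \<sigma> (map (tm_val M v) ts))"
    using \<sigma> Fn.prems by (auto simp: auts_def)
  moreover have "map \<sigma> (map (tm_val M v) ts) = map (tm_val M (\<sigma> \<circ> v)) ts"
    using Fn by (auto simp: list_all_iff comp_def)
  ultimately show ?case by (simp only: tm_val.simps)
qed simp

lemma aut_sat_assignment:
  assumes M: "is_structure L M" and \<sigma>: "\<sigma> \<in> auts L M"
  shows "v \<in> assignments M \<Longrightarrow> wf_fm L \<phi> \<Longrightarrow> sat M (\<sigma> \<circ> v) \<phi> = sat M v \<phi>"
proof (induction \<phi> arbitrary: v)
  case (Eq t u)
  have "tm_val M v t \<in> universe M" "tm_val M v u \<in> universe M"
    using tm_val_car[OF M Eq.prems(1)] Eq.prems(2) by (auto simp: universe_def)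
  then show ?case
    using Eq.prems by (simp add: aut_tm_val[OF M _ \<sigma>] auts_inj[OF \<sigma>] del: comp_apply)
next
  case (Rel p ts)
  have "map (tm_val M v) ts \<in> tuples M (map (tm_sort L) ts)"
    by (rule map_tuples, rule tm_val_car[OF M Rel.prems(1)])
      (use Rel.prems in \<open>auto simp: list_all_iff\<close>)
  then have "rint M p (map \<sigma> (map (tm_val M v) ts)) = rint M p (map (tm_val M v) ts)"
    using \<sigma> Rel.prems by (simp add: auts_def del: map_map)
  moreover have "map \<sigma> (map (tm_val M v) ts) = map (tm_val M (\<sigma> \<circ> v)) ts"
    using Rel.prems aut_tm_val[OF M Rel.prems(1) \<sigma>] by (auto simp: list_all_iff)
  ultimately show ?case by (simp only: sat.simps)
next
  case (Ex x \<phi>)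
  have eq: "sat M ((\<sigma> \<circ> v)(x := \<sigma> a)) \<phi> = sat M (v(x := a)) \<phi>" if "a \<in> car M (snd x)" for a
  proof -
    have "(\<sigma> \<circ> v)(x := \<sigma> a) = \<sigma> \<circ> v(x := a)" by auto
    moreover have "v(x := a) \<in> assignments M" using Ex.prems(1) that by (auto simp: assignments_def)
    ultimately show ?thesis using Ex.IH[of "v(x := a)"] Ex.prems(2) by (simp only: wf_fm.simps)
  qed
  have "\<sigma> ` car M (snd x) = car M (snd x)" using \<sigma> by (simp add: auts_def)
  then have "(\<exists>b\<in>car M (snd x). sat M ((\<sigma> \<circ> v)(x := b)) \<phi>) \<longleftrightarrow>
      (\<exists>a\<in>car M (snd x). sat M ((\<sigma> \<circ> v)(x := \<sigma> a)) \<phi>)"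
    by (metis (no_types, lifting) image_iff)
  then show ?case using eq by (simp del: comp_apply)
qed (simp_all del: comp_apply)

lemma aut_sat:
  assumes M: "is_structure L M" and \<sigma>: "\<sigma> \<in> auts L M" and "srt M v (fv \<phi>)" "wf_fm L \<phi>"
    and w: "\<And>x. x \<in> fv \<phi> \<Longrightarrow> w x = \<sigma> (v x)"
  shows "sat M w \<phi> = sat M v \<phi>"
proof -
  define u where "u x = (if x \<in> fv \<phi> then v x else some_elem M (snd x))" for x
  have "u \<in> assignments M"
    using assms(3) some_elem_in[OF M] unfolding assignments_def srt_def u_def mem_Collect_eq
    by (metis (full_types))
  then have "sat M (\<sigma> \<circ> u) \<phi> = sat M u \<phi>"
    by (rule aut_sat_assignment[OF M \<sigma> _ assms(4)])
  moreover have "sat M w \<phi> = sat M (\<sigma> \<circ> u) \<phi>" "sat M v \<phi> = sat M u \<phi>"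
    by (rule sat_cong, simp add: u_def w)+
  ultimately show ?thesis by simp
qed

lemma elem_rel_aut:
  assumes M: "is_structure L M" and \<sigma>: "\<sigma> \<in> auts L M"
  shows "elem_rel V L M M {(a, \<sigma> a) | a. a \<in> universe M}"
  unfolding elem_rel_def
proof (intro conjI allI impI)
  show "\<exists>s. a \<in> car M s \<and> b \<in> car M s" if "(a, b) \<in> {(a, \<sigma> a) | a. a \<in> universe M}" for a b
    using that auts_car[OF \<sigma>] by (auto simp: universe_def)
qed (rule aut_sat[OF M \<sigma>, symmetric], auto)

text \<open>
  An elementary relation with full domain and range is the graph of an automorphism; preservation
  of operations and relations comes from atomic formulas.
\<close>

lemma aut_of_elem_rel:
  assumes inf: "infinite (UNIV :: 'v set)" and M: "is_structure L M"
    and H: "elem_rel TYPE('v) L M M H" "universe M \<subseteq> Domain H" "universe M \<subseteq> Range H"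
  shows "\<exists>\<sigma>\<in>auts L M. \<forall>a b. (a, b) \<in> H \<longrightarrow> \<sigma> a = b"
proof
  note inj = elem_rel_inj[OF inf H(1) M M]
  define \<sigma> where "\<sigma> = (\<lambda>a\<in>universe M. THE b. (a, b) \<in> H)"
  have \<sigma>: "\<sigma> a = b" if "(a, b) \<in> H" for a b
    using elem_rel_universe[OF H(1) that] that inj by (auto simp: \<sigma>_def intro!: the_equality)
  then show "\<forall>a b. (a, b) \<in> H \<longrightarrow> \<sigma> a = b" by blast
  have \<sigma>H: "(a, \<sigma> a) \<in> H" if "a \<in> universe M" for a
    using that H(2) \<sigma> by blast
  have "inj_on \<sigma> (universe M)" by (rule inj_onI) (metis \<sigma>H inj)
  moreover have "\<sigma> ` universe M = universe M"
    using \<sigma>H \<sigma> H(3) elem_rel_universe[OF H(1)] by (auto simp: image_iff) (metis Range.cases in_mono)+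
  ultimately have "\<sigma> \<in> Bij (universe M)" by (simp add: Bij_def bij_betw_def \<sigma>_def)
  moreover have "\<sigma> ` car M s = car M s" for s
  proof
    show "\<sigma> ` car M s \<subseteq> car M s"
      using \<sigma>H elem_rel_car1[OF H(1) _ M] unfolding universe_def by blast
    show "car M s \<subseteq> \<sigma> ` car M s"
    proof
      fix b assume b: "b \<in> car M s"
      then have "b \<in> Range H" using H(3) by (auto simp: universe_def)
      then obtain a where "(a, b) \<in> H" by blast
      then show "b \<in> \<sigma> ` car M s" using elem_rel_car2[OF H(1) _ M b] \<sigma> by blast
    qed
  qed
  moreover have "\<sigma> (fint M f as) = fint M f (map \<sigma> as)"
    if f: "f \<in> funs L" "as \<in> tuples M (fdom L f)" for f as
  proof -
    define ss where "ss = fdom L f"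
    have len: "length as = length ss" "\<And>i. i < length as \<Longrightarrow> as ! i \<in> car M (ss ! i)"
      using f(2) by (auto simp: tuples_def ss_def list_all2_conv_all_nth)
    define c where "c = fint M f as"
    have c: "c \<in> car M (fcod L f)" using M f unfolding is_structure_def c_def by blast
    define xs where "xs = map (\<lambda>i. (Suc i, ss ! i)) [0..<length ss]"
    define \<phi> :: "('a, 'b, nat \<times> 'c) fm" where "\<phi> = Eq (Fn f (map Var xs)) (Var (0, fcod L f))"
    define v where "v = (\<lambda>x :: nat \<times> 'c. (c # as) ! fst x)"
    define w where "w = (\<lambda>x :: nat \<times> 'c. \<sigma> (v x))"
    have fv: "fv \<phi> = insert (0, fcod L f) {(Suc i, ss ! i) | i. i < length ss}"
      by (auto simp: \<phi>_def xs_def)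
    have srt: "srt M v (fv \<phi>)"
      using len c by (auto simp: srt_def fv v_def)
    then have v: "v x \<in> universe M" if "x \<in> fv \<phi>" for x
      using that by (auto simp: srt_def universe_def)
    have mv: "map v xs = as"
      unfolding xs_def using len(1) by (auto intro!: nth_equalityI simp: v_def)
    have mw: "map w xs = map \<sigma> as"
      unfolding xs_def using len(1) by (auto intro!: nth_equalityI simp: w_def v_def)
    have "wf_fm L \<phi>"
      using f(1) by (auto simp: \<phi>_def xs_def list_all_iff ss_def map_nth comp_def)
    then have "sat M v \<phi> = sat M w \<phi>"
    proof (rule elem_rel_sat[OF inf H(1) _ srt])
      show "(v x, w x) \<in> H" if "x \<in> fv \<phi>" for x using v[OF that] \<sigma>H by (simp add: w_def)
      then show "srt M w (fv \<phi>)" using srt elem_rel_car1[OF H(1) _ M] unfolding srt_def by blast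
    qed
    moreover have "sat M v \<phi> \<longleftrightarrow> fint M f (map v xs) = c"
      by (simp add: \<phi>_def comp_def v_def)
    moreover have "sat M w \<phi> \<longleftrightarrow> fint M f (map w xs) = \<sigma> c"
      by (simp add: \<phi>_def comp_def w_def) (simp add: v_def)
    ultimately show ?thesis by (simp add: mv mw c_def)
  qed
  moreover have "rint M p (map \<sigma> as) \<longleftrightarrow> rint M p as"
    if p: "p \<in> rels L" "as \<in> tuples M (rdom L p)" for p as
  proof -
    define ss where "ss = rdom L p"
    have len: "length as = length ss" "\<And>i. i < length as \<Longrightarrow> as ! i \<in> car M (ss ! i)"
      using p(2) by (auto simp: tuples_def ss_def list_all2_conv_all_nth)
    define xs where "xs = map (\<lambda>i. (i, ss ! i)) [0..<length ss]"
    define \<phi> :: "('a, 'b, nat \<times> 'c) fm" where "\<phi> = Rel p (map Var xs)"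
    define v where "v = (\<lambda>x :: nat \<times> 'c. as ! fst x)"
    define w where "w = (\<lambda>x :: nat \<times> 'c. \<sigma> (v x))"
    have fv: "fv \<phi> = {(i, ss ! i) | i. i < length ss}"
      by (auto simp: \<phi>_def xs_def)
    have srt: "srt M v (fv \<phi>)"
      using len by (auto simp: srt_def fv v_def)
    then have v: "v x \<in> universe M" if "x \<in> fv \<phi>" for x
      using that by (auto simp: srt_def universe_def)
    have mv: "map v xs = as"
      unfolding xs_def using len(1) by (auto intro!: nth_equalityI simp: v_def)
    have mw: "map w xs = map \<sigma> as"
      unfolding xs_def using len(1) by (auto intro!: nth_equalityI simp: w_def v_def)
    have "wf_fm L \<phi>"
      using p(1) by (auto simp: \<phi>_def xs_def list_all_iff ss_def map_nth comp_def)
    then have "sat M v \<phi> = sat M w \<phi>"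
    proof (rule elem_rel_sat[OF inf H(1) _ srt])
      show "(v x, w x) \<in> H" if "x \<in> fv \<phi>" for x using v[OF that] \<sigma>H by (simp add: w_def)
      then show "srt M w (fv \<phi>)" using srt elem_rel_car1[OF H(1) _ M] unfolding srt_def by blast
    qed
    moreover have "sat M v \<phi> \<longleftrightarrow> rint M p (map v xs)"
      by (simp add: \<phi>_def comp_def)
    moreover have "sat M w \<phi> \<longleftrightarrow> rint M p (map w xs)"
      by (simp add: \<phi>_def comp_def)
    ultimately show ?thesis by (simp add: mv mw)
  qed
  ultimately show "\<sigma> \<in> auts L M" by (simp add: auts_def)
qed

text \<open>
  Homogeneity: a small elementary relation on a saturated structure is contained in the graph of
  an automorphism. This is back-and-forth along a well-order of the universe whose proper
  initial segments are small.
\<close>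

lemma homogeneous:
  fixes T :: "('f, 'p, 'v \<times> 's) fm set" and M :: "('f, 'p, 's, 'm) struct"
  assumes inf: "infinite (UNIV :: 'v set)" and M: "monster L T M"
    and G: "elem_rel TYPE('v) L M M G" "small M G"
  shows "\<exists>\<sigma>\<in>auts L M. \<forall>a b. (a, b) \<in> G \<longrightarrow> \<sigma> a = b"
proof -
  note str = monsterD(1)[OF M] and infM = monsterD(2)[OF M]
  define R where "R = |universe M| - Id"
  define B where "B x = {y. (y, x) \<in> R}" for x
  note wfR = strict_card_order(1)[of "universe M", folded R_def]
    and trR = strict_card_order(2)[of "universe M", folded R_def]
    and totR = strict_card_order(3)[of _ "universe M", folded R_def]
    and BU = strict_card_order(4)[of _ "universe M", folded R_def, folded B_def]
    and smallB = strict_card_order(5)[of _ "universe M", folded R_def, folded B_def, folded small_def]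
  \<comment> \<open>At stage \<open>y\<close>, the pair \<open>F y\<close> consists of an image and a preimage of \<open>y\<close>.\<close>
  define E where "E D F = G \<union> (\<Union>y\<in>D. {(y, fst (F y)), (snd (F y), y)})"
    for D and F :: "'m \<Rightarrow> 'm \<times> 'm"
  define P where "P F x r \<longleftrightarrow> (x \<in> universe M \<longrightarrow> elem_rel TYPE('v) L M M (E (insert x (B x)) (F(x := r))))"
    for F x r
  have limit: "elem_rel TYPE('v) L M M (E D F)"
    if D: "D \<subseteq> universe M" and PD: "\<And>y. y \<in> D \<Longrightarrow> elem_rel TYPE('v) L M M (E (insert y (B y)) F)" for D F
  proof (rule elem_rel_limit)
    fix Q assume Q: "finite Q" "Q \<subseteq> E D F"
    then have "\<forall>q\<in>Q - G. \<exists>y\<in>D. q \<in> {(y, fst (F y)), (snd (F y), y)}" by (auto simp: E_def)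
    then obtain h where h: "\<forall>q\<in>Q - G. h q \<in> D \<and> q \<in> {(h q, fst (F (h q))), (snd (F (h q)), h q)}"
      by metis
    define V where "V = h ` (Q - G)"
    have "finite V" "V \<subseteq> D" using Q(1) h by (auto simp: V_def)
    have QV: "Q \<subseteq> E V F"
    proof
      fix q assume "q \<in> Q"
      then show "q \<in> E V F" using h unfolding E_def V_def by (cases "q \<in> G") auto
    qed
    show "\<exists>G'. Q \<subseteq> G' \<and> elem_rel TYPE('v) L M M G'"
    proof (cases "V = {}")
      case True
      then show ?thesis using QV G(1) by (intro exI[of _ G]) (simp add: E_def)
    next
      case False
      have "\<exists>y\<in>V. \<forall>z\<in>V. z = y \<or> (z, y) \<in> R"
        by (rule finite_chain_max[OF \<open>finite V\<close> False trR]) (use totR D \<open>V \<subseteq> D\<close> in blast)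
      then obtain y where "y \<in> V" "V \<subseteq> insert y (B y)" by (auto simp: B_def)
      then have "Q \<subseteq> E (insert y (B y)) F" using QV unfolding E_def by blast
      then show ?thesis using PD \<open>y \<in> V\<close> \<open>V \<subseteq> D\<close> by blast
    qed
  qed
  have forward: "\<exists>b. elem_rel TYPE('v) L M M (insert (a, b) H)"
    if H: "elem_rel TYPE('v) L M M H" "small M H" and a: "a \<in> universe M" for H a
  proof -
    have "{a} \<subseteq> universe M" "small M {a}" using a by (simp_all add: small_finite[OF infM])
    from elem_rel_extend[OF inf str infM M H this]
    obtain H' where H': "elem_rel TYPE('v) L M M H'" "H \<subseteq> H'" "{a} \<subseteq> Domain H'" by blast
    then obtain b where "(a, b) \<in> H'" by blast
    with H' show ?thesis by (meson elem_rel_mono insert_subset)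
  qed
  have backward: "\<exists>b. elem_rel TYPE('v) L M M (insert (b, a) H)"
    if H: "elem_rel TYPE('v) L M M H" "small M H" and a: "a \<in> universe M" for H a
  proof -
    have "small M (H\<inverse>)"
      by (rule small_image_mono[OF H(2), of _ "\<lambda>(a, b). (b, a)"]) (auto simp: image_iff)
    then obtain b where "elem_rel TYPE('v) L M M (insert (a, b) (H\<inverse>))"
      using forward[OF elem_rel_converse[OF H(1)] _ a] by blast
    moreover have "(insert (a, b) (H\<inverse>))\<inverse> = insert (b, a) H" by auto
    ultimately show ?thesis using elem_rel_converse by metis
  qed
  have "\<exists>F. \<forall>x. P F x (F x)"
  proof (rule dependent_wf_choice[OF wfR])
    show "P f x r = P g x r" if "\<And>z. (z, x) \<in> R \<Longrightarrow> f z = g z" for f g x r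
    proof -
      have "E (insert x (B x)) (f(x := r)) = E (insert x (B x)) (g(x := r))"
        unfolding E_def by (rule arg_cong[of _ _ "\<lambda>S. G \<union> S"], rule SUP_cong) (use that in \<open>auto simp: B_def\<close>)
      then show ?thesis by (simp add: P_def)
    qed
    show "\<exists>r. P f x r" if IH: "\<And>y. (y, x) \<in> R \<Longrightarrow> P f y (f y)" for x f
    proof (cases "x \<in> universe M")
      case True
      let ?H = "E (B x) f"
      have H: "elem_rel TYPE('v) L M M ?H"
      proof (rule limit[OF BU])
        fix y assume "y \<in> B x"
        then show "elem_rel TYPE('v) L M M (E (insert y (B y)) f)"
          using IH[of y] BU[of x] by (auto simp: P_def B_def)
      qed
      have smallH: "small M ?H"
      proof -
        have "E (B x) f = G \<union> ((\<lambda>y. (y, fst (f y))) ` B x \<union> (\<lambda>y. (snd (f y), y)) ` B x)"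
          by (auto simp: E_def)
        then show ?thesis using smallB[OF True] G(2) by (simp add: small_Un[OF infM] small_image)
      qed
      obtain c where c: "elem_rel TYPE('v) L M M (insert (x, c) ?H)"
        using forward[OF H smallH True] by blast
      have "small M (insert (x, c) ?H)"
        using small_Un[OF infM small_finite[OF infM, of "{(x, c)}"] smallH] by simp
      then obtain d where d: "elem_rel TYPE('v) L M M (insert (d, x) (insert (x, c) ?H))"
        using backward[OF c _ True] by blast
      have "x \<notin> B x" by (simp add: B_def R_def)
      then have "E (insert x (B x)) (f(x := (c, d))) = insert (d, x) (insert (x, c) ?H)"
      proof -
        have "(\<Union>y\<in>B x. {(y, fst ((f(x := (c, d))) y)), (snd ((f(x := (c, d))) y), y)}) =
            (\<Union>y\<in>B x. {(y, fst (f y)), (snd (f y), y)})"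
          by (rule SUP_cong) (use \<open>x \<notin> B x\<close> in auto)
        then show ?thesis unfolding E_def by (simp add: insert_commute)
      qed
      then have "P f x (c, d)" using d by (simp add: P_def)
      then show ?thesis by blast
    qed (simp add: P_def)
  qed
  then obtain F where F: "\<forall>x. P F x (F x)" ..
  have "elem_rel TYPE('v) L M M (E (universe M) F)"
  proof (rule limit[OF subset_refl])
    show "elem_rel TYPE('v) L M M (E (insert y (B y)) F)" if "y \<in> universe M" for y
      using F[rule_format, of y] that by (simp add: P_def)
  qed
  moreover have "universe M \<subseteq> Domain (E (universe M) F)" "universe M \<subseteq> Range (E (universe M) F)"
    unfolding E_def by blast+
  ultimately obtain \<sigma> where "\<sigma> \<in> auts L M" "\<forall>a b. (a, b) \<in> E (universe M) F \<longrightarrow> \<sigma> a = b"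
    using aut_of_elem_rel[OF inf str] by blast
  then show ?thesis by (auto simp: E_def)
qed

section \<open>Elementary submodels\<close>

lemma assignments_car: "v \<in> assignments M \<Longrightarrow> v y \<in> car M (snd y)"
  unfolding assignments_def by blast

lemma assignments_upd:
  assumes "v \<in> assignments M" "b \<in> car M (snd x)"
  shows "v(x := b) \<in> assignments M"
  unfolding assignments_def
proof (intro CollectI allI)
  show "(v(x := b)) y \<in> car M (snd y)" for y
    using assms(2) assignments_car[OF assms(1), of y] by (cases "y = x") simp_all
qed

text \<open>
  The universes of the elementary submodels of \<open>M\<close> are the subsets \<open>C\<close> that pass the
  Tarski-Vaught test.
\<close>

definition elem_subset ::
  "'v itself \<Rightarrow> ('f, 'p, 's) lang \<Rightarrow> ('f, 'p, 's, 'm) struct \<Rightarrow> 'm set \<Rightarrow> bool" where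
  "elem_subset _ L M C \<longleftrightarrow> C \<subseteq> universe M \<and>
     (\<forall>(\<phi> :: ('f, 'p, 'v \<times> 's) fm) x v a. wf_fm L \<phi> \<longrightarrow> (\<forall>y\<in>fv \<phi> - {x}. v y \<in> C \<inter> car M (snd y)) \<longrightarrow>
        a \<in> car M (snd x) \<longrightarrow> sat M (v(x := a)) \<phi> \<longrightarrow> (\<exists>b\<in>C \<inter> car M (snd x). sat M (v(x := b)) \<phi>))"

lemma elem_subsetD:
  fixes \<phi> :: "('f, 'p, 'v \<times> 's) fm"
  assumes "elem_subset TYPE('v) L M C" "wf_fm L \<phi>" "\<And>y. y \<in> fv \<phi> - {x} \<Longrightarrow> v y \<in> C \<inter> car M (snd y)"
    "a \<in> car M (snd x)" "sat M (v(x := a)) \<phi>"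
  shows "\<exists>b\<in>C \<inter> car M (snd x). sat M (v(x := b)) \<phi>"
  using assms unfolding elem_subset_def by blast

text \<open>
  If a set passes the Tarski-Vaught test for one infinite type of names, it does so for all types.
\<close>

lemma elem_subset_names:
  fixes L :: "('f, 'p, 's) lang"
  assumes inf: "infinite (UNIV :: 'v set)" and C: "elem_subset TYPE('v) L M C"
  shows "elem_subset TYPE('u) L M C"
  unfolding elem_subset_def
proof (intro conjI allI impI)
  show "C \<subseteq> universe M" using C by (simp add: elem_subset_def)
  fix \<phi> :: "('f, 'p, 'u \<times> 's) fm" and x v a
  assume *: "wf_fm L \<phi>" "\<forall>y\<in>fv \<phi> - {x}. v y \<in> C \<inter> car M (snd y)" "a \<in> car M (snd x)"
    "sat M (v(x := a)) \<phi>"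
  define x0 :: "'v \<times> 's" where "x0 = (undefined, snd x)"
  have x0: "snd x0 = snd x" by (simp add: x0_def)
  obtain \<theta> \<eta> where \<theta>: "\<theta> x = x0" "\<And>y. snd (\<theta> y) = snd y" "\<And>z. snd (\<eta> z) = snd z"
      "\<And>y. y \<in> insert x (fv \<phi>) \<Longrightarrow> \<eta> (\<theta> y :: 'v \<times> 's) = y"
    by (rule fresh_names[OF inf finite_fv[of \<phi>] x0]) blast
  have sat: "sat M ((v \<circ> \<eta>)(x0 := c)) (sub \<phi> \<theta>) = sat M (v(x := c)) \<phi>" for c
    unfolding sat_sub[OF inf]
  proof (rule sat_cong)
    fix y assume "y \<in> fv \<phi>"
    then have "\<eta> (\<theta> y) = y" "\<eta> x0 = x" using \<theta> by (metis insertCI)+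
    then show "((v \<circ> \<eta>)(x0 := c) \<circ> \<theta>) y = (v(x := c)) y"
      using \<theta>(1) by (cases "y = x") auto
  qed
  have "\<exists>b\<in>C \<inter> car M (snd x0). sat M ((v \<circ> \<eta>)(x0 := b)) (sub \<phi> \<theta>)"
  proof (rule elem_subsetD[OF C])
    show "wf_fm L (sub \<phi> \<theta>)" using *(1) \<theta> by (intro wf_sub[OF inf])
    show "sat M ((v \<circ> \<eta>)(x0 := a)) (sub \<phi> \<theta>)" using *(4) sat by simp
    show "a \<in> car M (snd x0)" using *(3) x0 by simp
    fix z assume "z \<in> fv (sub \<phi> \<theta>) - {x0}"
    then obtain y where y: "y \<in> fv \<phi>" "z = \<theta> y" "y \<noteq> x" using \<theta>(1) by (auto simp: fv_sub[OF inf])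
    then show "(v \<circ> \<eta>) z \<in> C \<inter> car M (snd z)" using *(2) \<theta>(2,4) by simp
  qed
  then show "\<exists>b\<in>C \<inter> car M (snd x). sat M (v(x := b)) \<phi>" by (simp only: sat x0)
qed

lemma elem_submodel_elem_subset:
  fixes L :: "('f, 'p, 's) lang"
  assumes K: "elem_submodel TYPE('v) L K M"
  shows "elem_subset TYPE('v) L M (universe K)"
  unfolding elem_subset_def
proof (intro conjI allI impI)
  have strK: "is_structure L K" and strM: "is_structure L M" and sub: "\<And>s. car K s \<subseteq> car M s"
    and sat: "\<And>(\<phi> :: ('f, 'p, 'v \<times> 's) fm) v. wf_fm L \<phi> \<Longrightarrow> v \<in> assignments K \<Longrightarrow> sat K v \<phi> = sat M v \<phi>"
    using K by (auto simp: elem_submodel_def)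
  show "universe K \<subseteq> universe M" using sub by (auto simp: universe_def)
  have car: "universe K \<inter> car M s = car K s" for s
    using sub car_disjoint[OF strM] by (auto simp: universe_def) (metis in_mono)
  fix \<phi> :: "('f, 'p, 'v \<times> 's) fm" and x v a
  assume *: "wf_fm L \<phi>" "\<forall>y\<in>fv \<phi> - {x}. v y \<in> universe K \<inter> car M (snd y)" "a \<in> car M (snd x)"
    "sat M (v(x := a)) \<phi>"
  define u where "u y = (if y \<in> fv \<phi> - {x} then v y else some_elem K (snd y))" for y
  have u: "u \<in> assignments K"
    unfolding assignments_def
  proof (intro CollectI allI)
    show "u y \<in> car K (snd y)" for y
      using *(2) some_elem_in[OF strK] unfolding u_def car by auto
  qed
  have eq: "sat M (u(x := b)) \<phi> = sat M (v(x := b)) \<phi>" for b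
    by (rule sat_cong) (simp add: u_def)
  have "sat M u (Ex x \<phi>)" using *(3,4) eq by auto
  then have "sat K u (Ex x \<phi>)" using sat[of "Ex x \<phi>" u] u *(1) by simp
  then obtain b where b: "b \<in> car K (snd x)" "sat K (u(x := b)) \<phi>" by auto
  have "u(x := b) \<in> assignments K" using u b(1) by (rule assignments_upd)
  then have "sat M (v(x := b)) \<phi>" using b(2) sat[OF *(1)] eq by metis
  then show "\<exists>b\<in>universe K \<inter> car M (snd x). sat M (v(x := b)) \<phi>" unfolding car using b(1) by blast
qed

lemma elem_subset_elem_submodel:
  fixes L :: "('f, 'p, 's) lang" and M :: "('f, 'p, 's, 'm) struct"
  assumes inf: "infinite (UNIV :: 'v set)" and M: "is_structure L M"
    and C: "elem_subset TYPE('v) L M C"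
  shows "\<exists>K. elem_submodel TYPE('v) L K M \<and> universe K = C"
proof (intro exI conjI)
  define K where "K = M\<lparr>car := \<lambda>s. C \<inter> car M s\<rparr>"
  have K: "car K s = C \<inter> car M s" "fint K = fint M" "rint K = rint M" for s by (simp_all add: K_def)
  show "universe K = C" using C by (auto simp: universe_def K elem_subset_def)
  note C' = elem_subset_names[OF inf C, where 'u = nat]
  have tm: "tm_val K v t = tm_val M v t" for v and t :: "('f, 'v \<times> 's) tm"
  proof (induction t)
    case (Fn f ts)
    then have "map (tm_val K v) ts = map (tm_val M v) ts" by simp
    then show ?case by (simp only: tm_val.simps K)
  qed simp
  have sat: "sat K v \<phi> = sat M v \<phi>" if "wf_fm L \<phi>" "v \<in> assignments K"
    for v and \<phi> :: "('f, 'p, 'v \<times> 's) fm"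
    using that
  proof (induction \<phi> arbitrary: v)
    case (Rel p ts)
    have "map (tm_val K v) ts = map (tm_val M v) ts" by (simp add: tm)
    then show ?case by (simp only: sat.simps K)
  next
    case (Ex x \<phi>)
    have v: "v y \<in> C \<inter> car M (snd y)" for y
      using assignments_car[OF Ex.prems(2), of y] unfolding K .
    have IH: "sat K (v(x := b)) \<phi> = sat M (v(x := b)) \<phi>" if "b \<in> C \<inter> car M (snd x)" for b
    proof (rule Ex.IH)
      show "v(x := b) \<in> assignments K"
        by (rule assignments_upd[OF Ex.prems(2)]) (use that in \<open>simp add: K\<close>)
    qed (use Ex.prems in simp)
    have "(\<exists>a\<in>car M (snd x). sat M (v(x := a)) \<phi>) \<longleftrightarrow> (\<exists>a\<in>C \<inter> car M (snd x). sat M (v(x := a)) \<phi>)"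
      using elem_subsetD[OF C, of \<phi> x v] Ex.prems(1) v by (metis Int_iff wf_fm.simps(5))
    then show ?case using IH by (simp add: K)
  qed (simp_all add: tm)
  have "is_structure L K"
    unfolding is_structure_def
  proof (intro conjI allI ballI impI)
    show "car K s \<noteq> {}" for s
      using elem_subsetD[OF C', of "Eq (Var (0, s)) (Var (0, s))" "(0, s)" _ "some_elem M s"] some_elem_in[OF M]
      by (auto simp: K)
    show "car K s \<inter> car K t = {}" if "s \<noteq> t" for s t
      using M that by (auto simp: K is_structure_def)
    fix f as assume f: "f \<in> funs L" "as \<in> tuples K (fdom L f)"
    define ss where "ss = fdom L f"
    have len: "length as = length ss" "\<And>i. i < length as \<Longrightarrow> as ! i \<in> C \<inter> car M (ss ! i)"
      using f(2) by (auto simp: tuples_def ss_def list_all2_conv_all_nth K)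
    then have "as \<in> tuples M (fdom L f)"
      by (auto simp: tuples_def ss_def list_all2_conv_all_nth)
    then have c: "fint M f as \<in> car M (fcod L f)" using M f(1) unfolding is_structure_def by blast
    define xs where "xs = map (\<lambda>i. (Suc i, ss ! i)) [0..<length ss]"
    define \<phi> :: "('f, 'p, nat \<times> 's) fm" where "\<phi> = Eq (Fn f (map Var xs)) (Var (0, fcod L f))"
    define v where "v = (\<lambda>x :: nat \<times> 's. (undefined # as) ! fst x)"
    have fv: "fv \<phi> = insert (0, fcod L f) {(Suc i, ss ! i) | i. i < length ss}"
      by (auto simp: \<phi>_def xs_def)
    have mv: "map (v((0, fcod L f) := b)) xs = as" for b
      unfolding xs_def using len(1) by (auto intro!: nth_equalityI simp: v_def)
    have sat: "sat M (v((0, fcod L f) := b)) \<phi> \<longleftrightarrow> fint M f as = b" for b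
      using mv[of b] by (simp add: \<phi>_def comp_def del: fun_upd_apply) simp
    have "\<exists>b\<in>C \<inter> car M (snd (0 :: nat, fcod L f)). sat M (v((0, fcod L f) := b)) \<phi>"
    proof (rule elem_subsetD[OF C'])
      show "wf_fm L \<phi>"
        using f(1) by (auto simp: \<phi>_def xs_def list_all_iff ss_def map_nth comp_def)
      show "v y \<in> C \<inter> car M (snd y)" if "y \<in> fv \<phi> - {(0, fcod L f)}" for y
        using that len by (auto simp: fv v_def)
      show "sat M (v((0, fcod L f) := fint M f as)) \<phi>" by (simp only: sat)
    qed (use c in simp)
    then show "fint K f as \<in> car K (fcod L f)" by (auto simp: sat K)
  qed
  then show "elem_submodel TYPE('v) L K M"
    unfolding elem_submodel_def using M sat by (auto simp: K)
qed

lemma elem_subset_image: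
  fixes L :: "('f, 'p, 's) lang"
  assumes M: "is_structure L M" and M': "is_structure L M'"
    and H: "elem_rel TYPE('v) L M M' H" and C: "elem_subset TYPE('v) L M C" "C \<subseteq> Domain H"
  shows "elem_subset TYPE('v) L M' (H `` C)"
  unfolding elem_subset_def
proof (intro conjI allI impI)
  show "H `` C \<subseteq> universe M'" using elem_rel_universe[OF H] by auto
  fix \<phi> :: "('f, 'p, 'v \<times> 's) fm" and x v a
  assume *: "wf_fm L \<phi>" "\<forall>y\<in>fv \<phi> - {x}. v y \<in> H `` C \<inter> car M' (snd y)" "a \<in> car M' (snd x)"
    "sat M' (v(x := a)) \<phi>"
  then have "\<forall>y\<in>fv \<phi> - {x}. \<exists>c\<in>C. (c, v y) \<in> H" by blast
  then obtain u where u: "\<forall>y\<in>fv \<phi> - {x}. u y \<in> C \<and> (u y, v y) \<in> H" by metis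
  then have uM: "\<forall>y\<in>fv \<phi> - {x}. u y \<in> car M (snd y)"
    using *(2) elem_rel_car2[OF H _ M'] by blast
  have "sat M u (Ex x \<phi>) = sat M' v (Ex x \<phi>)"
    by (rule elem_relD[OF H]) (use u uM *(1,2) in \<open>simp_all add: srt_def\<close>)
  then obtain c' where "c' \<in> car M (snd x)" "sat M (u(x := c')) \<phi>" using *(3,4) by auto
  then obtain c where c: "c \<in> C" "c \<in> car M (snd x)" "sat M (u(x := c)) \<phi>"
    using elem_subsetD[OF C(1) *(1), of x u c'] u uM by auto
  then obtain d where d: "(c, d) \<in> H" using C(2) by blast
  then have dM: "d \<in> car M' (snd x)" using elem_rel_car1[OF H _ M] c(2) by blast
  have "sat M (u(x := c)) \<phi> = sat M' (v(x := d)) \<phi>"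
    by (rule elem_relD[OF H]) (use u uM *(1,2) c(2) d dM in \<open>simp_all add: srt_def\<close>)
  then show "\<exists>b\<in>H `` C \<inter> car M' (snd x). sat M' (v(x := b)) \<phi>" using c d dM by blast
qed

subsection \<open>Small elementary submodels exist\<close>

text \<open>
  The closure under a set of finitary operations, each of which is applied to lists of all lengths.
\<close>

inductive_set closure :: "('a list \<Rightarrow> 'a) set \<Rightarrow> 'a set" for B where
  "b \<in> B \<Longrightarrow> xs \<in> lists (closure B) \<Longrightarrow> b xs \<in> closure B"

lemma card_closure:
  assumes S: "infinite S" and B: "|B| \<le>o |S|"
  shows "|closure B| \<le>o |S|"
proof -
  define D where "D = rec_nat {} (\<lambda>_ D. (\<lambda>(b, xs). b xs) ` (B \<times> lists D))"
  have D0: "D 0 = {}" and DS: "D (Suc n) = (\<lambda>(b, xs). b xs) ` (B \<times> lists (D n))" for n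
    by (simp_all add: D_def)
  have "D n \<subseteq> D (Suc n)" for n
  proof (induction n)
    case (Suc n)
    then show ?case unfolding DS[of "Suc n"] DS[of n] using lists_mono by blast
  qed (simp add: D0)
  then have mono: "D m \<subseteq> D n" if "m \<le> n" for m n
    using that lift_Suc_mono_le[of D] by blast
  have "closure B \<subseteq> (\<Union>n. D n)"
  proof
    fix x assume "x \<in> closure B"
    then show "x \<in> (\<Union>n. D n)"
    proof induction
      case (1 b xs)
      have "\<forall>y\<in>set xs. \<exists>n. y \<in> D n" using 1(2) by auto
      then obtain h where h: "\<forall>y\<in>set xs. y \<in> D (h y)" by metis
      obtain n where "\<forall>y\<in>set xs. h y \<le> n"
        using finite_set[of xs] by (metis finite_nat_set_iff_bounded_le finite_imageI imageI)
      then have "xs \<in> lists (D n)" using h mono by blast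
      then have "b xs \<in> D (Suc n)"
        unfolding DS using 1(1) by (intro image_eqI[of _ _ "(b, xs)"]) auto
      then show ?case by blast
    qed
  qed
  moreover have "|D n| \<le>o |S|" for n
  proof (induction n)
    case 0
    then show ?case by (simp add: D0 card_of_empty)
  next
    case (Suc n)
    have "|lists (D n)| \<le>o |lists S|" using Suc by (simp add: card_of_lists_mono)
    then have "|lists (D n)| \<le>o |S|"
      using card_of_lists_infinite[OF S] ordLeq_ordIso_trans by blast
    then have "|B \<times> lists (D n)| \<le>o |S|" using card_of_Times_ordLeq_infinite[OF S B] by blast
    then show ?case unfolding DS using card_of_image ordLeq_transitive by blast
  qed
  moreover have "|\<Union>n. D n| \<le>o |S|"
    by (rule card_of_UNION_ordLeq_infinite[OF S])
      (use S infinite_iff_card_of_nat calculation(2) in auto)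
  ultimately show ?thesis using card_of_mono1 ordLeq_transitive by blast
qed

text \<open>
  A set whose cardinality is that of the language, including its sorts and \<open>\<aleph>\<^sub>0\<close>.
\<close>

definition symbols :: "('f, 'p, 's) lang \<Rightarrow> (nat + 's + 'f + 'p) set" where
  "symbols L = UNIV <+> UNIV <+> funs L <+> rels L"

lemma infinite_symbols: "infinite (symbols L)"
  unfolding symbols_def by (simp add: finite_Plus_iff)

lemma card_variables:
  fixes L :: "('f, 'p, 's) lang"
  shows "|UNIV :: (nat \<times> 's) set| \<le>o |symbols L|"
proof -
  have "|UNIV :: 's set| \<le>o |symbols L|"
    by (rule surj_imp_ordLeq[of _ "\<lambda>x. case x of Inr (Inl s) \<Rightarrow> s | _ \<Rightarrow> undefined"])
      (auto simp: symbols_def image_iff intro!: bexI[of _ "Inr (Inl _)"])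
  moreover have "|UNIV :: nat set| \<le>o |symbols L|"
    using infinite_symbols infinite_iff_card_of_nat by blast
  ultimately show ?thesis
    using card_of_Times_ordLeq_infinite[OF infinite_symbols, of UNIV L UNIV] by simp
qed

lemma card_formulas:
  fixes L :: "('f, 'p, 's) lang"
  shows "|{\<phi> :: ('f, 'p, nat \<times> 's) fm. wf_fm L \<phi>}| \<le>o |symbols L|"
proof -
  let ?S = "symbols L"
  note S = infinite_symbols[of L]
  have Un: "|A \<union> B| \<le>o |?S|" if "|A| \<le>o |?S|" "|B| \<le>o |?S|" for A B :: "'z set"
    using card_of_Un_ordLeq_infinite[OF S] that by blast
  have Im: "|h ` A| \<le>o |?S|" if "|A| \<le>o |?S|" for h :: "'y \<Rightarrow> 'z" and A
    using card_of_image that ordLeq_transitive by blast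
  have Fin: "|A| \<le>o |?S|" if "finite A" for A :: "'z set"
    using that S finite_ordLess_infinite2 ordLess_imp_ordLeq by blast
  have fns: "|funs L| \<le>o |?S|"
    by (rule card_of_ordLeqI[of "\<lambda>f. Inr (Inr (Inl f))"]) (auto simp: symbols_def inj_on_def)
  have rls: "|rels L| \<le>o |?S|"
    by (rule card_of_ordLeqI[of "\<lambda>f. Inr (Inr (Inr f))"]) (auto simp: symbols_def inj_on_def)
  note vars = card_variables[of L]
  define Tm where "Tm = {t :: ('f, nat \<times> 's) tm. wf_tm L t}"
  have Tm: "|Tm| \<le>o |?S|"
  proof -
    define B :: "(('f, nat \<times> 's) tm list \<Rightarrow> ('f, nat \<times> 's) tm) set"
      where "B = (\<lambda>x _. Var x) ` UNIV \<union> (\<lambda>f ts. Fn f ts) ` funs L"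
    have "t \<in> closure B" if "wf_tm L t" for t :: "('f, nat \<times> 's) tm"
      using that
    proof (induction t)
      case (Var x)
      have "(\<lambda>_. Var x) [] \<in> closure B" by (rule closure.intros[where b = "\<lambda>_. Var x" and xs = "[]"]) (auto simp: B_def)
      then show ?case by simp
    next
      case (Fn f ts)
      show ?case by (rule closure.intros[where b = "Fn f" and xs = ts]) (use Fn in \<open>auto simp: B_def list_all_iff\<close>)
    qed
    then have "Tm \<subseteq> closure B" by (auto simp: Tm_def)
    moreover have "|closure B| \<le>o |?S|"
      unfolding B_def by (intro card_closure S Un Im vars fns)
    ultimately show ?thesis using card_of_mono1 ordLeq_transitive by blast
  qed
  have lTm: "|lists Tm| \<le>o |?S|"
    using card_of_lists_mono[OF Tm] card_of_lists_infinite[OF S] ordLeq_ordIso_trans by blast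
  define B :: "(('f, 'p, nat \<times> 's) fm list \<Rightarrow> ('f, 'p, nat \<times> 's) fm) set"
    where "B = ((\<lambda>(t, u) _. Eq t u) ` (Tm \<times> Tm) \<union> (\<lambda>(p, ts) _. Rel p ts) ` (rels L \<times> lists Tm)) \<union>
    ({\<lambda>\<phi>s. Neg (hd \<phi>s), \<lambda>\<phi>s. Conj (hd \<phi>s) (last \<phi>s)} \<union> (\<lambda>x \<phi>s. Ex x (hd \<phi>s)) ` UNIV)"
  have "\<phi> \<in> closure B" if "wf_fm L \<phi>" for \<phi> :: "('f, 'p, nat \<times> 's) fm"
    using that
  proof (induction \<phi>)
    case (Eq t u)
    have "(\<lambda>_. Eq t u) [] \<in> closure B"
      by (rule closure.intros[where b = "\<lambda>_. Eq t u" and xs = "[]"]) (use Eq in \<open>auto simp: B_def Tm_def intro!: image_eqI[of _ _ "(t, u)"]\<close>)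
    then show ?case by simp
  next
    case (Rel p ts)
    have "(\<lambda>_. Rel p ts) [] \<in> closure B"
      by (rule closure.intros[where b = "\<lambda>_. Rel p ts" and xs = "[]"])
        (use Rel in \<open>auto simp: B_def Tm_def list_all_iff intro!: image_eqI[of _ _ "(p, ts)"]\<close>)
    then show ?case by simp
  next
    case (Neg \<phi>)
    have "(\<lambda>\<phi>s. Neg (hd \<phi>s)) [\<phi>] \<in> closure B"
      by (rule closure.intros[where b = "\<lambda>\<phi>s. Neg (hd \<phi>s)" and xs = "[\<phi>]"]) (use Neg in \<open>auto simp: B_def\<close>)
    then show ?case by simp
  next
    case (Conj \<phi> \<psi>)
    have "(\<lambda>\<phi>s. Conj (hd \<phi>s) (last \<phi>s)) [\<phi>, \<psi>] \<in> closure B"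
      by (rule closure.intros[where b = "\<lambda>\<phi>s. Conj (hd \<phi>s) (last \<phi>s)" and xs = "[\<phi>, \<psi>]"]) (use Conj in \<open>auto simp: B_def\<close>)
    then show ?case by simp
  next
    case (Ex x \<phi>)
    have "(\<lambda>\<phi>s. Ex x (hd \<phi>s)) [\<phi>] \<in> closure B"
      by (rule closure.intros[where b = "\<lambda>\<phi>s. Ex x (hd \<phi>s)" and xs = "[\<phi>]"]) (use Ex in \<open>auto simp: B_def\<close>)
    then show ?case by simp
  qed
  then have "{\<phi> :: ('f, 'p, nat \<times> 's) fm. wf_fm L \<phi>} \<subseteq> closure B" by blast
  moreover have "|closure B| \<le>o |?S|"
    unfolding B_def
    by (intro card_closure S Un Im vars Fin card_of_Times_ordLeq_infinite Tm lTm rls) simp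
  ultimately show ?thesis using card_of_mono1 ordLeq_transitive by blast
qed

text \<open>
  The downward Loewenheim-Skolem theorem: the closure of the empty set under witness functions
  for all formulas in countably many names.
\<close>

lemma ex_elem_subset:
  fixes L :: "('f, 'p, 's) lang" and M :: "('f, 'p, 's, 'm) struct"
  assumes M: "is_structure L M"
  shows "\<exists>C. elem_subset TYPE('v) L M C \<and> |C| \<le>o |symbols L|"
proof -
  let ?S = "symbols L"
  note S = infinite_symbols[of L]
  define vars where "vars \<phi> x = (SOME ys. set ys = fv \<phi> - {x})" for \<phi> :: "('f, 'p, nat \<times> 's) fm" and x
  have vars: "set (vars \<phi> x) = fv \<phi> - {x}" for \<phi> x
    unfolding vars_def by (rule someI_ex, rule finite_list) simp
  define val where "val \<phi> x as = (\<lambda>y. the (map_of (zip (vars \<phi> x) as) y))"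
    for \<phi> x and as :: "'m list"
  define wit where "wit \<phi> x as =
      (if \<exists>a\<in>car M (snd x). sat M ((val \<phi> x as)(x := a)) \<phi>
       then SOME a. a \<in> car M (snd x) \<and> sat M ((val \<phi> x as)(x := a)) \<phi> else some_elem M (snd x))"
    for \<phi> x as
  have wit: "wit \<phi> x as \<in> car M (snd x) \<and>
      ((\<exists>a\<in>car M (snd x). sat M ((val \<phi> x as)(x := a)) \<phi>) \<longrightarrow> sat M ((val \<phi> x as)(x := wit \<phi> x as)) \<phi>)"
    for \<phi> x as
  proof (cases "\<exists>a\<in>car M (snd x). sat M ((val \<phi> x as)(x := a)) \<phi>")
    case True
    then have "\<exists>a. a \<in> car M (snd x) \<and> sat M ((val \<phi> x as)(x := a)) \<phi>" by blast
    from someI_ex[OF this] show ?thesis using True by (simp add: wit_def)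
  qed (auto simp: wit_def some_elem_in[OF M])
  define B where "B = (\<lambda>(\<phi>, x). wit \<phi> x) ` ({\<phi>. wf_fm L \<phi>} \<times> UNIV)"
  define C where "C = closure B"
  have "C \<subseteq> universe M"
    unfolding C_def
  proof
    fix a assume "a \<in> closure B"
    then show "a \<in> universe M"
    proof cases
      case (1 b as)
      then obtain \<phi> x where "a = wit \<phi> x as" by (auto simp: B_def)
      then show ?thesis using wit[of \<phi> x as] unfolding universe_def by blast
    qed
  qed
  moreover have "\<exists>b\<in>C \<inter> car M (snd x). sat M (v(x := b)) \<phi>"
    if *: "wf_fm L \<phi>" "\<forall>y\<in>fv \<phi> - {x}. v y \<in> C \<inter> car M (snd y)" "a \<in> car M (snd x)" "sat M (v(x := a)) \<phi>"
    for \<phi> :: "('f, 'p, nat \<times> 's) fm" and x v a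
  proof -
    define as where "as = map v (vars \<phi> x)"
    have "val \<phi> x as y = v y" if "y \<in> fv \<phi> - {x}" for y
      using that vars by (simp add: val_def as_def map_of_zip_map)
    then have eq: "sat M ((val \<phi> x as)(x := b)) \<phi> = sat M (v(x := b)) \<phi>" for b
      by (intro sat_cong) auto
    have "wit \<phi> x as \<in> C"
      unfolding C_def
    proof (rule closure.intros)
      show "wit \<phi> x \<in> B" using *(1) by (auto simp: B_def)
      show "as \<in> lists (closure B)" using *(2) by (auto simp: as_def vars C_def)
    qed
    then show ?thesis using wit[of \<phi> x as] eq *(3,4) by auto
  qed
  ultimately have "elem_subset TYPE(nat) L M C"
    unfolding elem_subset_def by blast
  then have "elem_subset TYPE('v) L M C" by (rule elem_subset_names[rotated]) simp
  moreover have "|C| \<le>o |?S|"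
  proof -
    have "|{\<phi> :: ('f, 'p, nat \<times> 's) fm. wf_fm L \<phi>} \<times> (UNIV :: (nat \<times> 's) set)| \<le>o |?S|"
      by (rule card_of_Times_ordLeq_infinite[OF S card_formulas card_variables])
    then have "|B| \<le>o |?S|" unfolding B_def using card_of_image ordLeq_transitive by blast
    then show ?thesis unfolding C_def by (rule card_closure[OF S])
  qed
  ultimately show ?thesis by blast
qed

lemma small_symbols:
  assumes "monster L T M"
  shows "small M (symbols L)"
  using assms unfolding symbols_def
  by (intro small_Plus monsterD(2)[OF assms]) (simp_all add: monster_def)

lemma small_card: "|C| \<le>o |S| \<Longrightarrow> small M S \<Longrightarrow> small M C"
  unfolding small_def using ordLeq_ordLess_trans by blast

section \<open>The group of Lascar strong automorphisms\<close>

lemma auts_ext: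
  assumes "\<sigma> \<in> auts L M" "\<tau> \<in> auts L M" "\<And>a. a \<in> universe M \<Longrightarrow> \<sigma> a = \<tau> a"
  shows "\<sigma> = \<tau>"
  using assms auts_Bij Bij_imp_extensional by (metis extensionalityI)

lemma tuples_universe: "as \<in> tuples M ss \<Longrightarrow> a \<in> set as \<Longrightarrow> a \<in> universe M"
  by (auto simp: tuples_def universe_def list_all2_conv_all_nth in_set_conv_nth)

lemma auts_id: "is_structure L M \<Longrightarrow> (\<lambda>a\<in>universe M. a) \<in> auts L M"
proof -
  assume M: "is_structure L M"
  have car: "a \<in> universe M" if "a \<in> car M s" for a s using that by (auto simp: universe_def)
  have map: "map (\<lambda>a\<in>universe M. a) as = as" if "as \<in> tuples M ss" for as ss
    using tuples_universe[OF that] by (auto intro!: map_idI)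
  have f: "fint M f as \<in> universe M" if "f \<in> funs L" "as \<in> tuples M (fdom L f)" for f as
    using M that car unfolding is_structure_def by blast
  have "(\<lambda>a\<in>universe M. a) ` car M s = car M s" for s
    using car by (auto simp: image_iff)
  then show ?thesis by (simp add: auts_def id_Bij map f)
qed

lemma auts_compose:
  assumes M: "is_structure L M" and \<sigma>: "\<sigma> \<in> auts L M" and \<tau>: "\<tau> \<in> auts L M"
  shows "compose (universe M) \<sigma> \<tau> \<in> auts L M"
proof -
  have car: "a \<in> universe M" if "a \<in> car M s" for a s using that by (auto simp: universe_def)
  have map: "map (compose (universe M) \<sigma> \<tau>) as = map \<sigma> (map \<tau> as)" if "as \<in> tuples M ss" for as ss
    using tuples_universe[OF that] by (auto simp: compose_def)
  have tup: "map \<tau> as \<in> tuples M ss" if "as \<in> tuples M ss" for as ss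
    using that auts_car[OF \<tau>] by (auto simp: tuples_def list_all2_conv_all_nth)
  have f: "fint M f as \<in> universe M" if "f \<in> funs L" "as \<in> tuples M (fdom L f)" for f as
    using M that car unfolding is_structure_def by blast
  have img: "compose (universe M) \<sigma> \<tau> ` car M s = \<sigma> ` \<tau> ` car M s" for s
    using car by (auto simp: compose_def image_iff)
  show ?thesis
    using \<sigma> \<tau> unfolding auts_def
    by (auto simp: compose_Bij img map tup f compose_eq simp del: map_map)
qed

lemma auts_inverse:
  assumes M: "is_structure L M" and \<sigma>: "\<sigma> \<in> auts L M"
  shows "\<exists>\<tau>\<in>auts L M. \<forall>a\<in>universe M. \<tau> (\<sigma> a) = a"
proof -
  let ?H = "{(a, \<sigma> a) | a. a \<in> universe M}\<inverse>"
  have 1: "elem_rel TYPE(nat) L M M ?H"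
    by (rule elem_rel_converse[OF elem_rel_aut[OF M \<sigma>]])
  have 2: "universe M \<subseteq> Domain ?H" "universe M \<subseteq> Range ?H"
    using auts_image[OF \<sigma>] by blast+
  obtain \<tau> where "\<tau> \<in> auts L M" "\<forall>a b. (a, b) \<in> ?H \<longrightarrow> \<tau> a = b"
    using aut_of_elem_rel[OF infinite_UNIV_nat M 1 2] by blast
  then show ?thesis by (intro bexI[of _ \<tau>]) auto
qed

lemma Aut_carrier [simp]: "carrier (Aut L M) = auts L M"
  by (simp add: Aut_def)

lemma Aut_mult: "\<sigma> \<in> auts L M \<Longrightarrow> \<tau> \<in> auts L M \<Longrightarrow> \<sigma> \<otimes>\<^bsub>Aut L M\<^esub> \<tau> = compose (universe M) \<sigma> \<tau>"
  by (simp add: Aut_def BijGroup_def auts_Bij)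

lemma Aut_apply:
  "\<sigma> \<in> auts L M \<Longrightarrow> \<tau> \<in> auts L M \<Longrightarrow> a \<in> universe M \<Longrightarrow> (\<sigma> \<otimes>\<^bsub>Aut L M\<^esub> \<tau>) a = \<sigma> (\<tau> a)"
  by (simp add: Aut_mult compose_eq)

lemma Aut_one_apply: "a \<in> universe M \<Longrightarrow> \<one>\<^bsub>Aut L M\<^esub> a = a"
  by (simp add: Aut_def BijGroup_def)

lemma Aut_group:
  assumes M: "is_structure L M"
  shows "group (Aut L M)"
proof (rule groupI)
  have one: "\<one>\<^bsub>Aut L M\<^esub> \<in> auts L M"
    using auts_id[OF M] by (simp add: Aut_def BijGroup_def)
  have mult: "\<sigma> \<otimes>\<^bsub>Aut L M\<^esub> \<tau> \<in> auts L M" if "\<sigma> \<in> auts L M" "\<tau> \<in> auts L M" for \<sigma> \<tau>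
    using that auts_compose[OF M] by (simp add: Aut_mult)
  show "\<one>\<^bsub>Aut L M\<^esub> \<in> carrier (Aut L M)" using one by simp
  show "x \<otimes>\<^bsub>Aut L M\<^esub> y \<in> carrier (Aut L M)"
    if "x \<in> carrier (Aut L M)" "y \<in> carrier (Aut L M)" for x y using that mult by simp
  show "x \<otimes>\<^bsub>Aut L M\<^esub> y \<otimes>\<^bsub>Aut L M\<^esub> z = x \<otimes>\<^bsub>Aut L M\<^esub> (y \<otimes>\<^bsub>Aut L M\<^esub> z)"
    if "x \<in> carrier (Aut L M)" "y \<in> carrier (Aut L M)" "z \<in> carrier (Aut L M)" for x y z
    by (rule auts_ext[of _ L M]) (use that mult in \<open>simp_all add: Aut_apply auts_universe[of z L M]\<close>)
  show "\<one>\<^bsub>Aut L M\<^esub> \<otimes>\<^bsub>Aut L M\<^esub> x = x" if "x \<in> carrier (Aut L M)" for x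
    by (rule auts_ext[of _ L M])
      (use that one mult in \<open>simp_all add: Aut_apply Aut_one_apply auts_universe[of x L M]\<close>)
  show "\<exists>y\<in>carrier (Aut L M). y \<otimes>\<^bsub>Aut L M\<^esub> x = \<one>\<^bsub>Aut L M\<^esub>" if x: "x \<in> carrier (Aut L M)" for x
  proof -
    obtain y where y: "y \<in> auts L M" "\<forall>a\<in>universe M. y (x a) = a"
      using auts_inverse[OF M, of x] x by auto
    have "y \<otimes>\<^bsub>Aut L M\<^esub> x = \<one>\<^bsub>Aut L M\<^esub>"
      by (rule auts_ext[of _ L M]) (use x y one mult in \<open>simp_all add: Aut_apply Aut_one_apply\<close>)
    then show ?thesis using y(1) by auto
  qed
qed

lemma Aut_inv:
  assumes M: "is_structure L M" and \<sigma>: "\<sigma> \<in> auts L M"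
  shows "inv\<^bsub>Aut L M\<^esub> \<sigma> \<in> auts L M"
    "a \<in> universe M \<Longrightarrow> (inv\<^bsub>Aut L M\<^esub> \<sigma>) (\<sigma> a) = a"
    "a \<in> universe M \<Longrightarrow> \<sigma> ((inv\<^bsub>Aut L M\<^esub> \<sigma>) a) = a"
proof -
  interpret group "Aut L M" by (rule Aut_group[OF M])
  show *: "inv\<^bsub>Aut L M\<^esub> \<sigma> \<in> auts L M" using inv_closed \<sigma> by simp
  show "a \<in> universe M \<Longrightarrow> (inv\<^bsub>Aut L M\<^esub> \<sigma>) (\<sigma> a) = a"
    using l_inv[of \<sigma>] \<sigma> Aut_apply[OF * \<sigma>, of a] Aut_one_apply[of a M L] by simp
  show "a \<in> universe M \<Longrightarrow> \<sigma> ((inv\<^bsub>Aut L M\<^esub> \<sigma>) a) = a"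
    using r_inv[of \<sigma>] \<sigma> Aut_apply[OF \<sigma> *, of a] Aut_one_apply[of a M L] by simp
qed

text \<open>Products of \<open>n\<close> elements of a set of generators.\<close>

primrec words :: "('a, 'b) monoid_scheme \<Rightarrow> 'a set \<Rightarrow> nat \<Rightarrow> 'a set" where
  "words G S 0 = {\<one>\<^bsub>G\<^esub>}"
| "words G S (Suc n) = {g \<otimes>\<^bsub>G\<^esub> h | g h. g \<in> S \<and> h \<in> words G S n}"

lemma words_carrier:
  assumes "group G" "S \<subseteq> carrier G"
  shows "words G S n \<subseteq> carrier G"
proof -
  interpret group G by fact
  show ?thesis by (induction n) (use assms(2) in auto)
qed

lemma words_mult:
  assumes "group G" "S \<subseteq> carrier G"
  shows "g \<in> words G S m \<Longrightarrow> h \<in> words G S n \<Longrightarrow> g \<otimes>\<^bsub>G\<^esub> h \<in> words G S (m + n)"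
proof (induction m arbitrary: g)
  case 0
  interpret group G by fact
  show ?case using 0 words_carrier[OF assms, of n] by auto
next
  case (Suc m)
  interpret group G by fact
  obtain a g' where "a \<in> S" "g' \<in> words G S m" "g = a \<otimes>\<^bsub>G\<^esub> g'" using Suc.prems by auto
  moreover have "g' \<otimes>\<^bsub>G\<^esub> h \<in> words G S (m + n)" using Suc.IH[of g'] Suc.prems(2) calculation(2) by blast
  moreover have "g \<otimes>\<^bsub>G\<^esub> h = a \<otimes>\<^bsub>G\<^esub> (g' \<otimes>\<^bsub>G\<^esub> h)"
    using calculation Suc.prems(2) words_carrier[OF assms] assms(2) by (simp add: m_assoc subset_iff)
  ultimately show ?case by auto
qed

lemma generate_eq_words:
  assumes G: "group G" and S: "S \<subseteq> carrier G" "\<And>g. g \<in> S \<Longrightarrow> inv\<^bsub>G\<^esub> g \<in> S"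
  shows "generate G S = (\<Union>n. words G S n)"
proof
  interpret group G by fact
  have 1: "g \<in> words G S 1" if "g \<in> S" for g
  proof -
    have "g = g \<otimes>\<^bsub>G\<^esub> \<one>\<^bsub>G\<^esub>" using that S(1) by auto
    then show ?thesis using that by auto
  qed
  show "generate G S \<subseteq> (\<Union>n. words G S n)"
  proof
    fix g assume "g \<in> generate G S"
    then show "g \<in> (\<Union>n. words G S n)"
    proof induction
      case one
      show ?case by (rule UN_I[of 0]) simp_all
    next
      case (incl h)
      then show ?case using 1 by blast
    next
      case (inv h)
      then show ?case using 1 S(2) by blast
    next
      case (eng h1 h2)
      then show ?case using words_mult[OF G S(1)] by blast
    qed
  qed
  have "words G S n \<subseteq> generate G S" for n
    by (induction n) (auto intro: generate.intros)
  then show "(\<Union>n. words G S n) \<subseteq> generate G S" by blast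
qed

lemma words_sequence:
  "\<tau> \<in> words G S n \<longleftrightarrow> (\<exists>h g. h 0 = \<one>\<^bsub>G\<^esub> \<and> (\<forall>k<n. g k \<in> S \<and> h (Suc k) = g k \<otimes>\<^bsub>G\<^esub> h k) \<and> h n = \<tau>)"
proof (induction n arbitrary: \<tau>)
  case 0
  show ?case by (auto intro!: exI[of _ "\<lambda>_. \<tau>"])
next
  case (Suc n)
  show ?case (is "?l = ?r")
  proof
    assume ?l
    then obtain a \<rho> where *: "a \<in> S" "\<rho> \<in> words G S n" "\<tau> = a \<otimes>\<^bsub>G\<^esub> \<rho>" by auto
    then obtain h g where "h 0 = \<one>\<^bsub>G\<^esub>" "\<forall>k<n. g k \<in> S \<and> h (Suc k) = g k \<otimes>\<^bsub>G\<^esub> h k" "h n = \<rho>"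
      using Suc.IH by blast
    then show ?r using *
      by (intro exI[of _ "h(Suc n := \<tau>)"] exI[of _ "g(n := a)"]) (auto simp: less_Suc_eq)
  next
    assume ?r
    then obtain h g where *: "h 0 = \<one>\<^bsub>G\<^esub>" "\<forall>k<Suc n. g k \<in> S \<and> h (Suc k) = g k \<otimes>\<^bsub>G\<^esub> h k" "h (Suc n) = \<tau>"
      by blast
    then have "h n \<in> words G S n" using Suc.IH less_Suc_eq by metis
    moreover have "\<tau> = g n \<otimes>\<^bsub>G\<^esub> h n" "g n \<in> S" using * by auto
    ultimately show ?l by auto
  qed
qed

text \<open>The automorphisms that fix a small elementary submodel pointwise.\<close>

definition fixers ::
  "'v itself \<Rightarrow> ('f, 'p, 's) lang \<Rightarrow> ('f, 'p, 's, 'm) struct \<Rightarrow> ('m \<Rightarrow> 'm) set" where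
  "fixers V L M = {\<sigma> \<in> auts L M. \<exists>C. elem_subset V L M C \<and> small M C \<and> (\<forall>a\<in>C. \<sigma> a = a)}"

lemma fixers_auts: "fixers V L M \<subseteq> auts L M"
  by (auto simp: fixers_def)

lemma fixers_inv:
  assumes M: "is_structure L M" and \<sigma>: "\<sigma> \<in> fixers V L M"
  shows "inv\<^bsub>Aut L M\<^esub> \<sigma> \<in> fixers V L M"
proof -
  obtain C where C: "elem_subset V L M C" "small M C" "\<forall>a\<in>C. \<sigma> a = a" and \<sigma>': "\<sigma> \<in> auts L M"
    using \<sigma> by (auto simp: fixers_def)
  have "(inv\<^bsub>Aut L M\<^esub> \<sigma>) a = a" if "a \<in> C" for a
    using Aut_inv(2)[OF M \<sigma>', of a] C that by (auto simp: elem_subset_def)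
  then show ?thesis using C Aut_inv(1)[OF M \<sigma>'] by (auto simp: fixers_def)
qed

lemma Autf_eq_words:
  fixes L :: "('f, 'p, 's) lang"
  assumes inf: "infinite (UNIV :: 'v set)" and M: "is_structure L M"
  shows "Autf TYPE('v) L M = (\<Union>n. words (Aut L M) (fixers TYPE('v) L M) n)"
proof -
  have "{\<sigma> \<in> auts L M. \<exists>K. elem_submodel TYPE('v) L K M \<and> small M (universe K) \<and> (\<forall>a\<in>universe K. \<sigma> a = a)}
      = fixers TYPE('v) L M"
    unfolding fixers_def
    using elem_submodel_elem_subset elem_subset_elem_submodel[OF inf M] by blast
  then show ?thesis
    unfolding Autf_def
    using generate_eq_words[OF Aut_group[OF M], of "fixers TYPE('v) L M"]
    by (simp add: fixers_auts fixers_inv[OF M])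
qed

lemma Autf_subgroup:
  fixes L :: "('f, 'p, 's) lang"
  assumes M: "is_structure L M"
  shows "subgroup (Autf V L M) (Aut L M)"
  unfolding Autf_def by (rule group.generate_is_subgroup[OF Aut_group[OF M]]) auto

lemma fixers_conj:
  fixes L :: "('f, 'p, 's) lang"
  assumes M: "is_structure L M" and \<alpha>: "\<alpha> \<in> auts L M" and \<sigma>: "\<sigma> \<in> fixers TYPE('v) L M"
  shows "\<alpha> \<otimes>\<^bsub>Aut L M\<^esub> \<sigma> \<otimes>\<^bsub>Aut L M\<^esub> inv\<^bsub>Aut L M\<^esub> \<alpha> \<in> fixers TYPE('v) L M"
proof -
  interpret group "Aut L M" by (rule Aut_group[OF M])
  obtain C where C: "elem_subset TYPE('v) L M C" "small M C" "\<forall>a\<in>C. \<sigma> a = a" and \<sigma>': "\<sigma> \<in> auts L M"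
    using \<sigma> by (auto simp: fixers_def)
  note CU = C(1)[unfolded elem_subset_def, THEN conjunct1]
  let ?\<beta> = "\<alpha> \<otimes>\<^bsub>Aut L M\<^esub> \<sigma> \<otimes>\<^bsub>Aut L M\<^esub> inv\<^bsub>Aut L M\<^esub> \<alpha>"
  let ?H = "{(a, \<alpha> a) | a. a \<in> universe M}"
  have "elem_subset TYPE('v) L M (?H `` C)"
    by (rule elem_subset_image[OF M M elem_rel_aut[OF M \<alpha>] C(1)]) (use CU in auto)
  moreover have "?H `` C = \<alpha> ` C" using CU by auto
  moreover have "?\<beta> b = b" if b: "b \<in> \<alpha> ` C" for b
  proof -
    obtain a where a: "a \<in> C" "b = \<alpha> a" using b by blast
    have U: "a \<in> universe M" "b \<in> universe M" using a CU auts_universe[OF \<alpha>] by auto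
    have "\<alpha> \<otimes>\<^bsub>Aut L M\<^esub> \<sigma> \<in> auts L M" using \<alpha> \<sigma>' m_closed by simp
    then have "?\<beta> b = (\<alpha> \<otimes>\<^bsub>Aut L M\<^esub> \<sigma>) ((inv\<^bsub>Aut L M\<^esub> \<alpha>) b)"
      using Aut_apply[of _ L M] Aut_inv(1)[OF M \<alpha>] U(2) by blast
    also have "(inv\<^bsub>Aut L M\<^esub> \<alpha>) b = a" using Aut_inv(2)[OF M \<alpha>] a U by simp
    finally show ?thesis using Aut_apply[OF \<alpha> \<sigma>' U(1)] C(3) a by simp
  qed
  moreover have "?\<beta> \<in> auts L M" using \<alpha> \<sigma>' m_closed inv_closed by simp
  ultimately show ?thesis using small_image[OF C(2), of \<alpha>] by (auto simp: fixers_def)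
qed

lemma Autf_conj:
  fixes L :: "('f, 'p, 's) lang"
  assumes inf: "infinite (UNIV :: 'v set)" and M: "is_structure L M"
    and \<alpha>: "\<alpha> \<in> auts L M" and \<sigma>: "\<sigma> \<in> Autf TYPE('v) L M"
  shows "\<alpha> \<otimes>\<^bsub>Aut L M\<^esub> \<sigma> \<otimes>\<^bsub>Aut L M\<^esub> inv\<^bsub>Aut L M\<^esub> \<alpha> \<in> Autf TYPE('v) L M"
proof -
  interpret group "Aut L M" by (rule Aut_group[OF M])
  let ?c = "\<lambda>\<sigma>. \<alpha> \<otimes>\<^bsub>Aut L M\<^esub> \<sigma> \<otimes>\<^bsub>Aut L M\<^esub> inv\<^bsub>Aut L M\<^esub> \<alpha>"
  let ?W = "words (Aut L M) (fixers TYPE('v) L M)"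
  have auts: "?W n \<subseteq> auts L M" for n
    using words_carrier[OF is_group, of "fixers TYPE('v) L M"] by (simp add: fixers_auts)
  have "?c \<sigma> \<in> ?W n" if "\<sigma> \<in> ?W n" for \<sigma> n
    using that
  proof (induction n arbitrary: \<sigma>)
    case 0
    then show ?case using \<alpha> by simp
  next
    case (Suc n)
    then obtain g h where gh: "g \<in> fixers TYPE('v) L M" "h \<in> ?W n" "\<sigma> = g \<otimes>\<^bsub>Aut L M\<^esub> h" by auto
    have car: "g \<in> auts L M" "h \<in> auts L M" using gh auts fixers_auts by blast+
    have "?c g \<otimes>\<^bsub>Aut L M\<^esub> ?c h = ?c \<sigma>"
    proof -
      have "inv\<^bsub>Aut L M\<^esub> \<alpha> \<otimes>\<^bsub>Aut L M\<^esub> (\<alpha> \<otimes>\<^bsub>Aut L M\<^esub> (h \<otimes>\<^bsub>Aut L M\<^esub> inv\<^bsub>Aut L M\<^esub> \<alpha>)) = h \<otimes>\<^bsub>Aut L M\<^esub> inv\<^bsub>Aut L M\<^esub> \<alpha>"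
        using \<alpha> car(2)
        by (simp add: m_assoc[symmetric] Aut_carrier[symmetric] del: Aut_carrier)
      then show ?thesis
        using \<alpha> car gh(3) by (simp add: m_assoc Aut_carrier[symmetric] del: Aut_carrier)
    qed
    from this[symmetric] show ?case
      unfolding words.simps mem_Collect_eq using fixers_conj[OF M \<alpha> gh(1)] Suc.IH[OF gh(2)] by blast
  qed
  then show ?thesis using \<sigma> unfolding Autf_eq_words[OF inf M] by blast
qed

section \<open>Compactness of the Lascar distance\<close>

definition fm_iff :: "('f, 'p, 'x) fm \<Rightarrow> ('f, 'p, 'x) fm \<Rightarrow> ('f, 'p, 'x) fm" where
  "fm_iff \<phi> \<psi> = Conj (Neg (Conj \<phi> (Neg \<psi>))) (Neg (Conj \<psi> (Neg \<phi>)))"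

lemma fm_iff_simps [simp]:
  "wf_fm L (fm_iff \<phi> \<psi>) \<longleftrightarrow> wf_fm L \<phi> \<and> wf_fm L \<psi>"
  "fv (fm_iff \<phi> \<psi>) = fv \<phi> \<union> fv \<psi>"
  "sat M v (fm_iff \<phi> \<psi>) \<longleftrightarrow> (sat M v \<phi> \<longleftrightarrow> sat M v \<psi>)"
  by (auto simp: fm_iff_def)

text \<open>
  The Tarski-Vaught test for blocks of quantifiers.
\<close>

lemma elem_subset_exs:
  fixes \<phi> :: "('f, 'p, 'v \<times> 's) fm"
  assumes C: "elem_subset TYPE('v) L M C" and \<phi>: "wf_fm L \<phi>"
  shows "(\<And>y. y \<in> fv \<phi> - set xs \<Longrightarrow> v y \<in> C \<inter> car M (snd y)) \<Longrightarrow> sat M v (exs xs \<phi>) \<Longrightarrow>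
    \<exists>w. (\<forall>y. y \<notin> set xs \<longrightarrow> w y = v y) \<and> (\<forall>y\<in>set xs. w y \<in> C \<inter> car M (snd y)) \<and> sat M w \<phi>"
proof (induction xs arbitrary: v)
  case Nil
  then show ?case by (intro exI[of _ v]) (simp add: exs_Nil)
next
  case (Cons x xs)
  obtain a where a: "a \<in> car M (snd x)" "sat M (v(x := a)) (exs xs \<phi>)"
    using Cons.prems(2) by (auto simp: exs_Cons)
  have "\<exists>b\<in>C \<inter> car M (snd x). sat M (v(x := b)) (exs xs \<phi>)"
  proof (rule elem_subsetD[OF C _ _ a])
    show "v y \<in> C \<inter> car M (snd y)" if "y \<in> fv (exs xs \<phi>) - {x}" for y
      by (rule Cons.prems(1)) (use that in auto)
  qed (simp add: \<phi>)
  then obtain b where b: "b \<in> C \<inter> car M (snd x)" "sat M (v(x := b)) (exs xs \<phi>)" by blast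
  have "\<exists>w. (\<forall>y. y \<notin> set xs \<longrightarrow> w y = (v(x := b)) y) \<and> (\<forall>y\<in>set xs. w y \<in> C \<inter> car M (snd y)) \<and> sat M w \<phi>"
  proof (rule Cons.IH[OF _ b(2)])
    fix y assume y: "y \<in> fv \<phi> - set xs"
    show "(v(x := b)) y \<in> C \<inter> car M (snd y)"
    proof (cases "y = x")
      case False
      then show ?thesis using Cons.prems(1)[of y] y by simp
    qed (use b(1) in simp)
  qed
  then obtain w where w: "\<And>y. y \<notin> set xs \<Longrightarrow> w y = (v(x := b)) y"
      "\<forall>y\<in>set xs. w y \<in> C \<inter> car M (snd y)" "sat M w \<phi>" by blast
  have "w x \<in> C \<inter> car M (snd x)" using w(1)[of x] w(2) b(1) by (cases "x \<in> set xs") auto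
  then show ?case using w by (intro exI[of _ w]) auto
qed

text \<open>
  The automorphisms fixing pointwise some conjugate of the set \<open>C\<close> under the automorphism group. If
  \<open>C\<close> is a small elementary submodel, they are among the generators of the group of Lascar
  strong automorphisms, and what they fix has a prescribed type.
\<close>

definition conj_fixers :: "('f, 'p, 's) lang \<Rightarrow> ('f, 'p, 's, 'm) struct \<Rightarrow> 'm set \<Rightarrow> ('m \<Rightarrow> 'm) set" where
  "conj_fixers L M C = {\<sigma> \<in> auts L M. \<exists>\<rho>\<in>auts L M. \<forall>c\<in>C. \<sigma> (\<rho> c) = \<rho> c}"

text \<open>
  If \<open>f\<close> agrees on every finite subset of \<open>A\<close> with a product of \<open>n\<close> automorphisms fixing small
  elementary submodels, then it agrees on all of \<open>A\<close> with such a product; moreover the factors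
  may be taken to fix conjugates of \<open>C\<close>. The type to be realized describes \<open>n + 1\<close> copies of \<open>A\<close>,
  the first being \<open>A\<close> and the last its image under \<open>f\<close>, and copies of \<open>C\<close> over which consecutive
  copies of \<open>A\<close> have the same type.
\<close>

lemma realize_words:
  fixes T :: "('f, 'p, 'v \<times> 's) fm set" and M :: "('f, 'p, 's, 'm) struct"
  assumes inf: "infinite (UNIV :: 'v set)" and M: "monster L T M"
    and A: "A \<subseteq> universe M" "small M A" and C: "C \<subseteq> universe M" "small M C"
    and fin: "\<And>F. finite F \<Longrightarrow> F \<subseteq> A \<Longrightarrow>
      \<exists>\<tau>\<in>words (Aut L M) (fixers TYPE('v) L M) n. \<forall>a\<in>F. \<tau> a = f a"
  shows "\<exists>\<tau>\<in>words (Aut L M) (conj_fixers L M C) n. \<forall>a\<in>A. \<tau> a = f a"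
proof (cases "n = 0")
  case True
  have "f a = a" if "a \<in> A" for a
    using fin[of "{a}"] that True A(1) Aut_one_apply[of a M L] by auto
  then show ?thesis using True A(1) Aut_one_apply[of _ M L] by auto
next
  case n: False
  note str = monsterD(1)[OF M] and infM = monsterD(2)[OF M]
  note [simp] = InlI InrI
  interpret group "Aut L M" by (rule Aut_group[OF str])
  let ?W = "words (Aut L M) (fixers TYPE('v) L M)"
  have W_auts: "?W k \<subseteq> auts L M" for k
    using words_carrier[OF is_group, of "fixers TYPE('v) L M"] by (simp add: fixers_auts)
  define st where "st a = (SOME s. a \<in> car M s)" for a
  have st: "a \<in> car M (st a)" if "a \<in> universe M" for a
    using that unfolding st_def universe_def by (auto intro: someI)
  define el where "el u = (case u of Inl a \<Rightarrow> a | Inr c \<Rightarrow> c)" for u :: "'m + 'm"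
  define nm where "nm u k = ((u, k :: nat), st (el u))" for u k
  define nm2 where "nm2 u = (u, st (el u))" for u
  define J where "J = (\<lambda>(u, k). nm u k) ` ((A <+> C) \<times> {..n})"
  define I where "I = (\<lambda>(a, k). nm (Inl a) k) ` (A \<times> {0, n})"
  define J1 where "J1 k = (\<lambda>c. nm (Inr c) k) ` C" for k
  define J2 where "J2 = nm2 ` (A <+> C)"
  define \<alpha> where "\<alpha> k y = ((fst y, k), snd y)" for k :: nat and y :: "('m + 'm) \<times> 's"
  define \<beta> where "\<beta> k y = ((fst y, case fst y of Inl a \<Rightarrow> Suc k | Inr c \<Rightarrow> k), snd y)"
    for k :: nat and y :: "('m + 'm) \<times> 's"
  have \<alpha>nm: "\<alpha> k (nm2 u) = nm u k" for k u by (simp add: \<alpha>_def nm2_def nm_def)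
  have \<beta>nm: "\<beta> k (nm2 (Inl a)) = nm (Inl a) (Suc k)" "\<beta> k (nm2 (Inr a)) = nm (Inr a) k" for k a
    by (simp_all add: \<beta>_def nm2_def nm_def)
  have \<alpha>s: "snd (\<alpha> k y) = snd y" and \<beta>s: "snd (\<beta> k y) = snd y" for k y
    by (simp_all add: \<alpha>_def \<beta>_def)
  have nmJ: "nm u k \<in> J" if "u \<in> A <+> C" "k \<le> n" for u k
    using that unfolding J_def by (intro image_eqI[of _ _ "(u, k)"]) auto
  have J1J: "J1 k \<subseteq> J" if "k < n" for k using that nmJ by (auto simp: J1_def)
  have \<alpha>J: "\<alpha> k y \<in> J" "\<beta> k y \<in> J" if "y \<in> J2" "k < n" for k y
    using that nmJ by (auto simp: J2_def \<alpha>nm \<beta>nm)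
  have fU: "f a \<in> car M (st a)" if a: "a \<in> A" for a
  proof -
    obtain \<tau> where "\<tau> \<in> ?W n" "\<tau> a = f a" using fin[of "{a}"] a by auto
    then show ?thesis using W_auts auts_car[of \<tau> L M a "st a"] st[of a] a A(1) by auto
  qed
  define z where "z x = (if x \<in> J then el (fst (fst x)) else some_elem M (snd x))"
    for x :: "(('m + 'm) \<times> nat) \<times> 's"
  have zJ: "z (nm u k) = el u" if "u \<in> A <+> C" "k \<le> n" for u k
    using nmJ[OF that] by (simp add: z_def nm_def)
  have elU: "el u \<in> universe M" if "u \<in> A <+> C" for u using that A(1) C(1) by (auto simp: el_def)
  have z: "z x \<in> car M (snd x)" for x
  proof (cases "x \<in> J")
    case True
    then obtain u k where "x = nm u k" "u \<in> A <+> C" by (auto simp: J_def)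
    then show ?thesis using True st[OF elU] by (simp add: z_def nm_def)
  qed (simp add: z_def some_elem_in[OF str])
  define v where "v x = (case fst x of (Inl a, k) \<Rightarrow> if k = 0 then a else f a | (Inr c, k) \<Rightarrow> c)"
    for x :: "(('m + 'm) \<times> nat) \<times> 's"
  have v: "v (nm (Inl a) k) = (if k = 0 then a else f a)" for a k by (simp add: v_def nm_def)
  have nms: "snd (nm u k) = st (el u)" for u k by (simp add: nm_def)
  have el: "el (Inl a) = a" "el (Inr a) = a" for a by (simp_all add: el_def)
  \<comment> \<open>The \<open>k\<close>-th copy of \<open>C\<close> has the type of \<open>C\<close>, and the copies \<open>k\<close> and \<open>k + 1\<close> of \<open>A\<close> have
    the same type over it.\<close>
  define \<Gamma>1 where "\<Gamma>1 k = {\<chi> :: ('f, 'p, (('m + 'm) \<times> nat) \<times> 's) fm.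
      wf_fm L \<chi> \<and> fv \<chi> \<subseteq> J1 k \<and> sat M z \<chi>}" for k
  define \<Gamma>2 where "\<Gamma>2 k = {fm_iff (sub \<phi> (\<alpha> k)) (sub \<phi> (\<beta> k)) | \<phi> :: ('f, 'p, ('m + 'm) \<times> 's) fm.
      wf_fm L \<phi> \<and> fv \<phi> \<subseteq> J2}" for k
  define \<Gamma> where "\<Gamma> = (\<Union>k<n. \<Gamma>1 k \<union> \<Gamma>2 k)"
  have inf1: "infinite (UNIV :: 'm set)" using infinite_super[OF subset_UNIV infM] .
  then have inf2: "infinite (UNIV :: ('m + 'm) set)" by (simp add: finite_Plus_UNIV_iff)
  then have inf3: "infinite (UNIV :: (('m + 'm) \<times> nat) set)" by (simp add: finite_prod)
  have "\<exists>w. srt M w J \<and> (\<forall>i\<in>I. w i = v i) \<and> (\<forall>\<phi>\<in>\<Gamma>. sat M w \<phi>)"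
  proof (rule realize_type[OF inf M])
    show "small M J"
      unfolding J_def
      by (intro small_image small_Times small_Plus infM A C small_finite finite_atMost)
    show "I \<subseteq> J" using nmJ by (auto simp: I_def)
    show "srt M v I" using st fU A(1) by (auto simp: I_def srt_def v nms el)
    show "wf_fm L \<phi> \<and> fv \<phi> \<subseteq> J" if "\<phi> \<in> \<Gamma>" for \<phi>
    proof -
      obtain k where k: "k < n" "\<phi> \<in> \<Gamma>1 k \<or> \<phi> \<in> \<Gamma>2 k" using \<open>\<phi> \<in> \<Gamma>\<close> by (auto simp: \<Gamma>_def)
      show ?thesis
      proof (cases "\<phi> \<in> \<Gamma>1 k")
        case True
        then show ?thesis using J1J[OF k(1)] by (auto simp: \<Gamma>1_def)
      next
        case False
        then obtain \<psi> where \<psi>: "wf_fm L \<psi>" "fv \<psi> \<subseteq> J2" "\<phi> = fm_iff (sub \<psi> (\<alpha> k)) (sub \<psi> (\<beta> k))"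
          using k(2) by (auto simp: \<Gamma>2_def)
        have "wf_fm L (sub \<psi> (\<alpha> k))" "wf_fm L (sub \<psi> (\<beta> k))"
          by (rule wf_sub[OF inf3 \<psi>(1)], rule \<alpha>s \<beta>s)+
        moreover have "\<alpha> k ` fv \<psi> \<subseteq> J" "\<beta> k ` fv \<psi> \<subseteq> J"
          using \<psi>(2) \<alpha>J[OF _ k(1)] by blast+
        ultimately show ?thesis by (simp add: \<psi>(3) fv_sub[OF inf3])
      qed
    qed
    fix \<Gamma>0 assume \<Gamma>0: "finite \<Gamma>0" "\<Gamma>0 \<subseteq> \<Gamma>"
    define V where "V = \<Union>(fv ` \<Gamma>0)"
    have "finite V" using \<Gamma>0 by (auto simp: V_def)
    \<comment> \<open>Finitely many formulas only mention a finite part \<open>F\<close> of \<open>A\<close>, where a product of \<open>n\<close> automorphisms is given.\<close>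
    define F where "F = {a \<in> A. \<exists>k. nm (Inl a) k \<in> V}"
    have "F \<subseteq> (\<lambda>x. el (fst (fst x))) ` V"
      by (auto simp: F_def nm_def el image_iff) (metis el(1) fst_conv)
    then have "finite F" using \<open>finite V\<close> finite_subset by blast
    then obtain \<tau> where \<tau>: "\<tau> \<in> ?W n" "\<forall>a\<in>F. \<tau> a = f a"
      using fin[of F] by (auto simp: F_def)
    then obtain h g where h0: "h 0 = \<one>\<^bsub>Aut L M\<^esub>" and hn: "h n = \<tau>"
      and g: "\<And>k. k < n \<Longrightarrow> g k \<in> fixers TYPE('v) L M"
      and hS: "\<And>k. k < n \<Longrightarrow> h (Suc k) = g k \<otimes>\<^bsub>Aut L M\<^esub> h k"
      unfolding words_sequence by blast
    have ga: "g k \<in> auts L M" if "k < n" for k using g[OF that] fixers_auts by blast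
    have ha: "h k \<in> auts L M" if "k \<le> n" for k
      using that
    proof (induction k)
      case 0
      then show ?case using one_closed h0 by simp
    next
      case (Suc k)
      then show ?case using m_closed[of "g k" "h k"] ga hS by simp
    qed
    have "\<forall>k. \<exists>D. k < n \<longrightarrow> elem_subset TYPE('v) L M D \<and> (\<forall>d\<in>D. g k d = d)"
      using g unfolding fixers_def by blast
    then obtain D where D: "\<And>k. k < n \<Longrightarrow> elem_subset TYPE('v) L M (D k)"
      and gD: "\<And>k d. k < n \<Longrightarrow> d \<in> D k \<Longrightarrow> g k d = d"
      by metis
    \<comment> \<open>The finite part of the type of \<open>C\<close> is realized inside the submodel \<open>D k\<close> fixed by \<open>g k\<close>.\<close>
    have "\<exists>u. (\<forall>x\<in>V \<inter> J1 k. u x \<in> D k \<inter> car M (snd x)) \<and> (\<forall>\<chi>\<in>\<Gamma>0 \<inter> \<Gamma>1 k. sat M u \<chi>)"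
      if k: "k < n" for k
    proof -
      obtain \<psi>s where \<psi>s: "set \<psi>s = \<Gamma>0 \<inter> \<Gamma>1 k" using \<Gamma>0(1) finite_list[of "\<Gamma>0 \<inter> \<Gamma>1 k"] by auto
      \<comment> \<open>An arbitrary variable, needed to form the conjunction.\<close>
      define y :: "(('m + 'm) \<times> nat) \<times> 's" where "y = undefined"
      obtain xs where xs: "set xs = insert y (V \<inter> J1 k)"
        using finite_list[of "insert y (V \<inter> J1 k)"] \<open>finite V\<close> by auto
      let ?\<phi> = "conjs y \<psi>s"
      have "fv ?\<phi> \<subseteq> set xs" using xs \<psi>s by (auto simp: \<Gamma>1_def V_def)
      then have "\<exists>u. (\<forall>x. x \<notin> set xs \<longrightarrow> u x = z x) \<and> (\<forall>x\<in>set xs. u x \<in> D k \<inter> car M (snd x)) \<and> sat M u ?\<phi>"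
      proof (intro elem_subset_exs[OF elem_subset_names[OF inf D[OF k]]])
        show "wf_fm L ?\<phi>" using \<psi>s by (auto simp: \<Gamma>1_def)
        show "sat M z (exs xs ?\<phi>)"
          unfolding sat_exs using z \<psi>s by (intro exI[of _ z]) (auto simp: \<Gamma>1_def)
      qed auto
      then show ?thesis using xs \<psi>s by auto
    qed
    then obtain u where u: "\<And>k x. k < n \<Longrightarrow> x \<in> V \<inter> J1 k \<Longrightarrow> u k x \<in> D k \<inter> car M (snd x)"
      "\<And>k \<chi>. k < n \<Longrightarrow> \<chi> \<in> \<Gamma>0 \<inter> \<Gamma>1 k \<Longrightarrow> sat M (u k) \<chi>"
      by metis
    define w where "w x = (case fst x of (Inl a, k) \<Rightarrow> if a \<in> F then h k a else v x
        | (Inr c, k) \<Rightarrow> if k < n \<and> x \<in> V \<inter> J1 k then u k x else z x)" for x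
    have wl: "w (nm (Inl a) k) = (if a \<in> F then h k a else if k = 0 then a else f a)" for a k
      by (simp add: w_def v nm_def) (simp add: v_def)
    have wr: "w x = u k x" if "x \<in> V \<inter> J1 k" "k < n" for x k
      using that by (auto simp: w_def J1_def nm_def)
    have wrJ: "w (nm (Inr c) k) \<in> car M (st c)" for c k
      using u(1)[of k "nm (Inr c) k"] z[of "nm (Inr c) k"]
      by (auto simp: w_def nm_def el split: if_splits)
    have FU: "a \<in> universe M" "a \<in> A" if "a \<in> F" for a using that A(1) by (auto simp: F_def)
    have "srt M w J"
      unfolding srt_def
    proof
      fix x assume "x \<in> J"
      then obtain u k where x: "x = nm u k" "u \<in> A <+> C" "k \<le> n" by (auto simp: J_def)
      show "w x \<in> car M (snd x)"
      proof (cases u)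
        case (Inl a)
        then have "a \<in> A" using x by auto
        then show ?thesis
          using Inl x auts_car[OF ha st] st fU A(1) by (auto simp: wl nms el)
      next
        case (Inr c)
        then show ?thesis using x wrJ by (simp add: nms el)
      qed
    qed
    moreover have "\<forall>i\<in>I. w i = v i"
      using n h0 hn \<tau>(2) FU Aut_one_apply[of _ M L] by (auto simp: I_def wl v)
    moreover have "sat M w \<chi>" if \<chi>: "\<chi> \<in> \<Gamma>0" for \<chi>
    proof -
      obtain k where k: "k < n" "\<chi> \<in> \<Gamma>1 k \<or> \<chi> \<in> \<Gamma>2 k" using \<chi> \<Gamma>0(2) by (auto simp: \<Gamma>_def)
      show ?thesis
      proof (cases "\<chi> \<in> \<Gamma>1 k")
        case True
        have "sat M w \<chi> = sat M (u k) \<chi>"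
        proof (rule sat_cong)
          fix x assume "x \<in> fv \<chi>"
          then have "x \<in> V \<inter> J1 k" using True \<chi> by (auto simp: V_def \<Gamma>1_def)
          then show "w x = u k x" using wr k(1) by blast
        qed
        then show ?thesis using u(2)[OF k(1)] \<chi> True by blast
      next
        case False
        then obtain \<phi> where \<phi>: "wf_fm L \<phi>" "fv \<phi> \<subseteq> J2" "\<chi> = fm_iff (sub \<phi> (\<alpha> k)) (sub \<phi> (\<beta> k))"
          using k(2) by (auto simp: \<Gamma>2_def)
        have \<alpha>V: "\<alpha> k y \<in> V" if "y \<in> fv \<phi>" for y
          using that \<phi>(3) \<chi> by (auto simp: V_def fv_sub[OF inf3] intro!: bexI[of _ \<chi>])
        have "sat M (w \<circ> \<beta> k) \<phi> = sat M (w \<circ> \<alpha> k) \<phi>"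
        proof (rule aut_sat[OF str ga[OF k(1)]])
          show "srt M (w \<circ> \<alpha> k) (fv \<phi>)"
            unfolding srt_def
          proof
            fix y assume "y \<in> fv \<phi>"
            then have "\<alpha> k y \<in> J" using \<phi>(2) \<alpha>J(1)[of y k] k(1) by blast
            then show "(w \<circ> \<alpha> k) y \<in> car M (snd y)"
              using \<open>srt M w J\<close> \<alpha>s[of k y] unfolding srt_def by (metis comp_apply)
          qed
          show "wf_fm L \<phi>" by fact
          fix y assume y: "y \<in> fv \<phi>"
          then obtain u' where u': "u' \<in> A <+> C" "y = nm2 u'" using \<phi>(2) by (auto simp: J2_def)
          show "(w \<circ> \<beta> k) y = g k ((w \<circ> \<alpha> k) y)"
          proof (cases u')
            case (Inl a)
            then have "a \<in> F" using \<alpha>V[OF y] u' by (auto simp: F_def \<alpha>nm)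
            then show ?thesis
              using Inl u' FU(1) k(1) hS[OF k(1)] Aut_apply[OF ga ha] by (simp add: \<alpha>nm \<beta>nm wl)
          next
            case (Inr c)
            then have *: "nm (Inr c) k \<in> V \<inter> J1 k" using \<alpha>V[OF y] u' by (auto simp: \<alpha>nm J1_def)
            then show ?thesis
              using Inr u' wr[OF * k(1)] u(1)[OF k(1) *] gD[OF k(1)] by (simp add: \<alpha>nm \<beta>nm)
          qed
        qed
        then show ?thesis by (simp add: \<phi>(3) sat_sub[OF inf3])
      qed
    qed
    ultimately show "\<exists>w. srt M w J \<and> (\<forall>i\<in>I. w i = v i) \<and> (\<forall>\<phi>\<in>\<Gamma>0. sat M w \<phi>)" by blast
  qed
  then obtain w where w: "srt M w J" "\<forall>i\<in>I. w i = v i" "\<forall>\<phi>\<in>\<Gamma>. sat M w \<phi>" by blast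
  have "\<exists>\<sigma>\<in>conj_fixers L M C. \<forall>a\<in>A. \<sigma> (w (nm (Inl a) k)) = w (nm (Inl a) (Suc k))"
    if k: "k < n" for k
  proof -
    have srt\<alpha>: "srt M (w \<circ> \<alpha> k) J2" "srt M (w \<circ> \<beta> k) J2"
      using w(1) \<alpha>J[OF _ k] \<alpha>s \<beta>s unfolding srt_def by (metis comp_apply)+
    let ?G = "{((w \<circ> \<alpha> k) y, (w \<circ> \<beta> k) y) | y. y \<in> J2}"
    have "elem_rel TYPE('v) L M M ?G"
    proof (rule elem_rel_of_assignments[OF inf2 str srt\<alpha>])
      fix \<phi> :: "('f, 'p, ('m + 'm) \<times> 's) fm"
      assume "wf_fm L \<phi>" "fv \<phi> \<subseteq> J2" and sat: "sat M (w \<circ> \<alpha> k) \<phi>"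
      then have "fm_iff (sub \<phi> (\<alpha> k)) (sub \<phi> (\<beta> k)) \<in> \<Gamma>" using k by (auto simp: \<Gamma>_def \<Gamma>2_def)
      then have "sat M w (fm_iff (sub \<phi> (\<alpha> k)) (sub \<phi> (\<beta> k)))" using w(3) by blast
      then show "sat M (w \<circ> \<beta> k) \<phi>" using sat by (simp add: sat_sub[OF inf3])
    qed
    moreover have "small M ?G"
    proof (rule small_image_mono)
      show "small M (A <+> C)" by (intro small_Plus infM A C)
      show "?G \<subseteq> (\<lambda>u. ((w \<circ> \<alpha> k) (nm2 u), (w \<circ> \<beta> k) (nm2 u))) ` (A <+> C)"
        unfolding J2_def by blast
    qed
    ultimately obtain \<sigma> where \<sigma>: "\<sigma> \<in> auts L M" "\<forall>a b. (a, b) \<in> ?G \<longrightarrow> \<sigma> a = b"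
      using homogeneous[OF inf M] by blast
    let ?H = "{(z x, w x) | x. x \<in> J1 k}"
    have "elem_rel TYPE('v) L M M ?H"
    proof (rule elem_rel_of_assignments[OF inf3 str])
      show "srt M z (J1 k)" using z by (simp add: srt_def)
      show "srt M w (J1 k)" using w(1) J1J[OF k] by (auto simp: srt_def)
      fix \<phi> :: "('f, 'p, (('m + 'm) \<times> nat) \<times> 's) fm"
      assume "wf_fm L \<phi>" "fv \<phi> \<subseteq> J1 k" "sat M z \<phi>"
      then have "\<phi> \<in> \<Gamma>" using k by (auto simp: \<Gamma>_def \<Gamma>1_def)
      then show "sat M w \<phi>" using w(3) by blast
    qed
    moreover have "small M ?H"
    proof (rule small_image_mono[OF C(2)])
      show "?H \<subseteq> (\<lambda>c. (z (nm (Inr c) k), w (nm (Inr c) k))) ` C" unfolding J1_def by blast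
    qed
    ultimately obtain \<rho> where \<rho>: "\<rho> \<in> auts L M" "\<forall>a b. (a, b) \<in> ?H \<longrightarrow> \<rho> a = b"
      using homogeneous[OF inf M] by blast
    have \<rho>c: "\<rho> c = w (nm (Inr c) k)" if c: "c \<in> C" for c
    proof -
      have "nm (Inr c) k \<in> J1 k" using c by (simp add: J1_def)
      then have "(z (nm (Inr c) k), w (nm (Inr c) k)) \<in> ?H" by blast
      then have "\<rho> (z (nm (Inr c) k)) = w (nm (Inr c) k)" by (rule \<rho>(2)[rule_format])
      moreover have "z (nm (Inr c) k) = c" using zJ[of "Inr c" k] c k by (simp add: el)
      ultimately show ?thesis by simp
    qed
    have \<sigma>nm: "\<sigma> (w (\<alpha> k (nm2 u))) = w (\<beta> k (nm2 u))" if "u \<in> A <+> C" for u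
    proof -
      have "nm2 u \<in> J2" using that by (auto simp: J2_def)
      then have "((w \<circ> \<alpha> k) (nm2 u), (w \<circ> \<beta> k) (nm2 u)) \<in> ?G" by blast
      then have "\<sigma> ((w \<circ> \<alpha> k) (nm2 u)) = (w \<circ> \<beta> k) (nm2 u)" by (rule \<sigma>(2)[rule_format])
      then show ?thesis by simp
    qed
    have "\<sigma> (\<rho> c) = \<rho> c" if "c \<in> C" for c
      using \<sigma>nm[of "Inr c"] that by (simp add: \<alpha>nm \<beta>nm \<rho>c InrI)
    then have "\<sigma> \<in> conj_fixers L M C" using \<sigma>(1) \<rho>(1) by (auto simp: conj_fixers_def)
    moreover have "\<forall>a\<in>A. \<sigma> (w (nm (Inl a) k)) = w (nm (Inl a) (Suc k))"
    proof
      show "\<sigma> (w (nm (Inl a) k)) = w (nm (Inl a) (Suc k))" if "a \<in> A" for a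
        using \<sigma>nm[OF InlI[OF that]] by (simp add: \<alpha>nm \<beta>nm)
    qed
    ultimately show ?thesis by blast
  qed
  then obtain g where g: "\<And>k. k < n \<Longrightarrow> g k \<in> conj_fixers L M C"
    "\<And>k a. k < n \<Longrightarrow> a \<in> A \<Longrightarrow> g k (w (nm (Inl a) k)) = w (nm (Inl a) (Suc k))"
    by metis
  define h where "h = rec_nat \<one>\<^bsub>Aut L M\<^esub> (\<lambda>k h. g k \<otimes>\<^bsub>Aut L M\<^esub> h)"
  have h: "h 0 = \<one>\<^bsub>Aut L M\<^esub>" "h (Suc k) = g k \<otimes>\<^bsub>Aut L M\<^esub> h k" for k by (simp_all add: h_def)
  have "h n \<in> words (Aut L M) (conj_fixers L M C) n"
    unfolding words_sequence using g(1) h by blast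
  moreover have "h k \<in> auts L M \<and> (\<forall>a\<in>A. h k a = w (nm (Inl a) k))" if "k \<le> n" for k
    using that
  proof (induction k)
    case 0
    have "w (nm (Inl a) 0) = a" if "a \<in> A" for a
      using w(2) that v by (auto simp: I_def)
    then show ?case using h(1) A(1) one_closed Aut_one_apply[of _ M L] by auto
  next
    case (Suc k)
    then have k: "k < n" and IH: "h k \<in> auts L M" "\<forall>a\<in>A. h k a = w (nm (Inl a) k)" by auto
    have "g k \<in> auts L M" using g(1)[OF k] by (simp add: conj_fixers_def)
    then show ?case
      using IH h(2) g(2)[OF k] m_closed[of "g k" "h k"] A(1) by (auto simp: Aut_apply)
  qed
  moreover have "w (nm (Inl a) n) = f a" if "a \<in> A" for a
    using w(2) that v[of a n] n by (auto simp: I_def)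
  ultimately show ?thesis by (intro bexI[of _ "h n"]) auto
qed

section \<open>Transfer of Lascar strong automorphisms\<close>

lemma small_relcomp:
  assumes "infinite (universe M)" "small M G" "small M H"
  shows "small M (G O H)"
  by (rule small_image_mono[OF small_Times[OF assms], of _ "\<lambda>(p, q). (fst p, snd q)"]) force

lemma small_converse: "small M G \<Longrightarrow> small M (G\<inverse>)"
  by (rule small_image_mono[of _ G _ "\<lambda>(a, b). (b, a)"]) (auto simp: image_iff)

lemma small_elem_rel:
  assumes inf: "infinite (UNIV :: 'v set)" and G: "elem_rel TYPE('v) L M M' G"
    and M: "is_structure L M" "is_structure L M'" and A: "small N A" "Domain G \<subseteq> A"
  shows "small N G"
proof (rule small_image_mono[OF A(1)])
  show "G \<subseteq> (\<lambda>a. (a, SOME b. (a, b) \<in> G)) ` A"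
  proof
    fix g assume g: "g \<in> G"
    obtain a b where ab: "g = (a, b)" by fastforce
    have "(SOME b. (a, b) \<in> G) = b"
      by (rule some_equality) (use g ab elem_rel_inj[OF inf G M] in blast)+
    then show "g \<in> (\<lambda>a. (a, SOME b. (a, b) \<in> G)) ` A" using g ab A(2) by force
  qed
qed

text \<open>
  If \<open>\<sigma>\<close> fixes a small elementary submodel of \<open>M\<close>, then its trace on a small set is carried by an
  elementary relation to the trace of an automorphism fixing a small elementary submodel of
  \<open>M'\<close>: by compactness, the fixed submodel may be taken of cardinality at most that of the
  language, so that it is also small in \<open>M'\<close>.
\<close>

lemma transfer_fixer:
  fixes T T' :: "('f, 'p, 'v \<times> 's) fm set" and M :: "('f, 'p, 's, 'm) struct" and M' :: "('f, 'p, 's, 'n) struct"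
  assumes inf: "infinite (UNIV :: 'v set)" and M: "monster L T M" and M': "monster L T' M'"
    and \<sigma>: "\<sigma> \<in> fixers TYPE('v) L M" and G: "elem_rel TYPE('v) L M M' G"
    and A: "A \<subseteq> universe M" "small M A" "small M' A"
  shows "\<exists>\<sigma>'\<in>fixers TYPE('v) L M'. \<forall>a\<in>A. \<forall>b c. (a, b) \<in> G \<longrightarrow> (\<sigma> a, c) \<in> G \<longrightarrow> \<sigma>' b = c"
proof -
  note str = monsterD(1)[OF M] and infM = monsterD(2)[OF M]
    and str' = monsterD(1)[OF M'] and infM' = monsterD(2)[OF M']
  have \<sigma>a: "\<sigma> \<in> auts L M" using \<sigma> fixers_auts by blast
  obtain C where C: "elem_subset TYPE('v) L M C" "|C| \<le>o |symbols L|"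
    using ex_elem_subset[OF str] by blast
  have CU: "C \<subseteq> universe M" using C(1) by (simp add: elem_subset_def)
  have smallC: "small M C" "small M' C"
    using small_card[OF C(2)] small_symbols[OF M] small_symbols[OF M'] by blast+
  interpret group "Aut L M" by (rule Aut_group[OF str])
  have "\<sigma> \<otimes>\<^bsub>Aut L M\<^esub> \<one>\<^bsub>Aut L M\<^esub> = \<sigma>" using \<sigma>a by simp
  then have "\<sigma> \<in> words (Aut L M) (fixers TYPE('v) L M) (Suc 0)" using \<sigma> by force
  then have "\<exists>\<tau>\<in>words (Aut L M) (conj_fixers L M C) (Suc 0). \<forall>a\<in>A. \<tau> a = \<sigma> a"
    by (intro realize_words[OF inf M A(1,2) CU smallC(1)]) blast
  then obtain g where g: "g \<in> conj_fixers L M C" "\<forall>a\<in>A. (g \<otimes>\<^bsub>Aut L M\<^esub> \<one>\<^bsub>Aut L M\<^esub>) a = \<sigma> a"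
    by auto
  then obtain \<rho> where ga: "g \<in> auts L M" and \<rho>: "\<rho> \<in> auts L M" "\<forall>c\<in>C. g (\<rho> c) = \<rho> c"
    by (auto simp: conj_fixers_def)
  have "g \<otimes>\<^bsub>Aut L M\<^esub> \<one>\<^bsub>Aut L M\<^esub> = g" using ga by simp
  with g(2) have gA: "\<forall>a\<in>A. g a = \<sigma> a" by simp
  define D where "D = \<rho> ` C"
  have DU: "D \<subseteq> universe M" using CU auts_universe[OF \<rho>(1)] by (auto simp: D_def)
  have smallD: "small M D" "small M' D" using smallC by (auto simp: D_def intro: small_image)
  have elemD: "elem_subset TYPE('v) L M D"
  proof -
    have "elem_subset TYPE('v) L M ({(a, \<rho> a) | a. a \<in> universe M} `` C)"
      by (rule elem_subset_image[OF str str elem_rel_aut[OF str \<rho>(1)] C(1)]) (use CU in auto)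
    moreover have "{(a, \<rho> a) | a. a \<in> universe M} `` C = D" using CU by (auto simp: D_def)
    ultimately show ?thesis by simp
  qed
  define G0 where "G0 = G \<inter> (A \<union> \<sigma> ` A) \<times> UNIV"
  have G0: "elem_rel TYPE('v) L M M' G0" by (rule elem_rel_mono[OF G]) (simp add: G0_def)
  have AA: "small M' (A \<union> \<sigma> ` A)" by (intro small_Un infM' A small_image)
  have smallG0: "small M' G0"
    by (rule small_elem_rel[OF inf G0 str str' AA]) (auto simp: G0_def)
  from elem_rel_extend[OF inf str infM M' G0 smallG0 DU smallD(2)]
  obtain H i where H: "elem_rel TYPE('v) L M M' H" "G0 \<subseteq> H" "D \<subseteq> Domain H" "H \<subseteq> i ` (G0 <+> D)"
    by blast
  have smallH: "small M' H"
    by (rule small_image_mono[OF small_Plus[OF infM' smallG0 smallD(2)] H(4)])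
  define S where "S = {(a, g a) | a. a \<in> A \<union> D}"
  have S: "elem_rel TYPE('v) L M M S"
    by (rule elem_rel_mono[OF elem_rel_aut[OF str ga]]) (use A(1) DU in \<open>auto simp: S_def\<close>)
  have smallS: "small M' S"
    by (rule small_image_mono[OF small_Un[OF infM' A(3) smallD(2)], of _ "\<lambda>a. (a, g a)"])
      (auto simp: S_def)
  have "elem_rel TYPE('v) L M' M' (H\<inverse> O S O H)"
    by (intro elem_rel_comp[OF elem_rel_converse[OF H(1)]] elem_rel_comp[OF S H(1)] str str')
  moreover have "small M' (H\<inverse> O S O H)"
    by (intro small_relcomp infM' small_converse smallH smallS)
  ultimately obtain \<sigma>' where \<sigma>': "\<sigma>' \<in> auts L M'" "\<forall>a b. (a, b) \<in> H\<inverse> O S O H \<longrightarrow> \<sigma>' a = b"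
    using homogeneous[OF inf M'] by blast
  have "\<sigma>' d = d" if d: "d \<in> H `` D" for d
  proof -
    obtain a where a: "a \<in> D" "(a, d) \<in> H" using d by blast
    then have "(a, a) \<in> S" using \<rho>(2) by (force simp: S_def D_def)
    then have "(d, d) \<in> H\<inverse> O S O H" using a by blast
    then show ?thesis using \<sigma>'(2) by blast
  qed
  moreover have "elem_subset TYPE('v) L M' (H `` D)"
    by (rule elem_subset_image[OF str str' H(1) elemD H(3)])
  moreover have "small M' (H `` D)"
    by (rule small_image_mono[OF smallH, of _ snd]) force
  ultimately have "\<sigma>' \<in> fixers TYPE('v) L M'" using \<sigma>'(1) unfolding fixers_def by blast
  moreover have "\<sigma>' b = c" if "a \<in> A" "(a, b) \<in> G" "(\<sigma> a, c) \<in> G" for a b c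
  proof -
    have "(a, b) \<in> H" "(g a, c) \<in> H" using that gA H(2) by (auto simp: G0_def)
    moreover have "(a, g a) \<in> S" using that by (auto simp: S_def)
    ultimately have "(b, c) \<in> H\<inverse> O S O H" by blast
    then show ?thesis using \<sigma>'(2) by blast
  qed
  ultimately show ?thesis by blast
qed

text \<open>
  The number of factors is preserved by the transfer, which the bound on Lascar distances will need.
\<close>

lemma transfer_words:
  fixes T T' :: "('f, 'p, 'v \<times> 's) fm set" and M :: "('f, 'p, 's, 'm) struct" and M' :: "('f, 'p, 's, 'n) struct"
  assumes inf: "infinite (UNIV :: 'v set)" and M: "monster L T M" and M': "monster L T' M'"
  shows "\<tau> \<in> words (Aut L M) (fixers TYPE('v) L M) n \<Longrightarrow> elem_rel TYPE('v) L M M' G \<Longrightarrow>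
    A \<subseteq> universe M \<Longrightarrow> small M A \<Longrightarrow> small M' A \<Longrightarrow>
    \<exists>\<tau>'\<in>words (Aut L M') (fixers TYPE('v) L M') n. \<forall>a\<in>A. \<forall>b c. (a, b) \<in> G \<longrightarrow> (\<tau> a, c) \<in> G \<longrightarrow> \<tau>' b = c"
proof (induction n arbitrary: \<tau> G)
  case 0
  note G = 0(2)
  have "b = c \<and> b \<in> universe M'" if "a \<in> A" "(a, b) \<in> G" "(\<tau> a, c) \<in> G" for a b c
    using that 0(1,3) Aut_one_apply[of a M L] elem_rel_universe[OF G that(2)]
      elem_rel_inj[OF inf G monsterD(1)[OF M] monsterD(1)[OF M'] that(2), of a c] by auto
  then show ?case using Aut_one_apply[of _ M' L] by simp
next
  case (Suc n)
  note str = monsterD(1)[OF M] and infM = monsterD(2)[OF M]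
    and str' = monsterD(1)[OF M'] and infM' = monsterD(2)[OF M']
  note A = Suc.prems(3-5)
  interpret group "Aut L M" by (rule Aut_group[OF str])
  interpret M': group "Aut L M'" by (rule Aut_group[OF str'])
  obtain g h where gh: "g \<in> fixers TYPE('v) L M" "h \<in> words (Aut L M) (fixers TYPE('v) L M) n"
    "\<tau> = g \<otimes>\<^bsub>Aut L M\<^esub> h" using Suc.prems(1) by auto
  have ga: "g \<in> auts L M" using gh(1) fixers_auts by blast
  have ha: "h \<in> auts L M"
    using gh(2) words_carrier[OF is_group, of "fixers TYPE('v) L M" n] fixers_auts[of "TYPE('v)" L M] by auto
  have hA: "h ` A \<subseteq> universe M" "small M (h ` A)" "small M' (h ` A)"
    using A auts_universe[OF ha] small_image by blast+
  have \<tau>: "\<tau> a = g (h a)" if "a \<in> A" for a using that A(1) gh(3) Aut_apply[OF ga ha] by auto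
  define G0 where "G0 = G \<inter> (A \<union> \<tau> ` A) \<times> UNIV"
  have G0: "elem_rel TYPE('v) L M M' G0" by (rule elem_rel_mono[OF Suc.prems(2)]) (simp add: G0_def)
  have AA: "small M' (A \<union> \<tau> ` A)" by (intro small_Un infM' A small_image)
  have smallG0: "small M' G0"
    by (rule small_elem_rel[OF inf G0 str str' AA]) (auto simp: G0_def)
  from elem_rel_extend[OF inf str infM M' G0 smallG0 hA(1,3)]
  obtain H where H: "elem_rel TYPE('v) L M M' H" "G0 \<subseteq> H" "h ` A \<subseteq> Domain H" by blast
  obtain h' where h': "h' \<in> words (Aut L M') (fixers TYPE('v) L M') n"
    "\<And>a b c. a \<in> A \<Longrightarrow> (a, b) \<in> H \<Longrightarrow> (h a, c) \<in> H \<Longrightarrow> h' b = c"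
    using Suc.IH[OF gh(2) H(1) A] by blast
  obtain g' where g': "g' \<in> fixers TYPE('v) L M'"
    "\<And>a b c. a \<in> h ` A \<Longrightarrow> (a, b) \<in> H \<Longrightarrow> (g a, c) \<in> H \<Longrightarrow> g' b = c"
    using transfer_fixer[OF inf M M' gh(1) H(1) hA] by blast
  have auts': "g' \<in> auts L M'" "h' \<in> auts L M'"
    using h'(1) g'(1) words_carrier[OF M'.is_group, of "fixers TYPE('v) L M'" n] fixers_auts[of "TYPE('v)" L M'] by auto
  have "(g' \<otimes>\<^bsub>Aut L M'\<^esub> h') b = c" if 0: "a \<in> A" "(a, b) \<in> G" "(\<tau> a, c) \<in> G" for a b c
  proof -
    have abc: "(a, b) \<in> H" "(g (h a), c) \<in> H" using 0 H(2) \<tau> by (auto simp: G0_def)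
    obtain d where d: "(h a, d) \<in> H" using H(3) 0(1) by blast
    have "h' b = d" "g' d = c" using h'(2)[OF 0(1) abc(1) d] g'(2)[OF _ d abc(2)] 0(1) by auto
    moreover have "b \<in> universe M'" using elem_rel_universe[OF H(1) abc(1)] by blast
    ultimately show ?thesis using Aut_apply[OF auts'] by simp
  qed
  moreover have "g' \<otimes>\<^bsub>Aut L M'\<^esub> h' \<in> words (Aut L M') (fixers TYPE('v) L M') (Suc n)"
    using g'(1) h'(1) by auto
  ultimately show ?case by blast
qed

lemma transfer_Autf:
  fixes T T' :: "('f, 'p, 'v \<times> 's) fm set" and M :: "('f, 'p, 's, 'm) struct" and M' :: "('f, 'p, 's, 'n) struct"
  assumes inf: "infinite (UNIV :: 'v set)" and M: "monster L T M" and M': "monster L T' M'"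
    and "\<tau> \<in> Autf TYPE('v) L M" "elem_rel TYPE('v) L M M' G"
    and "A \<subseteq> universe M" "small M A" "small M' A"
  shows "\<exists>\<tau>'\<in>Autf TYPE('v) L M'. \<forall>a\<in>A. \<forall>b c. (a, b) \<in> G \<longrightarrow> (\<tau> a, c) \<in> G \<longrightarrow> \<tau>' b = c"
proof -
  note Autf = Autf_eq_words[OF inf monsterD(1)[OF M]] Autf_eq_words[OF inf monsterD(1)[OF M']]
  obtain n where "\<tau> \<in> words (Aut L M) (fixers TYPE('v) L M) n" using assms(4) unfolding Autf by blast
  from transfer_words[OF inf M M' this assms(5-8)] obtain \<tau>'
    where "\<tau>' \<in> words (Aut L M') (fixers TYPE('v) L M') n"
      "\<forall>a\<in>A. \<forall>b c. (a, b) \<in> G \<longrightarrow> (\<tau> a, c) \<in> G \<longrightarrow> \<tau>' b = c" by blast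
  then show ?thesis unfolding Autf by (intro bexI[of _ \<tau>']) auto
qed

section \<open>Isomorphic quotients\<close>

text \<open>
  A relation between two groups induces an isomorphism of quotients if it is total on both
  sides, multiplicative modulo the second normal subgroup, and matches the normal subgroups.
  It need not be multiplicative itself. Since an element in relation to an inverse of \<open>x\<close> cancels
  every \<open>y\<close> related to \<open>x\<close> modulo the normal subgroup, the coset of \<open>y\<close> is determined by \<open>x\<close>.
\<close>

lemma quotient_iso_of_relation:
  assumes N1: "N1 \<lhd> G1" and N2: "N2 \<lhd> G2"
    and total: "\<And>x. x \<in> carrier G1 \<Longrightarrow> \<exists>y\<in>carrier G2. R x y"
    and onto: "\<And>y. y \<in> carrier G2 \<Longrightarrow> \<exists>x\<in>carrier G1. R x y"
    and mult: "\<And>x1 x2 y1 y2. \<lbrakk>x1 \<in> carrier G1; x2 \<in> carrier G1; y1 \<in> carrier G2; y2 \<in> carrier G2; R x1 y1; R x2 y2\<rbrakk>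
      \<Longrightarrow> \<exists>n\<in>N2. R (x1 \<otimes>\<^bsub>G1\<^esub> x2) (y1 \<otimes>\<^bsub>G2\<^esub> y2 \<otimes>\<^bsub>G2\<^esub> n)"
    and ker: "\<And>x y. \<lbrakk>x \<in> carrier G1; y \<in> carrier G2; R x y\<rbrakk> \<Longrightarrow> x \<in> N1 \<longleftrightarrow> y \<in> N2"
  shows "G1 Mod N1 \<cong> G2 Mod N2"
proof -
  interpret N1: normal N1 G1 by fact
  interpret N2: normal N2 G2 by fact
  interpret Q: group "G2 Mod N2" by (rule N2.factorgroup_is_group)
  define c where "c y = N2 #>\<^bsub>G2\<^esub> y" for y
  have c_hom: "c \<in> hom G2 (G2 Mod N2)" unfolding c_def by (rule N2.r_coset_hom_Mod)
  have c_carrier: "c y \<in> carrier (G2 Mod N2)" if "y \<in> carrier G2" for y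
    using c_hom that by (rule hom_in_carrier)
  have c_mult: "c (y \<otimes>\<^bsub>G2\<^esub> y') = c y \<otimes>\<^bsub>G2 Mod N2\<^esub> c y'" if "y \<in> carrier G2" "y' \<in> carrier G2" for y y'
    using c_hom that by (rule hom_mult)
  have c_one: "c y = \<one>\<^bsub>G2 Mod N2\<^esub> \<longleftrightarrow> y \<in> N2" if "y \<in> carrier G2" for y
    using that N2.coset_join1[OF _ that N2.subgroup_axioms] N2.coset_join2[OF that N2.subgroup_axioms] N2.subset
    by (auto simp: c_def FactGroup_def)
  have mult': "\<exists>y\<in>carrier G2. R (x1 \<otimes>\<^bsub>G1\<^esub> x2) y \<and> c y = c y1 \<otimes>\<^bsub>G2 Mod N2\<^esub> c y2"
    if *: "x1 \<in> carrier G1" "x2 \<in> carrier G1" "y1 \<in> carrier G2" "y2 \<in> carrier G2" "R x1 y1" "R x2 y2"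
    for x1 x2 y1 y2
  proof -
    obtain n where n: "n \<in> N2" "R (x1 \<otimes>\<^bsub>G1\<^esub> x2) (y1 \<otimes>\<^bsub>G2\<^esub> y2 \<otimes>\<^bsub>G2\<^esub> n)" using mult[OF *] by blast
    have nG: "n \<in> carrier G2" using n(1) N2.subset by blast
    then have "c n = \<one>\<^bsub>G2 Mod N2\<^esub>" using c_one n(1) by blast
    moreover have "c (y1 \<otimes>\<^bsub>G2\<^esub> y2 \<otimes>\<^bsub>G2\<^esub> n) = c y1 \<otimes>\<^bsub>G2 Mod N2\<^esub> c y2 \<otimes>\<^bsub>G2 Mod N2\<^esub> c n"
      using *(3,4) nG by (simp only: c_mult N2.m_closed)
    ultimately have "c (y1 \<otimes>\<^bsub>G2\<^esub> y2 \<otimes>\<^bsub>G2\<^esub> n) = c y1 \<otimes>\<^bsub>G2 Mod N2\<^esub> c y2"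
      using Q.r_one Q.m_closed c_carrier *(3,4) by metis
    then show ?thesis using n nG * by (intro bexI[of _ "y1 \<otimes>\<^bsub>G2\<^esub> y2 \<otimes>\<^bsub>G2\<^esub> n"]) auto
  qed
  have unique: "c y = c y'"
    if x: "x \<in> carrier G1" and y: "y \<in> carrier G2" "y' \<in> carrier G2" "R x y" "R x y'" for x y y'
  proof -
    obtain u where u: "u \<in> carrier G2" "R (inv\<^bsub>G1\<^esub> x) u" using total x by blast
    have "c u \<otimes>\<^bsub>G2 Mod N2\<^esub> c w = \<one>\<^bsub>G2 Mod N2\<^esub>" if w: "w \<in> carrier G2" "R x w" for w
    proof -
      obtain t where t: "t \<in> carrier G2" "R (inv\<^bsub>G1\<^esub> x \<otimes>\<^bsub>G1\<^esub> x) t" "c t = c u \<otimes>\<^bsub>G2 Mod N2\<^esub> c w"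
        using mult'[of "inv\<^bsub>G1\<^esub> x" x u w] x u w by auto
      then have "t \<in> N2" using ker[of "\<one>\<^bsub>G1\<^esub>" t] x by simp
      then show ?thesis using t c_one by metis
    qed
    then have "c u \<otimes>\<^bsub>G2 Mod N2\<^esub> c y = c u \<otimes>\<^bsub>G2 Mod N2\<^esub> c y'" using y by metis
    then show ?thesis
      using Q.Units_l_cancel[of "c u" "c y" "c y'"] Q.Units_eq c_carrier u(1) y by blast
  qed
  define r where "r x = (SOME y. y \<in> carrier G2 \<and> R x y)" for x
  have r: "r x \<in> carrier G2 \<and> R x (r x)" if "x \<in> carrier G1" for x
    unfolding r_def by (rule someI_ex) (use total[OF that] in blast)
  define \<Phi> where "\<Phi> x = c (r x)" for x
  interpret \<Phi>: group_hom G1 "G2 Mod N2" \<Phi>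
  proof (intro group_hom.intro group_hom_axioms.intro N1.is_group Q.is_group homI)
    show "\<Phi> x \<in> carrier (G2 Mod N2)" if "x \<in> carrier G1" for x
      using r[OF that] c_carrier by (simp add: \<Phi>_def)
    show "\<Phi> (x \<otimes>\<^bsub>G1\<^esub> x') = \<Phi> x \<otimes>\<^bsub>G2 Mod N2\<^esub> \<Phi> x'" if "x \<in> carrier G1" "x' \<in> carrier G1" for x x'
      using mult'[of x x' "r x" "r x'"] unique[of "x \<otimes>\<^bsub>G1\<^esub> x'" _ "r (x \<otimes>\<^bsub>G1\<^esub> x')"] r that
      by (metis N1.m_closed \<Phi>_def)
  qed
  have "\<Phi> ` carrier G1 = carrier (G2 Mod N2)"
  proof
    show "\<Phi> ` carrier G1 \<subseteq> carrier (G2 Mod N2)" by auto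
    show "carrier (G2 Mod N2) \<subseteq> \<Phi> ` carrier G1"
    proof
      fix q assume "q \<in> carrier (G2 Mod N2)"
      then obtain y where y: "y \<in> carrier G2" "q = c y" by (auto simp: FactGroup_def RCOSETS_def c_def)
      obtain x where x: "x \<in> carrier G1" "R x y" using onto[OF y(1)] by blast
      then have "q = \<Phi> x" using unique[of x y "r x"] r[of x] y by (simp add: \<Phi>_def)
      then show "q \<in> \<Phi> ` carrier G1" using x(1) by blast
    qed
  qed
  moreover have "kernel G1 (G2 Mod N2) \<Phi> = N1"
  proof -
    have "\<Phi> x = \<one>\<^bsub>G2 Mod N2\<^esub> \<longleftrightarrow> x \<in> N1" if "x \<in> carrier G1" for x
      using r[OF that] c_one[of "r x"] ker[OF that, of "r x"] by (simp only: \<Phi>_def)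
    then show ?thesis using N1.subset by (auto simp: kernel_def)
  qed
  ultimately show ?thesis using \<Phi>.FactGroup_iso by simp
qed

section \<open>The relativized Lascar Galois groups\<close>

lemma realizations_car: "a \<in> realizations M X \<Sigma> \<Longrightarrow> x \<in> X \<Longrightarrow> a x \<in> car M (snd x)"
  unfolding realizations_def by (auto dest: PiE_mem)

lemma realizations_universe: "a \<in> realizations M X \<Sigma> \<Longrightarrow> x \<in> X \<Longrightarrow> a x \<in> universe M"
  using realizations_car unfolding universe_def by blast

lemma elem_rel_realization:
  fixes \<Sigma> :: "('f, 'p, 'v \<times> 's) fm set"
  assumes \<Sigma>: "\<forall>\<phi>\<in>\<Sigma>. wf_fm L \<phi> \<and> fv \<phi> \<subseteq> X" and M: "is_structure L M" and G: "elem_rel TYPE('v) L M M' G"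
    and a: "a \<in> realizations M X \<Sigma>" and b: "b \<in> extensional X" "\<And>x. x \<in> X \<Longrightarrow> (a x, b x) \<in> G"
  shows "b \<in> realizations M' X \<Sigma>"
proof -
  have car: "b x \<in> car M' (snd x)" if "x \<in> X" for x
    using elem_rel_car1[OF G b(2)[OF that] M] realizations_car[OF a that] by blast
  have "sat M' b \<phi>" if \<phi>: "\<phi> \<in> \<Sigma>" for \<phi>
  proof -
    have fv: "x \<in> X" if "x \<in> fv \<phi>" for x using \<Sigma> \<phi> that by blast
    have "sat M a \<phi> = sat M' b \<phi>"
    proof (rule elem_relD[OF G])
      show "srt M a (fv \<phi>)" "srt M' b (fv \<phi>)"
        unfolding srt_def using fv car realizations_car[OF a] by blast+
    qed (use \<Sigma> \<phi> b(2) fv in blast)+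
    then show ?thesis using a \<phi> by (simp add: realizations_def)
  qed
  then show ?thesis using b(1) car unfolding realizations_def by (auto simp: PiE_def)
qed

lemma aut_realization:
  fixes \<Sigma> :: "('f, 'p, 'v \<times> 's) fm set"
  assumes \<Sigma>: "\<forall>\<phi>\<in>\<Sigma>. wf_fm L \<phi> \<and> fv \<phi> \<subseteq> X" and M: "is_structure L M" and \<sigma>: "\<sigma> \<in> auts L M"
    and a: "a \<in> realizations M X \<Sigma>"
  shows "compose X \<sigma> a \<in> realizations M X \<Sigma>"
  by (rule elem_rel_realization[OF \<Sigma> M elem_rel_aut[OF M \<sigma>] a])
    (use realizations_universe[OF a] in \<open>auto simp: compose_def\<close>)

text \<open>
  The elements occurring in the first \<open>l\<close> of the tuples \<open>a\<close>.
\<close>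

definition points :: "'x set \<Rightarrow> enat \<Rightarrow> (nat \<Rightarrow> 'x \<Rightarrow> 'm) \<Rightarrow> 'm set" where
  "points X l a = {a i x | i x. enat i < l \<and> x \<in> X}"

lemma small_points:
  assumes "infinite (universe N)" "small N X" "small N (UNIV :: nat set)"
  shows "small N (points X l a)"
proof (rule small_image_mono[OF small_Times[OF assms(1,3,2)]])
  show "points X l a \<subseteq> (\<lambda>(i, x). a i x) ` (UNIV \<times> X)" by (force simp: points_def)
qed

text \<open>
  The automorphisms of \<open>M\<close> whose restrictions form \<^const>\<open>Autf_fix_upto\<close>. Equality of Lascar types
  is expressed on the elements occurring in the tuples.
\<close>

definition fix_auts ::
  "enat \<Rightarrow> ('f, 'p, 's) lang \<Rightarrow> ('f, 'p, 's, 'm) struct \<Rightarrow> ('v \<times> 's) set \<Rightarrow>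
   ('f, 'p, 'v \<times> 's) fm set \<Rightarrow> ('m \<Rightarrow> 'm) set" where
  "fix_auts l L M X \<Sigma> = {\<sigma> \<in> auts L M.
     \<forall>a. (\<forall>i. enat i < l \<longrightarrow> a i \<in> realizations M X \<Sigma>) \<longrightarrow>
       (\<exists>\<tau>\<in>Autf TYPE('v) L M. \<forall>b\<in>points X l a. \<sigma> b = \<tau> b)}"

lemma lascar_eq_image:
  fixes X :: "('v \<times> 's) set"
  shows "lascar_eq L M X J a (\<lambda>j. compose X \<sigma> (a j)) \<longleftrightarrow>
    (\<exists>\<tau>\<in>Autf TYPE('v) L M. \<forall>j\<in>J. \<forall>x\<in>X. \<sigma> (a j x) = \<tau> (a j x))"
proof -
  have "compose X \<sigma> b = compose X \<tau> b \<longleftrightarrow> (\<forall>x\<in>X. \<sigma> (b x) = \<tau> (b x))" for \<tau> and b :: "'v \<times> 's \<Rightarrow> _"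
    by (auto simp: compose_def fun_eq_iff)
  then show ?thesis by (simp add: lascar_eq_def)
qed

lemma Autf_fix_upto_eq: "Autf_fix_upto l L M X \<Sigma> = restr M X \<Sigma> ` fix_auts l L M X \<Sigma>"
proof -
  have "(\<forall>b\<in>points X l a. \<sigma> b = \<tau> b) \<longleftrightarrow> (\<forall>j\<in>{i. enat i < l}. \<forall>x\<in>X. \<sigma> (a j x) = \<tau> (a j x))"
    for \<sigma> \<tau> :: "'c \<Rightarrow> 'c" and a
    by (auto simp: points_def)
  then show ?thesis
    unfolding Autf_fix_upto_def fix_auts_def lascar_eq_image by auto
qed

lemma fix_auts_auts: "\<sigma> \<in> fix_auts l L M X \<Sigma> \<Longrightarrow> \<sigma> \<in> auts L M"
  by (simp add: fix_auts_def)

lemma fix_autsD: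
  fixes X :: "('v \<times> 's) set"
  assumes "\<sigma> \<in> fix_auts l L M X \<Sigma>" "\<And>i. enat i < l \<Longrightarrow> a i \<in> realizations M X \<Sigma>"
  obtains \<tau> where "\<tau> \<in> Autf TYPE('v) L M" "\<And>b. b \<in> points X l a \<Longrightarrow> \<sigma> b = \<tau> b"
  using assms unfolding fix_auts_def mem_Collect_eq by meson

lemma Autf_fix_auts:
  fixes \<Sigma> :: "('f, 'p, 'v \<times> 's) fm set"
  assumes M: "is_structure L M"
  shows "Autf TYPE('v) L M \<subseteq> fix_auts l L M X \<Sigma>"
  using subgroup.subset[OF Autf_subgroup[OF M, of "TYPE('v)"]] unfolding fix_auts_def by auto

lemma points_universe:
  "(\<And>i. enat i < l \<Longrightarrow> a i \<in> realizations M X \<Sigma>) \<Longrightarrow> points X l a \<subseteq> universe M"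
  using realizations_universe by (fastforce simp: points_def)

lemma points_compose: "points X l (\<lambda>i. compose X \<sigma> (a i)) = \<sigma> ` points X l a"
  by (force simp: points_def compose_def)

lemma fix_auts_normal:
  fixes \<Sigma> :: "('f, 'p, 'v \<times> 's) fm set"
  assumes inf: "infinite (UNIV :: 'v set)" and M: "is_structure L M"
    and \<Sigma>: "\<forall>\<phi>\<in>\<Sigma>. wf_fm L \<phi> \<and> fv \<phi> \<subseteq> X"
  shows "fix_auts l L M X \<Sigma> \<lhd> Aut L M"
proof -
  interpret group "Aut L M" by (rule Aut_group[OF M])
  interpret Autf: subgroup "Autf TYPE('v) L M" "Aut L M" by (rule Autf_subgroup[OF M])
  let ?H = "fix_auts l L M X \<Sigma>"
  note closed = one_closed[unfolded Aut_carrier] m_closed[unfolded Aut_carrier] inv_closed[unfolded Aut_carrier]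
  have Aa: "\<tau> \<in> auts L M" if "\<tau> \<in> Autf TYPE('v) L M" for \<tau> using Autf.subset that by auto
  have moved: "\<And>i. enat i < l \<Longrightarrow> compose X \<sigma> (a i) \<in> realizations M X \<Sigma>"
    if "\<sigma> \<in> auts L M" "\<And>i. enat i < l \<Longrightarrow> a i \<in> realizations M X \<Sigma>" for \<sigma> a
    using aut_realization[OF \<Sigma> M that(1)] that(2) by blast
  have get: "\<exists>\<tau>\<in>Autf TYPE('v) L M. \<forall>b\<in>\<alpha> ` points X l a. \<sigma> b = \<tau> b"
    if 0: "\<sigma> \<in> ?H" "\<alpha> \<in> auts L M" "\<And>i. enat i < l \<Longrightarrow> a i \<in> realizations M X \<Sigma>" for \<sigma> \<alpha> a
  proof -
    obtain \<tau> where "\<tau> \<in> Autf TYPE('v) L M"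
        "\<And>b. b \<in> points X l (\<lambda>i. compose X \<alpha> (a i)) \<Longrightarrow> \<sigma> b = \<tau> b"
      by (rule fix_autsD[OF 0(1), of "\<lambda>i. compose X \<alpha> (a i)"]) (use moved[OF 0(2)] 0(3) in blast)+
    then show ?thesis unfolding points_compose by blast
  qed
  have one: "\<one>\<^bsub>Aut L M\<^esub> \<in> ?H" using Autf_fix_auts[OF M] Autf.one_closed by blast
  have mult: "\<sigma> \<otimes>\<^bsub>Aut L M\<^esub> \<tau> \<in> ?H" if st: "\<sigma> \<in> ?H" "\<tau> \<in> ?H" for \<sigma> \<tau>
    unfolding fix_auts_def
  proof (intro CollectI conjI allI impI)
    note au = fix_auts_auts[OF st(1)] fix_auts_auts[OF st(2)]
    show "\<sigma> \<otimes>\<^bsub>Aut L M\<^esub> \<tau> \<in> auts L M" using au closed by blast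
    fix a assume a: "\<forall>i. enat i < l \<longrightarrow> a i \<in> realizations M X \<Sigma>"
    then have U: "points X l a \<subseteq> universe M" by (intro points_universe) blast
    obtain \<tau>' where \<tau>': "\<tau>' \<in> Autf TYPE('v) L M" "\<And>b. b \<in> points X l a \<Longrightarrow> \<tau> b = \<tau>' b"
      by (rule fix_autsD[OF st(2), of a]) (use a in blast)+
    obtain \<sigma>' where \<sigma>': "\<sigma>' \<in> Autf TYPE('v) L M" "\<forall>b\<in>\<tau> ` points X l a. \<sigma> b = \<sigma>' b"
      using get[OF st(1) au(2)] a by blast
    have "(\<sigma> \<otimes>\<^bsub>Aut L M\<^esub> \<tau>) b = (\<sigma>' \<otimes>\<^bsub>Aut L M\<^esub> \<tau>') b" if "b \<in> points X l a" for b
      using that U \<tau>'(2) \<sigma>'(2) Aut_apply[OF au, of b] Aut_apply[OF Aa[OF \<sigma>'(1)] Aa[OF \<tau>'(1)], of b]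
      by (metis imageI subsetD)
    then show "\<exists>\<rho>\<in>Autf TYPE('v) L M. \<forall>b\<in>points X l a. (\<sigma> \<otimes>\<^bsub>Aut L M\<^esub> \<tau>) b = \<rho> b"
      using Autf.m_closed[OF \<sigma>'(1) \<tau>'(1)] by blast
  qed
  have inv: "inv\<^bsub>Aut L M\<^esub> \<sigma> \<in> ?H" if s: "\<sigma> \<in> ?H" for \<sigma>
    unfolding fix_auts_def
  proof (intro CollectI conjI allI impI)
    note au = fix_auts_auts[OF s]
    let ?\<iota> = "inv\<^bsub>Aut L M\<^esub> \<sigma>"
    show \<iota>: "?\<iota> \<in> auts L M" using au closed by blast
    fix a assume a: "\<forall>i. enat i < l \<longrightarrow> a i \<in> realizations M X \<Sigma>"
    then have U: "points X l a \<subseteq> universe M" by (intro points_universe) blast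
    obtain \<sigma>' where \<sigma>': "\<sigma>' \<in> Autf TYPE('v) L M" "\<forall>b\<in>?\<iota> ` points X l a. \<sigma> b = \<sigma>' b"
      using get[OF s \<iota>] a by blast
    have "?\<iota> b = (inv\<^bsub>Aut L M\<^esub> \<sigma>') b" if b: "b \<in> points X l a" for b
    proof -
      have "b = \<sigma> (?\<iota> b)" using Aut_inv(3)[OF M au] b U by auto
      also have "\<dots> = \<sigma>' (?\<iota> b)" using \<sigma>'(2) b by blast
      finally show ?thesis
        using Aut_inv(2)[OF M Aa[OF \<sigma>'(1)], of "?\<iota> b"] auts_universe[OF \<iota>] b U by auto
    qed
    then show "\<exists>\<rho>\<in>Autf TYPE('v) L M. \<forall>b\<in>points X l a. ?\<iota> b = \<rho> b"
      using Autf.m_inv_closed[OF \<sigma>'(1)] by blast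
  qed
  have conj: "\<alpha> \<otimes>\<^bsub>Aut L M\<^esub> \<sigma> \<otimes>\<^bsub>Aut L M\<^esub> inv\<^bsub>Aut L M\<^esub> \<alpha> \<in> ?H"
    if as: "\<alpha> \<in> auts L M" "\<sigma> \<in> ?H" for \<alpha> \<sigma>
    unfolding fix_auts_def
  proof (intro CollectI conjI allI impI)
    note au = fix_auts_auts[OF as(2)]
    let ?\<iota> = "inv\<^bsub>Aut L M\<^esub> \<alpha>"
    have \<iota>: "?\<iota> \<in> auts L M" using as(1) closed by blast
    show "\<alpha> \<otimes>\<^bsub>Aut L M\<^esub> \<sigma> \<otimes>\<^bsub>Aut L M\<^esub> ?\<iota> \<in> auts L M" by (intro closed as(1) au \<iota>)
    fix a assume a: "\<forall>i. enat i < l \<longrightarrow> a i \<in> realizations M X \<Sigma>"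
    then have U: "points X l a \<subseteq> universe M" by (intro points_universe) blast
    obtain \<sigma>' where \<sigma>': "\<sigma>' \<in> Autf TYPE('v) L M" "\<forall>b\<in>?\<iota> ` points X l a. \<sigma> b = \<sigma>' b"
      using get[OF as(2) \<iota>] a by blast
    have ap: "(\<alpha> \<otimes>\<^bsub>Aut L M\<^esub> \<rho> \<otimes>\<^bsub>Aut L M\<^esub> ?\<iota>) b = \<alpha> (\<rho> (?\<iota> b))"
      if "\<rho> \<in> auts L M" "b \<in> universe M" for \<rho> b
      using that as(1) \<iota> closed auts_universe[OF \<iota>] by (simp add: Aut_apply)
    have "(\<alpha> \<otimes>\<^bsub>Aut L M\<^esub> \<sigma> \<otimes>\<^bsub>Aut L M\<^esub> ?\<iota>) b = (\<alpha> \<otimes>\<^bsub>Aut L M\<^esub> \<sigma>' \<otimes>\<^bsub>Aut L M\<^esub> ?\<iota>) b"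
      if b: "b \<in> points X l a" for b
      using ap[OF au] ap[OF Aa[OF \<sigma>'(1)]] \<sigma>'(2) b U by (metis imageI subsetD)
    then show "\<exists>\<rho>\<in>Autf TYPE('v) L M. \<forall>b\<in>points X l a. (\<alpha> \<otimes>\<^bsub>Aut L M\<^esub> \<sigma> \<otimes>\<^bsub>Aut L M\<^esub> ?\<iota>) b = \<rho> b"
      using Autf_conj[OF inf M as(1) \<sigma>'(1)] by blast
  qed
  have "subgroup ?H (Aut L M)"
    by (rule subgroupI) (use fix_auts_auts one mult inv in \<open>auto simp: subset_iff\<close>)
  then show ?thesis unfolding normal_inv_iff using conj by simp
qed

lemma restr_Bij:
  fixes \<Sigma> :: "('f, 'p, 'v \<times> 's) fm set"
  assumes M: "is_structure L M" and \<Sigma>: "\<forall>\<phi>\<in>\<Sigma>. wf_fm L \<phi> \<and> fv \<phi> \<subseteq> X"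
    and \<sigma>: "\<sigma> \<in> auts L M"
  shows "restr M X \<Sigma> \<sigma> \<in> Bij (realizations M X \<Sigma>)"
proof -
  let ?S = "realizations M X \<Sigma>" and ?\<iota> = "inv\<^bsub>Aut L M\<^esub> \<sigma>"
  note \<iota> = Aut_inv[OF M \<sigma>]
  have ext: "a \<in> extensional X" if "a \<in> ?S" for a using that by (auto simp: realizations_def PiE_def)
  have "compose X ?\<iota> (compose X \<sigma> a) = a" "compose X \<sigma> (compose X ?\<iota> a) = a" if "a \<in> ?S" for a
    using \<iota> realizations_universe[OF that] ext[OF that]
    by (auto simp: compose_def fun_eq_iff extensional_def)
  then have "bij_betw (compose X \<sigma>) ?S ?S"
    by (intro bij_betw_byWitness[of _ "compose X ?\<iota>"])
      (use aut_realization[OF \<Sigma> M \<sigma>] aut_realization[OF \<Sigma> M \<iota>(1)] in auto)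
  then show ?thesis by (auto simp: Bij_def restr_def bij_betw_def inj_on_def)
qed

lemma restr_hom:
  fixes \<Sigma> :: "('f, 'p, 'v \<times> 's) fm set"
  assumes M: "is_structure L M" and \<Sigma>: "\<forall>\<phi>\<in>\<Sigma>. wf_fm L \<phi> \<and> fv \<phi> \<subseteq> X"
  shows "group_hom (Aut L M) (Aut_real L M X \<Sigma>) (restr M X \<Sigma>)"
proof -
  let ?S = "realizations M X \<Sigma>"
  have mult: "restr M X \<Sigma> (\<sigma> \<otimes>\<^bsub>Aut L M\<^esub> \<tau>) = restr M X \<Sigma> \<sigma> \<otimes>\<^bsub>BijGroup ?S\<^esub> restr M X \<Sigma> \<tau>"
    if st: "\<sigma> \<in> auts L M" "\<tau> \<in> auts L M" for \<sigma> \<tau>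
  proof -
    have "compose X (\<sigma> \<otimes>\<^bsub>Aut L M\<^esub> \<tau>) a = compose X \<sigma> (compose X \<tau> a)" if "a \<in> ?S" for a
      using Aut_apply[OF st] realizations_universe[OF that] by (auto simp: compose_def fun_eq_iff)
    then have "restr M X \<Sigma> (\<sigma> \<otimes>\<^bsub>Aut L M\<^esub> \<tau>) = compose ?S (restr M X \<Sigma> \<sigma>) (restr M X \<Sigma> \<tau>)"
      using aut_realization[OF \<Sigma> M st(2)] unfolding restr_def compose_def[of ?S]
      by (intro restrict_ext) simp
    then show ?thesis using restr_Bij[OF M \<Sigma>] st by (simp add: BijGroup_def)
  qed
  have "group_hom (Aut L M) (BijGroup ?S) (restr M X \<Sigma>)"
  proof (intro group_hom.intro group_hom_axioms.intro homI Aut_group[OF M] group_BijGroup)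
  qed (use restr_Bij[OF M \<Sigma>] mult in \<open>simp_all add: BijGroup_def\<close>)
  then have "subgroup (restr M X \<Sigma> ` carrier (Aut L M)) (BijGroup ?S)"
    by (rule group_hom.img_is_subgroup)
  then have "group (Aut_real L M X \<Sigma>)"
    using subgroup.subgroup_is_group[OF _ group_BijGroup] by (simp add: Aut_real_def)
  then show ?thesis
    using Aut_group[OF M] mult by (intro group_hom.intro group_hom_axioms.intro homI) (auto simp: Aut_real_def)
qed

lemma Aut_real_carrier: "carrier (Aut_real L M X \<Sigma>) = restr M X \<Sigma> ` auts L M"
  by (simp add: Aut_real_def)

lemma Autf_fix_upto_normal:
  fixes \<Sigma> :: "('f, 'p, 'v \<times> 's) fm set"
  assumes inf: "infinite (UNIV :: 'v set)" and M: "is_structure L M"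
    and \<Sigma>: "\<forall>\<phi>\<in>\<Sigma>. wf_fm L \<phi> \<and> fv \<phi> \<subseteq> X"
  shows "Autf_fix_upto l L M X \<Sigma> \<lhd> Aut_real L M X \<Sigma>"
proof -
  interpret r: group_hom "Aut L M" "Aut_real L M X \<Sigma>" "restr M X \<Sigma>" by (rule restr_hom[OF M \<Sigma>])
  interpret N: normal "fix_auts l L M X \<Sigma>" "Aut L M" by (rule fix_auts_normal[OF inf M \<Sigma>])
  have "restr M X \<Sigma> \<alpha> \<otimes>\<^bsub>Aut_real L M X \<Sigma>\<^esub> restr M X \<Sigma> \<sigma> \<otimes>\<^bsub>Aut_real L M X \<Sigma>\<^esub> inv\<^bsub>Aut_real L M X \<Sigma>\<^esub> restr M X \<Sigma> \<alpha>
      \<in> restr M X \<Sigma> ` fix_auts l L M X \<Sigma>"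
    if "\<alpha> \<in> carrier (Aut L M)" "\<sigma> \<in> fix_auts l L M X \<Sigma>" for \<alpha> \<sigma>
  proof -
    have "\<sigma> \<in> carrier (Aut L M)" using that(2) N.subset by blast
    then have "restr M X \<Sigma> (\<alpha> \<otimes>\<^bsub>Aut L M\<^esub> \<sigma> \<otimes>\<^bsub>Aut L M\<^esub> inv\<^bsub>Aut L M\<^esub> \<alpha>) =
      restr M X \<Sigma> \<alpha> \<otimes>\<^bsub>Aut_real L M X \<Sigma>\<^esub> restr M X \<Sigma> \<sigma> \<otimes>\<^bsub>Aut_real L M X \<Sigma>\<^esub> inv\<^bsub>Aut_real L M X \<Sigma>\<^esub> restr M X \<Sigma> \<alpha>"
      using that(1) by (simp only: r.hom_mult r.hom_inv r.G.m_closed r.G.inv_closed)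
    then show ?thesis using N.inv_op_closed2[OF that] by (metis imageI)
  qed
  moreover have "subgroup (restr M X \<Sigma> ` fix_auts l L M X \<Sigma>) (Aut_real L M X \<Sigma>)"
    by (rule r.subgroup_img_is_subgroup[OF N.subgroup_axioms])
  ultimately show ?thesis
    unfolding Autf_fix_upto_eq r.H.normal_inv_iff Aut_real_carrier by auto
qed

lemma restr_fix_auts:
  fixes \<Sigma> :: "('f, 'p, 'v \<times> 's) fm set"
  assumes \<sigma>: "\<sigma> \<in> auts L M"
  shows "restr M X \<Sigma> \<sigma> \<in> Autf_fix_upto l L M X \<Sigma> \<longleftrightarrow> \<sigma> \<in> fix_auts l L M X \<Sigma>"
proof
  assume "restr M X \<Sigma> \<sigma> \<in> Autf_fix_upto l L M X \<Sigma>"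
  then obtain \<tau> where \<tau>: "\<tau> \<in> fix_auts l L M X \<Sigma>" "restr M X \<Sigma> \<sigma> = restr M X \<Sigma> \<tau>"
    by (auto simp: Autf_fix_upto_eq)
  have eq: "\<sigma> (a x) = \<tau> (a x)" if "a \<in> realizations M X \<Sigma>" "x \<in> X" for a x
  proof -
    have "compose X \<sigma> a = compose X \<tau> a" using fun_cong[OF \<tau>(2), of a] that(1) by (simp add: restr_def)
    then show ?thesis using that(2) by (metis compose_eq)
  qed
  show "\<sigma> \<in> fix_auts l L M X \<Sigma>"
    unfolding fix_auts_def
  proof (intro CollectI conjI allI impI \<sigma>)
    fix a assume a: "\<forall>i. enat i < l \<longrightarrow> a i \<in> realizations M X \<Sigma>"
    obtain \<rho> where "\<rho> \<in> Autf TYPE('v) L M" "\<And>b. b \<in> points X l a \<Longrightarrow> \<tau> b = \<rho> b"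
      by (rule fix_autsD[OF \<tau>(1), of a]) (use a in blast)+
    moreover have "\<sigma> b = \<tau> b" if "b \<in> points X l a" for b using that a eq by (auto simp: points_def)
    ultimately show "\<exists>\<rho>\<in>Autf TYPE('v) L M. \<forall>b\<in>points X l a. \<sigma> b = \<rho> b" by metis
  qed
qed (simp add: Autf_fix_upto_eq)

section \<open>Comparing two monster models\<close>

text \<open>
  The image of the relation \<open>E\<close> under a pair of maps.
\<close>

definition twist :: "('m \<times> 'n) set \<Rightarrow> ('m \<Rightarrow> 'm) \<Rightarrow> ('n \<Rightarrow> 'n) \<Rightarrow> ('m \<times> 'n) set" where
  "twist E \<sigma> \<tau> = {(\<sigma> a, \<tau> b) | a b. (a, b) \<in> E}"

text \<open>
  The relation \<open>E\<close> will be an elementary bijection between elementary submodels of \<open>M\<close> and \<open>M'\<close>.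
  Automorphisms \<open>\<sigma>\<close> of \<open>M\<close> and \<open>\<tau>\<close> of \<open>M'\<close> correspond if the images of these submodels have the
  same type over the submodels, up to \<open>E\<close>.
\<close>

definition corresponding ::
  "'v itself \<Rightarrow> ('f, 'p, 's) lang \<Rightarrow> ('f, 'p, 's, 'm) struct \<Rightarrow> ('f, 'p, 's, 'n) struct \<Rightarrow>
   ('m \<times> 'n) set \<Rightarrow> ('m \<Rightarrow> 'm) \<Rightarrow> ('n \<Rightarrow> 'n) \<Rightarrow> bool" where
  "corresponding V L M M' E \<sigma> \<tau> \<longleftrightarrow> elem_rel V L M M' (E \<union> twist E \<sigma> \<tau>)"

lemma corresponding_converse:
  "corresponding V L M M' E \<sigma> \<tau> \<longleftrightarrow> corresponding V L M' M (E\<inverse>) \<tau> \<sigma>"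
proof -
  have "(E \<union> twist E \<sigma> \<tau>)\<inverse> = E\<inverse> \<union> twist (E\<inverse>) \<tau> \<sigma>" by (auto simp: twist_def)
  then show ?thesis unfolding corresponding_def by (metis elem_rel_converse converse_converse)
qed

lemma small_twist: "small N E \<Longrightarrow> small N (twist E \<sigma> \<tau>)"
  by (rule small_image_mono[of N E _ "\<lambda>(a, b). (\<sigma> a, \<tau> b)"]) (auto simp: twist_def image_iff)

text \<open>
  For any given \<open>\<sigma>\<close>, a small elementary relation \<open>G\<close> containing \<open>E\<close> is extended to an elementary
  relation that also contains the image of \<open>E\<close> under \<open>\<sigma>\<close> and some automorphism \<open>\<tau>\<close>. Choosing \<open>G\<close>
  larger than \<open>E\<close> makes \<open>\<tau>\<close> compatible with a pair of corresponding automorphisms given before.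
\<close>

lemma corresponding_extend:
  fixes T T' :: "('f, 'p, 'v \<times> 's) fm set" and M :: "('f, 'p, 's, 'm) struct" and M' :: "('f, 'p, 's, 'n) struct"
  assumes inf: "infinite (UNIV :: 'v set)" and M: "monster L T M" and M': "monster L T' M'"
    and G: "elem_rel TYPE('v) L M M' G" "small M' G" and E: "E \<subseteq> G" and \<sigma>: "\<sigma> \<in> auts L M"
  shows "\<exists>H. \<exists>\<tau>\<in>auts L M'. elem_rel TYPE('v) L M M' H \<and> G \<subseteq> H \<and> twist E \<sigma> \<tau> \<subseteq> H"
proof -
  note str = monsterD(1)[OF M] and infM = monsterD(2)[OF M]
    and str' = monsterD(1)[OF M'] and infM' = monsterD(2)[OF M']
  have EU: "a \<in> universe M" if "(a, b) \<in> E" for a b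
    using elem_rel_universe[OF G(1)] E that by blast
  define B where "B = \<sigma> ` Domain E"
  have BU: "B \<subseteq> universe M" using EU auts_universe[OF \<sigma>] by (auto simp: B_def)
  have smallE: "small M' E" using G(2) E by (rule small_mono)
  have smallB: "small M' B"
    by (rule small_image_mono[OF smallE, of _ "\<lambda>(a, b). \<sigma> a"]) (force simp: B_def)
  from elem_rel_extend[OF inf str infM M' G BU smallB]
  obtain H i where H: "elem_rel TYPE('v) L M M' H" "G \<subseteq> H" "B \<subseteq> Domain H" "H \<subseteq> i ` (G <+> B)"
    by blast
  have smallH: "small M' H"
    by (rule small_image_mono[OF small_Plus[OF infM' G(2) smallB] H(4)])
  define S where "S = {(a, \<sigma> a) | a. a \<in> Domain E}"
  have S: "elem_rel TYPE('v) L M M S"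
    by (rule elem_rel_mono[OF elem_rel_aut[OF str \<sigma>]]) (use EU in \<open>auto simp: S_def\<close>)
  have smallS: "small M' S"
    by (rule small_image_mono[OF smallE, of _ "\<lambda>(a, b). (a, \<sigma> a)"]) (force simp: S_def)
  have "elem_rel TYPE('v) L M' M' (H\<inverse> O S O H)"
    by (intro elem_rel_comp[OF elem_rel_converse[OF H(1)]] elem_rel_comp[OF S H(1)] str str')
  moreover have "small M' (H\<inverse> O S O H)"
    by (intro small_relcomp infM' small_converse smallH smallS)
  ultimately obtain \<tau> where \<tau>: "\<tau> \<in> auts L M'" "\<forall>a b. (a, b) \<in> H\<inverse> O S O H \<longrightarrow> \<tau> a = b"
    using homogeneous[OF inf M'] by blast
  have "(\<sigma> a, \<tau> b) \<in> H" if ab: "(a, b) \<in> E" for a b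
  proof -
    have "\<sigma> a \<in> Domain H" using ab H(3) by (auto simp: B_def)
    then obtain d where d: "(\<sigma> a, d) \<in> H" by blast
    have "(a, b) \<in> H" "(a, \<sigma> a) \<in> S" using ab E H(2) by (auto simp: S_def)
    then have "(b, d) \<in> H\<inverse> O S O H" using d by blast
    then have "\<tau> b = d" by (rule \<tau>(2)[rule_format])
    then show ?thesis using d by simp
  qed
  then have "twist E \<sigma> \<tau> \<subseteq> H" by (auto simp: twist_def)
  then show ?thesis using H(1,2) \<tau>(1) by blast
qed

lemma corresponding_total:
  fixes T T' :: "('f, 'p, 'v \<times> 's) fm set" and M :: "('f, 'p, 's, 'm) struct" and M' :: "('f, 'p, 's, 'n) struct"
  assumes inf: "infinite (UNIV :: 'v set)" and M: "monster L T M" and M': "monster L T' M'"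
    and E: "elem_rel TYPE('v) L M M' E" "small M' E" and \<sigma>: "\<sigma> \<in> auts L M"
  shows "\<exists>\<tau>\<in>auts L M'. corresponding TYPE('v) L M M' E \<sigma> \<tau>"
proof -
  obtain H \<tau> where "\<tau> \<in> auts L M'" "elem_rel TYPE('v) L M M' H" "E \<subseteq> H" "twist E \<sigma> \<tau> \<subseteq> H"
    using corresponding_extend[OF inf M M' E subset_refl \<sigma>] by blast
  then show ?thesis unfolding corresponding_def by (meson Un_least elem_rel_mono)
qed

lemma fixers_Autf:
  fixes L :: "('f, 'p, 's) lang"
  assumes inf: "infinite (UNIV :: 'v set)" and M: "is_structure L M"
  shows "fixers TYPE('v) L M \<subseteq> Autf TYPE('v) L M"
proof
  fix \<sigma> assume \<sigma>: "\<sigma> \<in> fixers TYPE('v) L M"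
  interpret group "Aut L M" by (rule Aut_group[OF M])
  have "\<sigma> \<in> carrier (Aut L M)" using \<sigma> fixers_auts by auto
  then have "\<sigma> \<otimes>\<^bsub>Aut L M\<^esub> \<one>\<^bsub>Aut L M\<^esub> = \<sigma>" by (rule r_one)
  then have "\<sigma> \<in> words (Aut L M) (fixers TYPE('v) L M) (Suc 0)" using \<sigma> by force
  then show "\<sigma> \<in> Autf TYPE('v) L M" unfolding Autf_eq_words[OF inf M] by blast
qed

text \<open>
  The relation is multiplicative up to Lascar strong automorphisms. Some automorphism \<open>\<tau>3\<close>
  corresponds to the product of \<open>\<sigma>1\<close> and \<open>\<sigma>2\<close> and is chosen compatibly with \<open>\<tau>1\<close>. It is the product
  of \<open>\<tau>1\<close>, \<open>\<rho>\<close>, \<open>\<tau>2\<close> and \<open>\<kappa>\<close>, where \<open>\<rho>\<close> and \<open>\<kappa>\<close> fix the range of \<open>E\<close> pointwise.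
\<close>

lemma corresponding_mult:
  fixes T T' :: "('f, 'p, 'v \<times> 's) fm set" and M :: "('f, 'p, 's, 'm) struct" and M' :: "('f, 'p, 's, 'n) struct"
  assumes inf: "infinite (UNIV :: 'v set)" and M: "monster L T M" and M': "monster L T' M'"
    and E: "small M' E" "elem_subset TYPE('v) L M' (Range E)"
    and 1: "\<sigma>1 \<in> auts L M" "\<tau>1 \<in> auts L M'" "corresponding TYPE('v) L M M' E \<sigma>1 \<tau>1"
    and 2: "\<sigma>2 \<in> auts L M" "\<tau>2 \<in> auts L M'" "corresponding TYPE('v) L M M' E \<sigma>2 \<tau>2"
  shows "\<exists>\<nu>\<in>Autf TYPE('v) L M'. corresponding TYPE('v) L M M' E
    (\<sigma>1 \<otimes>\<^bsub>Aut L M\<^esub> \<sigma>2) (\<tau>1 \<otimes>\<^bsub>Aut L M'\<^esub> \<tau>2 \<otimes>\<^bsub>Aut L M'\<^esub> \<nu>)"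
proof -
  note str = monsterD(1)[OF M] and infM = monsterD(2)[OF M]
    and str' = monsterD(1)[OF M'] and infM' = monsterD(2)[OF M']
  interpret G: group "Aut L M" by (rule Aut_group[OF str])
  interpret G': group "Aut L M'" by (rule Aut_group[OF str'])
  interpret Autf: subgroup "Autf TYPE('v) L M'" "Aut L M'" by (rule Autf_subgroup[OF str'])
  note closed' = G'.m_closed[unfolded Aut_carrier] G'.inv_closed[unfolded Aut_carrier]
  let ?\<sigma>3 = "\<sigma>1 \<otimes>\<^bsub>Aut L M\<^esub> \<sigma>2"
  have \<sigma>3: "?\<sigma>3 \<in> auts L M" using G.m_closed 1 2 by simp
  have EU: "a \<in> universe M \<and> b \<in> universe M'" if "(a, b) \<in> E" for a b
    using elem_rel_universe[OF 1(3)[unfolded corresponding_def], of a b] that by blast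
  have small1: "small M' (E \<union> twist E \<sigma>1 \<tau>1)" by (intro small_Un infM' small_twist E(1))
  obtain H \<tau>3 where \<tau>3: "\<tau>3 \<in> auts L M'" and H: "elem_rel TYPE('v) L M M' H"
      "E \<union> twist E \<sigma>1 \<tau>1 \<subseteq> H" "twist E ?\<sigma>3 \<tau>3 \<subseteq> H"
    using corresponding_extend[OF inf M M' 1(3)[unfolded corresponding_def] small1 Un_upper1 \<sigma>3] by blast
  have R3: "corresponding TYPE('v) L M M' E ?\<sigma>3 \<tau>3"
    unfolding corresponding_def by (rule elem_rel_mono[OF H(1)]) (use H(2,3) in blast)
  let ?i = "inv\<^bsub>Aut L M'\<^esub> \<tau>1"
  note \<iota> = Aut_inv[OF str' 1(2)]
  \<comment> \<open>Over the range of \<open>E\<close>, its images under \<open>\<tau>2\<close> and under \<open>\<tau>3\<close> followed by the inverse of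
    \<open>\<tau>1\<close> have the same type, both corresponding to the image of the domain under \<open>\<sigma>2\<close>.\<close>
  define K where "K = E \<union> twist E \<sigma>2 \<tau>2"
  have K: "elem_rel TYPE('v) L M M' K" using 2(3) by (simp add: K_def corresponding_def)
  define S1 where "S1 = {(a, \<sigma>1 a) | a. a \<in> universe M}"
  define S2 where "S2 = {(a, ?i a) | a. a \<in> universe M'}"
  define P where "P = {(b, b) | b. b \<in> Range E} \<union> {(\<tau>2 b, ?i (\<tau>3 b)) | b. b \<in> Range E}"
  have "P \<subseteq> K\<inverse> O S1 O H O S2"
  proof -
    have "(b, b) \<in> K\<inverse> O S1 O H O S2" if ab: "(a, b) \<in> E" for a b
    proof -
      have "(b, a) \<in> K\<inverse>" "(a, \<sigma>1 a) \<in> S1" using ab EU by (auto simp: K_def S1_def)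
      moreover have "(\<sigma>1 a, \<tau>1 b) \<in> H" using ab H(2) by (auto simp: twist_def)
      moreover have "(\<tau>1 b, b) \<in> S2"
        using EU[OF ab] \<iota>(2)[of b] auts_universe[OF 1(2)] by (force simp: S2_def)
      ultimately show ?thesis by blast
    qed
    moreover have "(\<tau>2 b, ?i (\<tau>3 b)) \<in> K\<inverse> O S1 O H O S2" if ab: "(a, b) \<in> E" for a b
    proof -
      have "(\<tau>2 b, \<sigma>2 a) \<in> K\<inverse>" using ab by (auto simp: K_def twist_def)
      moreover have "(\<sigma>2 a, ?\<sigma>3 a) \<in> S1"
        using EU[OF ab] auts_universe[OF 2(1)] Aut_apply[OF 1(1) 2(1)] by (auto simp: S1_def)
      moreover have "(?\<sigma>3 a, \<tau>3 b) \<in> H" using ab H(3) by (auto simp: twist_def)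
      moreover have "(\<tau>3 b, ?i (\<tau>3 b)) \<in> S2"
        using EU[OF ab] auts_universe[OF \<tau>3] by (auto simp: S2_def)
      ultimately show ?thesis by blast
    qed
    ultimately show ?thesis by (auto simp: P_def)
  qed
  moreover have "elem_rel TYPE('v) L M' M' (K\<inverse> O S1 O H O S2)"
    unfolding S1_def S2_def
    by (intro elem_rel_comp[OF elem_rel_converse[OF K]] elem_rel_comp[OF elem_rel_aut[OF str 1(1)]]
        elem_rel_comp[OF H(1)] elem_rel_aut \<iota>(1) str str')
  ultimately have "elem_rel TYPE('v) L M' M' P" by (rule elem_rel_mono[rotated])
  moreover have "small M' P"
  proof -
    have "P \<subseteq> (\<lambda>(a, b). (b, b)) ` E \<union> (\<lambda>(a, b). (\<tau>2 b, ?i (\<tau>3 b))) ` E"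
      by (force simp: P_def)
    then show ?thesis by (rule small_mono[rotated]) (intro small_Un infM' small_image E(1))
  qed
  ultimately obtain \<rho> where \<rho>: "\<rho> \<in> auts L M'" "\<forall>a b. (a, b) \<in> P \<longrightarrow> \<rho> a = b"
    using homogeneous[OF inf M'] by blast
  have smallR: "small M' (Range E)"
    by (rule small_image_mono[OF E(1), of _ snd]) force
  have \<rho>R: "\<rho> b = b" "\<rho> (\<tau>2 b) = ?i (\<tau>3 b)" if "b \<in> Range E" for b
  proof -
    have "(b, b) \<in> P" "(\<tau>2 b, ?i (\<tau>3 b)) \<in> P" using that unfolding P_def by blast+
    then show "\<rho> b = b" "\<rho> (\<tau>2 b) = ?i (\<tau>3 b)" using \<rho>(2) by blast+
  qed
  then have \<rho>fix: "\<rho> \<in> fixers TYPE('v) L M'"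
    unfolding fixers_def using \<rho>(1) E(2) smallR by blast
  let ?\<mu> = "\<tau>1 \<otimes>\<^bsub>Aut L M'\<^esub> \<rho> \<otimes>\<^bsub>Aut L M'\<^esub> \<tau>2"
  define \<kappa> where "\<kappa> = inv\<^bsub>Aut L M'\<^esub> ?\<mu> \<otimes>\<^bsub>Aut L M'\<^esub> \<tau>3"
  have \<mu>: "?\<mu> \<in> auts L M'" by (intro closed' 1 2 \<rho>)
  have \<mu>app: "?\<mu> b = \<tau>3 b" if b: "b \<in> Range E" for b
  proof -
    have bU: "b \<in> universe M'" using b EU by blast
    have "?\<mu> b = \<tau>1 (\<rho> (\<tau>2 b))"
      using bU closed' 1 2 \<rho>(1) auts_universe[OF 2(2)] by (simp add: Aut_apply)
    then show ?thesis using \<rho>R(2)[OF b] \<iota>(3) auts_universe[OF \<tau>3 bU] by simp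
  qed
  have "\<kappa> \<in> fixers TYPE('v) L M'"
  proof -
    have "\<kappa> b = b" if b: "b \<in> Range E" for b
    proof -
      have bU: "b \<in> universe M'" using b EU by blast
      have "\<kappa> b = (inv\<^bsub>Aut L M'\<^esub> ?\<mu>) (\<tau>3 b)"
        unfolding \<kappa>_def by (rule Aut_apply[OF Aut_inv(1)[OF str' \<mu>] \<tau>3 bU])
      then show ?thesis using \<mu>app[OF b] Aut_inv(2)[OF str' \<mu> bU] by simp
    qed
    moreover have "\<kappa> \<in> auts L M'" unfolding \<kappa>_def by (intro closed' \<mu> \<tau>3)
    ultimately show ?thesis unfolding fixers_def using E(2) smallR by blast
  qed
  then have \<kappa>: "\<kappa> \<in> Autf TYPE('v) L M'" using fixers_Autf[OF inf str'] by blast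
  let ?\<gamma> = "inv\<^bsub>Aut L M'\<^esub> \<tau>2 \<otimes>\<^bsub>Aut L M'\<^esub> \<rho> \<otimes>\<^bsub>Aut L M'\<^esub> \<tau>2"
  have \<gamma>: "?\<gamma> \<in> Autf TYPE('v) L M'"
    using Autf_conj[OF inf str' Aut_inv(1)[OF str' 2(2)], of \<rho>] fixers_Autf[OF inf str'] \<rho>fix 2(2)
    by (auto simp: Aut_carrier[symmetric] simp del: Aut_carrier)
  have "\<tau>1 \<otimes>\<^bsub>Aut L M'\<^esub> \<tau>2 \<otimes>\<^bsub>Aut L M'\<^esub> (?\<gamma> \<otimes>\<^bsub>Aut L M'\<^esub> \<kappa>) = ?\<mu> \<otimes>\<^bsub>Aut L M'\<^esub> \<kappa>"
  proof (rule auts_ext[of _ L M'])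
    have \<kappa>a: "\<kappa> \<in> auts L M'" using \<kappa> Autf.subset by auto
    show "\<tau>1 \<otimes>\<^bsub>Aut L M'\<^esub> \<tau>2 \<otimes>\<^bsub>Aut L M'\<^esub> (?\<gamma> \<otimes>\<^bsub>Aut L M'\<^esub> \<kappa>) \<in> auts L M'" "?\<mu> \<otimes>\<^bsub>Aut L M'\<^esub> \<kappa> \<in> auts L M'"
      by (intro closed' 1 2 \<rho> \<kappa>a)+
    fix b assume b: "b \<in> universe M'"
    note au = 1(2) 2(2) \<rho>(1) \<kappa>a Aut_inv(1)[OF str' 2(2)]
    show "(\<tau>1 \<otimes>\<^bsub>Aut L M'\<^esub> \<tau>2 \<otimes>\<^bsub>Aut L M'\<^esub> (?\<gamma> \<otimes>\<^bsub>Aut L M'\<^esub> \<kappa>)) b = (?\<mu> \<otimes>\<^bsub>Aut L M'\<^esub> \<kappa>) b"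
      using b au closed' by (simp add: Aut_apply auts_universe[of _ L M'] Aut_inv(3)[OF str' 2(2)])
  qed
  moreover have "?\<mu> \<otimes>\<^bsub>Aut L M'\<^esub> \<kappa> = \<tau>3"
  proof (rule auts_ext[of _ L M'])
    have \<kappa>a: "\<kappa> \<in> auts L M'" using \<kappa> Autf.subset by auto
    show "?\<mu> \<otimes>\<^bsub>Aut L M'\<^esub> \<kappa> \<in> auts L M'" by (intro closed' \<mu> \<kappa>a)
    fix b assume b: "b \<in> universe M'"
    show "(?\<mu> \<otimes>\<^bsub>Aut L M'\<^esub> \<kappa>) b = \<tau>3 b"
      using b Aut_apply[OF \<mu> \<kappa>a b] Aut_apply[OF Aut_inv(1)[OF str' \<mu>] \<tau>3 b]
        Aut_inv(3)[OF str' \<mu>] auts_universe[OF \<tau>3 b] by (simp add: \<kappa>_def)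
  qed (rule \<tau>3)
  ultimately show ?thesis
    using R3 Autf.m_closed[OF \<gamma> \<kappa>] by (intro bexI[of _ "?\<gamma> \<otimes>\<^bsub>Aut L M'\<^esub> \<kappa>"]) auto
qed

text \<open>
  A tuple \<open>a'\<close> of realizations in \<open>M'\<close> and its image under \<open>\<tau>\<close> are carried by \<open>H\<close> to tuples \<open>a\<close>
  and \<open>b\<close> in \<open>M\<close>. As \<open>\<sigma>\<close> and \<open>\<tau>\<close> correspond, the image of \<open>a\<close> under \<open>\<sigma>\<close> has the type of \<open>b\<close> over the image of the
  submodel under \<open>\<sigma>\<close>. So \<open>a\<close>, its image under \<open>\<sigma>\<close>, and \<open>b\<close> have the same Lascar type, and this is
  transferred back to \<open>M'\<close>.
\<close>

lemma corresponding_fix_auts: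
  fixes T T' :: "('f, 'p, 'v \<times> 's) fm set" and M :: "('f, 'p, 's, 'm) struct" and M' :: "('f, 'p, 's, 'n) struct"
    and \<Sigma> :: "('f, 'p, 'v \<times> 's) fm set"
  assumes inf: "infinite (UNIV :: 'v set)" and M: "monster L T M" and M': "monster L T' M'"
    and X: "small M X" "small M' X" and \<Sigma>: "\<forall>\<phi>\<in>\<Sigma>. wf_fm L \<phi> \<and> fv \<phi> \<subseteq> X"
    and E: "small M E" "elem_subset TYPE('v) L M (Domain E)"
    and \<sigma>: "\<sigma> \<in> fix_auts l L M X \<Sigma>" and \<tau>: "\<tau> \<in> auts L M'"
    and R: "corresponding TYPE('v) L M M' E \<sigma> \<tau>"
  shows "\<tau> \<in> fix_auts l L M' X \<Sigma>"
  unfolding fix_auts_def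
proof (intro CollectI conjI allI impI \<tau>)
  note str = monsterD(1)[OF M] and infM = monsterD(2)[OF M]
    and str' = monsterD(1)[OF M'] and infM' = monsterD(2)[OF M']
  interpret G: group "Aut L M" by (rule Aut_group[OF str])
  interpret Autf: subgroup "Autf TYPE('v) L M" "Aut L M" by (rule Autf_subgroup[OF str])
  note closed = G.m_closed[unfolded Aut_carrier] G.inv_closed[unfolded Aut_carrier]
  have \<sigma>a: "\<sigma> \<in> auts L M" using \<sigma> by (rule fix_auts_auts)
  have nat: "small M (UNIV :: nat set)" "small M' (UNIV :: nat set)"
    using M M' by (simp_all add: monster_def)
  fix a' assume a': "\<forall>i. enat i < l \<longrightarrow> a' i \<in> realizations M' X \<Sigma>"
  define A' where "A' = points X l a'"
  have A'U: "A' \<subseteq> universe M'" unfolding A'_def using a' by (intro points_universe) blast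
  have smallA': "small M A'" unfolding A'_def by (intro small_points infM X nat)
  let ?K = "E\<inverse> \<union> twist (E\<inverse>) \<tau> \<sigma>"
  have K: "elem_rel TYPE('v) L M' M ?K"
    using corresponding_converse[THEN iffD1, OF R] unfolding corresponding_def .
  have smallK: "small M ?K" by (intro small_Un infM small_twist small_converse E(1))
  have BU: "A' \<union> \<tau> ` A' \<subseteq> universe M'" using A'U auts_universe[OF \<tau>] by blast
  have smallB: "small M (A' \<union> \<tau> ` A')" by (intro small_Un infM small_image smallA')
  from elem_rel_extend[OF inf str' infM' M K smallK BU smallB]
  obtain H where H: "elem_rel TYPE('v) L M' M H" "?K \<subseteq> H" "A' \<union> \<tau> ` A' \<subseteq> Domain H" by blast
  define a where "a i = (\<lambda>x\<in>X. SOME c. (a' i x, c) \<in> H)" for i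
  have aH: "(a' i x, a i x) \<in> H" if "enat i < l" "x \<in> X" for i x
  proof -
    have "a' i x \<in> A'" using that unfolding A'_def points_def by blast
    then have "a' i x \<in> Domain H" using H(3) by blast
    then have "\<exists>c. (a' i x, c) \<in> H" by blast
    from someI_ex[OF this] show ?thesis using that by (simp add: a_def)
  qed
  have a: "a i \<in> realizations M X \<Sigma>" if "enat i < l" for i
    by (rule elem_rel_realization[OF \<Sigma> str' H(1), of "a' i"]) (use a' that aH in \<open>auto simp: a_def\<close>)
  define A where "A = points X l a"
  have AU: "A \<subseteq> universe M" unfolding A_def using a by (intro points_universe) blast
  have smallA: "small M A" "small M' A" unfolding A_def by (intro small_points infM infM' X nat)+
  obtain \<tau>0 where \<tau>0: "\<tau>0 \<in> Autf TYPE('v) L M" "\<And>b. b \<in> A \<Longrightarrow> \<sigma> b = \<tau>0 b"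
    unfolding A_def by (rule fix_autsD[OF \<sigma>, of a]) (use a in blast)+
  have \<tau>0a: "\<tau>0 \<in> auts L M" using \<tau>0(1) Autf.subset by auto
  let ?i = "inv\<^bsub>Aut L M\<^esub> \<sigma>"
  note \<iota> = Aut_inv[OF str \<sigma>a]
  define S1 where "S1 = {(a, \<tau> a) | a. a \<in> universe M'}"
  define S2 where "S2 = {(a, ?i a) | a. a \<in> universe M}"
  define Q where "Q = (H\<inverse> O S1 O H O S2) \<inter> (Domain E \<union> A) \<times> UNIV"
  have Q: "elem_rel TYPE('v) L M M Q"
  proof (rule elem_rel_mono)
    show "elem_rel TYPE('v) L M M (H\<inverse> O S1 O H O S2)"
      unfolding S1_def S2_def
      by (intro elem_rel_comp[OF elem_rel_converse[OF H(1)]] elem_rel_comp[OF elem_rel_aut[OF str' \<tau>]]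
          elem_rel_comp[OF H(1)] elem_rel_aut \<iota>(1) str str')
  qed (simp add: Q_def)
  have smallD: "small M (Domain E)" by (rule small_image_mono[OF E(1), of _ fst]) force
  have smallQ: "small M Q"
    by (rule small_elem_rel[OF inf Q str str small_Un[OF infM smallD smallA(1)]]) (auto simp: Q_def)
  obtain \<rho> where \<rho>: "\<rho> \<in> auts L M" "\<forall>a b. (a, b) \<in> Q \<longrightarrow> \<rho> a = b"
    using homogeneous[OF inf M Q smallQ] by blast
  have S2: "(b, ?i b) \<in> S2" if "b \<in> universe M" for b using that by (auto simp: S2_def)
  have "\<rho> c = c" if c: "c \<in> Domain E" for c
  proof -
    obtain d where d: "(c, d) \<in> E" using c by blast
    have dc: "(d, c) \<in> H" "(\<tau> d, \<sigma> c) \<in> H" using d H(2) by (auto simp: twist_def)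
    have U: "d \<in> universe M'" "c \<in> universe M" using elem_rel_universe[OF H(1) dc(1)] by auto
    have "(d, \<tau> d) \<in> S1" using U by (auto simp: S1_def)
    moreover have "(\<sigma> c, c) \<in> S2" using S2[OF auts_universe[OF \<sigma>a U(2)]] \<iota>(2)[OF U(2)] by simp
    ultimately have "(c, c) \<in> Q" using dc c unfolding Q_def by blast
    then show ?thesis by (rule \<rho>(2)[rule_format])
  qed
  then have "\<rho> \<in> fixers TYPE('v) L M" unfolding fixers_def using \<rho>(1) E(2) smallD by blast
  then have \<rho>Autf: "\<rho> \<in> Autf TYPE('v) L M" using fixers_Autf[OF inf str] by blast
  \<comment> \<open>This takes \<open>a\<close> to the tuple that \<open>H\<close> assigns to the image of \<open>a'\<close> under \<open>\<tau>\<close>.\<close>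
  define \<tau>1 where "\<tau>1 = \<sigma> \<otimes>\<^bsub>Aut L M\<^esub> \<rho> \<otimes>\<^bsub>Aut L M\<^esub> ?i \<otimes>\<^bsub>Aut L M\<^esub> \<tau>0"
  have \<tau>1: "\<tau>1 \<in> Autf TYPE('v) L M"
    unfolding \<tau>1_def by (rule Autf.m_closed[OF Autf_conj[OF inf str \<sigma>a \<rho>Autf] \<tau>0(1)])
  have \<tau>1H: "(\<tau> (a' i x), \<tau>1 (a i x)) \<in> H" if ix: "enat i < l" "x \<in> X" for i x
  proof -
    have pA: "a' i x \<in> A'" "a i x \<in> A" using ix unfolding A'_def A_def points_def by blast+
    have pU: "a' i x \<in> universe M'" "a i x \<in> universe M" using pA A'U AU by auto
    have "\<tau> (a' i x) \<in> Domain H" using H(3) pA by blast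
    then obtain b where b: "(\<tau> (a' i x), b) \<in> H" by blast
    have bU: "b \<in> universe M" using elem_rel_universe[OF H(1) b] by blast
    have "(a' i x, \<tau> (a' i x)) \<in> S1" using pU by (auto simp: S1_def)
    then have "(a i x, ?i b) \<in> Q" using aH[OF ix] b S2[OF bU] pA(2) unfolding Q_def by blast
    then have "\<rho> (a i x) = ?i b" by (rule \<rho>(2)[rule_format])
    moreover have "\<tau>1 (a i x) = \<sigma> (\<rho> (?i (\<tau>0 (a i x))))"
      unfolding \<tau>1_def
      using pU(2) \<sigma>a \<rho>(1) \<tau>0a \<iota>(1) closed by (simp add: Aut_apply auts_universe[of _ L M])
    moreover have "?i (\<tau>0 (a i x)) = a i x" using \<tau>0(2)[OF pA(2)] \<iota>(2)[OF pU(2)] by simp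
    ultimately show ?thesis using b \<iota>(3)[OF bU] by simp
  qed
  obtain \<tau>' where \<tau>': "\<tau>' \<in> Autf TYPE('v) L M'"
      "\<forall>c\<in>A. \<forall>b d. (c, b) \<in> H\<inverse> \<longrightarrow> (\<tau>1 c, d) \<in> H\<inverse> \<longrightarrow> \<tau>' b = d"
    using transfer_Autf[OF inf M M' \<tau>1 elem_rel_converse[OF H(1)] AU smallA] by blast
  have "\<tau> b = \<tau>' b" if b: "b \<in> points X l a'" for b
  proof -
    obtain i x where ix: "enat i < l" "x \<in> X" "b = a' i x" using b unfolding points_def by blast
    have "a i x \<in> A" using ix unfolding A_def points_def by blast
    then have "\<tau>' (a' i x) = \<tau> (a' i x)" using \<tau>'(2) aH[OF ix(1,2)] \<tau>1H[OF ix(1,2)] by blast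
    then show ?thesis using ix(3) by simp
  qed
  then show "\<exists>\<tau>'\<in>Autf TYPE('v) L M'. \<forall>b\<in>points X l a'. \<tau> b = \<tau>' b" using \<tau>'(1) by blast
qed

lemma complete_theory_sat:
  fixes T :: "('f, 'p, 'v \<times> 's) fm set" and N :: "('f, 'p, 's, 'm) struct"
  assumes T: "complete_theory L T" and N: "is_model L T N" and \<phi>: "wf_fm L \<phi>" "fv \<phi> = {}"
  shows "sat N v \<phi> \<longleftrightarrow> \<phi> \<in> T"
proof -
  have str: "is_structure L N" using N by (simp add: is_model_def)
  define u :: "'v \<times> 's \<Rightarrow> 'm" where "u y = some_elem N (snd y)" for y
  have u: "u \<in> assignments N" using some_elem_in[OF str] by (auto simp: assignments_def u_def)
  have "\<phi> \<in> sentences L" using \<phi> by (simp add: sentences_def)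
  then have "\<phi> \<in> T \<longleftrightarrow> Neg \<phi> \<notin> T" using T by (auto simp: complete_theory_def)
  moreover have "\<phi> \<in> T \<Longrightarrow> sat N u \<phi>" "Neg \<phi> \<in> T \<Longrightarrow> sat N u (Neg \<phi>)"
    using N u unfolding is_model_def by blast+
  ultimately have "sat N u \<phi> \<longleftrightarrow> \<phi> \<in> T" by auto
  moreover have "sat N v \<phi> = sat N u \<phi>" by (rule sat_cong) (simp add: \<phi>(2))
  ultimately show ?thesis by simp
qed

lemma elem_rel_empty:
  fixes T :: "('f, 'p, 'v \<times> 's) fm set" and M :: "('f, 'p, 's, 'm) struct" and M' :: "('f, 'p, 's, 'n) struct"
  assumes T: "complete_theory L T" and M: "is_model L T M" and M': "is_model L T M'"
  shows "elem_rel TYPE('v) L M M' {}"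
  unfolding elem_rel_def
proof (intro conjI allI impI)
  fix \<phi> :: "('f, 'p, 'v \<times> 's) fm" and v :: "'v \<times> 's \<Rightarrow> 'm" and v' :: "'v \<times> 's \<Rightarrow> 'n"
  assume "wf_fm L \<phi>" "\<forall>x\<in>fv \<phi>. (v x, v' x) \<in> {}"
  then have "wf_fm L \<phi>" "fv \<phi> = {}" by auto
  then show "sat M v \<phi> = sat M' v' \<phi>"
    using complete_theory_sat[OF T M] complete_theory_sat[OF T M'] by metis
qed simp

text \<open>
  An elementary bijection between submodels of \<open>M\<close> and \<open>M'\<close> that are small in both models:
  the empty relation is elementary because \<open>T\<close> is complete, and it is extended to a submodel of
  \<open>M\<close> of cardinality at most that of the language.
\<close>

lemma ex_common_submodel:
  fixes T :: "('f, 'p, 'v \<times> 's) fm set" and M :: "('f, 'p, 's, 'm) struct" and M' :: "('f, 'p, 's, 'n) struct"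
  assumes inf: "infinite (UNIV :: 'v set)" and T: "complete_theory L T"
    and M: "monster L T M" and M': "monster L T M'"
  shows "\<exists>E. elem_rel TYPE('v) L M M' E \<and> small M E \<and> small M' E \<and>
    elem_subset TYPE('v) L M (Domain E) \<and> elem_subset TYPE('v) L M' (Range E)"
proof -
  note str = monsterD(1)[OF M] and infM = monsterD(2)[OF M]
    and str' = monsterD(1)[OF M'] and infM' = monsterD(2)[OF M']
  obtain C where C: "elem_subset TYPE('v) L M C" "|C| \<le>o |symbols L|"
    using ex_elem_subset[OF str] by blast
  have CU: "C \<subseteq> universe M" using C(1) by (simp add: elem_subset_def)
  have smallC: "small M C" "small M' C"
    using small_card[OF C(2)] small_symbols[OF M] small_symbols[OF M'] by blast+
  have empty: "elem_rel TYPE('v) L M M' {}" "small M' ({} :: ('m \<times> 'n) set)"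
    using elem_rel_empty[OF T] M M' small_finite[OF infM'] by (auto simp: monster_def)
  from elem_rel_extend[OF inf str infM M' empty CU smallC(2)]
  obtain H where H: "elem_rel TYPE('v) L M M' H" "C \<subseteq> Domain H" by blast
  define E where "E = H \<inter> C \<times> UNIV"
  have E: "elem_rel TYPE('v) L M M' E" by (rule elem_rel_mono[OF H(1)]) (simp add: E_def)
  have dom: "Domain E = C" using H(2) by (auto simp: E_def)
  then have "small M E" "small M' E"
    using small_elem_rel[OF inf E str str'] smallC by auto
  moreover have "elem_subset TYPE('v) L M' (Range E)"
  proof -
    have "E `` C = Range E" using dom by blast
    then show ?thesis using elem_subset_image[OF str str' E C(1)] dom by simp
  qed
  ultimately show ?thesis using E C(1) dom by auto
qed

lemma Gal_fix_upto_iso: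
  fixes T :: "('f, 'p, 'v \<times> 's) fm set" and M :: "('f, 'p, 's, 'm) struct" and M' :: "('f, 'p, 's, 'n) struct"
    and \<Sigma> :: "('f, 'p, 'v \<times> 's) fm set"
  assumes inf: "infinite (UNIV :: 'v set)" and T: "complete_theory L T"
    and M: "monster L T M" and M': "monster L T M'"
    and X: "small M X" "small M' X" and \<Sigma>: "\<forall>\<phi>\<in>\<Sigma>. wf_fm L \<phi> \<and> fv \<phi> \<subseteq> X"
  shows "Gal_fix_upto l L M X \<Sigma> \<cong> Gal_fix_upto l L M' X \<Sigma>"
proof -
  note str = monsterD(1)[OF M] and str' = monsterD(1)[OF M']
  interpret r: group_hom "Aut L M" "Aut_real L M X \<Sigma>" "restr M X \<Sigma>" by (rule restr_hom[OF str \<Sigma>])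
  interpret r': group_hom "Aut L M'" "Aut_real L M' X \<Sigma>" "restr M' X \<Sigma>" by (rule restr_hom[OF str' \<Sigma>])
  obtain E where E: "elem_rel TYPE('v) L M M' E" "small M E" "small M' E"
      "elem_subset TYPE('v) L M (Domain E)" "elem_subset TYPE('v) L M' (Range E)"
    using ex_common_submodel[OF inf T M M'] by blast
  let ?C = "corresponding TYPE('v) L M M' E"
  define R where "R x y \<longleftrightarrow> (\<exists>\<sigma>\<in>auts L M. \<exists>\<tau>\<in>auts L M'. x = restr M X \<Sigma> \<sigma> \<and> y = restr M' X \<Sigma> \<tau> \<and> ?C \<sigma> \<tau>)"
    for x y
  show ?thesis
    unfolding Gal_fix_upto_def
  proof (rule quotient_iso_of_relation[where R = R])
    show "Autf_fix_upto l L M X \<Sigma> \<lhd> Aut_real L M X \<Sigma>" by (rule Autf_fix_upto_normal[OF inf str \<Sigma>])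
    show "Autf_fix_upto l L M' X \<Sigma> \<lhd> Aut_real L M' X \<Sigma>" by (rule Autf_fix_upto_normal[OF inf str' \<Sigma>])
    show "\<exists>y\<in>carrier (Aut_real L M' X \<Sigma>). R x y" if "x \<in> carrier (Aut_real L M X \<Sigma>)" for x
      using that corresponding_total[OF inf M M' E(1,3)] unfolding Aut_real_carrier R_def by blast
    show "\<exists>x\<in>carrier (Aut_real L M X \<Sigma>). R x y" if y: "y \<in> carrier (Aut_real L M' X \<Sigma>)" for y
    proof -
      obtain \<tau> where \<tau>: "\<tau> \<in> auts L M'" "y = restr M' X \<Sigma> \<tau>" using y unfolding Aut_real_carrier by blast
      obtain \<sigma> where "\<sigma> \<in> auts L M" "corresponding TYPE('v) L M' M (E\<inverse>) \<tau> \<sigma>"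
        using corresponding_total[OF inf M' M elem_rel_converse[OF E(1)] small_converse[OF E(2)] \<tau>(1)] ..
      moreover from this(2) have "?C \<sigma> \<tau>" by (rule corresponding_converse[THEN iffD2])
      ultimately show ?thesis using \<tau> unfolding Aut_real_carrier R_def by blast
    qed
    show "x \<in> Autf_fix_upto l L M X \<Sigma> \<longleftrightarrow> y \<in> Autf_fix_upto l L M' X \<Sigma>" if "R x y" for x y
    proof -
      obtain \<sigma> \<tau> where *: "\<sigma> \<in> auts L M" "\<tau> \<in> auts L M'" "x = restr M X \<Sigma> \<sigma>" "y = restr M' X \<Sigma> \<tau>" "?C \<sigma> \<tau>"
        using \<open>R x y\<close> unfolding R_def by blast
      have "\<sigma> \<in> fix_auts l L M X \<Sigma> \<longleftrightarrow> \<tau> \<in> fix_auts l L M' X \<Sigma>"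
      proof
        show "\<tau> \<in> fix_auts l L M' X \<Sigma>" if "\<sigma> \<in> fix_auts l L M X \<Sigma>"
          by (rule corresponding_fix_auts[OF inf M M' X \<Sigma> E(2,4) that *(2,5)])
        show "\<sigma> \<in> fix_auts l L M X \<Sigma>" if "\<tau> \<in> fix_auts l L M' X \<Sigma>"
          by (rule corresponding_fix_auts[OF inf M' M X(2,1) \<Sigma> small_converse[OF E(3)] _ that *(1)
                corresponding_converse[THEN iffD1, OF *(5)]])
            (simp add: E(5))
      qed
      then show ?thesis using * by (simp add: restr_fix_auts)
    qed
    fix x1 x2 y1 y2 assume "R x1 y1" "R x2 y2"
    then obtain \<sigma>1 \<sigma>2 \<tau>1 \<tau>2 where
        1: "\<sigma>1 \<in> auts L M" "\<tau>1 \<in> auts L M'" "x1 = restr M X \<Sigma> \<sigma>1" "y1 = restr M' X \<Sigma> \<tau>1" "?C \<sigma>1 \<tau>1" and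
        2: "\<sigma>2 \<in> auts L M" "\<tau>2 \<in> auts L M'" "x2 = restr M X \<Sigma> \<sigma>2" "y2 = restr M' X \<Sigma> \<tau>2" "?C \<sigma>2 \<tau>2"
      unfolding R_def by blast
    obtain \<nu> where \<nu>: "\<nu> \<in> Autf TYPE('v) L M'"
        "?C (\<sigma>1 \<otimes>\<^bsub>Aut L M\<^esub> \<sigma>2) (\<tau>1 \<otimes>\<^bsub>Aut L M'\<^esub> \<tau>2 \<otimes>\<^bsub>Aut L M'\<^esub> \<nu>)"
      using corresponding_mult[OF inf M M' E(3,5) 1(1,2,5) 2(1,2,5)] by blast
    have \<nu>a: "\<nu> \<in> auts L M'" using \<nu>(1) subgroup.subset[OF Autf_subgroup[OF str']] by auto
    have "restr M' X \<Sigma> \<nu> \<in> Autf_fix_upto l L M' X \<Sigma>"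
      using \<nu>(1) Autf_fix_auts[OF str'] unfolding Autf_fix_upto_eq by blast
    moreover have "R (x1 \<otimes>\<^bsub>Aut_real L M X \<Sigma>\<^esub> x2)
        (y1 \<otimes>\<^bsub>Aut_real L M' X \<Sigma>\<^esub> y2 \<otimes>\<^bsub>Aut_real L M' X \<Sigma>\<^esub> restr M' X \<Sigma> \<nu>)"
    proof -
      have "restr M X \<Sigma> (\<sigma>1 \<otimes>\<^bsub>Aut L M\<^esub> \<sigma>2) = x1 \<otimes>\<^bsub>Aut_real L M X \<Sigma>\<^esub> x2"
        using 1 2 by (simp add: r.hom_mult)
      moreover have "restr M' X \<Sigma> (\<tau>1 \<otimes>\<^bsub>Aut L M'\<^esub> \<tau>2 \<otimes>\<^bsub>Aut L M'\<^esub> \<nu>) =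
          y1 \<otimes>\<^bsub>Aut_real L M' X \<Sigma>\<^esub> y2 \<otimes>\<^bsub>Aut_real L M' X \<Sigma>\<^esub> restr M' X \<Sigma> \<nu>"
        using 1(2,4) 2(2,4) \<nu>a r'.G.m_closed[of \<tau>1 \<tau>2] by (simp add: r'.hom_mult)
      moreover have "\<sigma>1 \<otimes>\<^bsub>Aut L M\<^esub> \<sigma>2 \<in> auts L M" "\<tau>1 \<otimes>\<^bsub>Aut L M'\<^esub> \<tau>2 \<otimes>\<^bsub>Aut L M'\<^esub> \<nu> \<in> auts L M'"
        using 1(1,2) 2(1,2) \<nu>a r.G.m_closed[unfolded Aut_carrier] r'.G.m_closed[unfolded Aut_carrier]
        by auto
      ultimately show ?thesis using \<nu>(2) unfolding R_def by metis
    qed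
    ultimately show "\<exists>n\<in>Autf_fix_upto l L M' X \<Sigma>. R (x1 \<otimes>\<^bsub>Aut_real L M X \<Sigma>\<^esub> x2)
        (y1 \<otimes>\<^bsub>Aut_real L M' X \<Sigma>\<^esub> y2 \<otimes>\<^bsub>Aut_real L M' X \<Sigma>\<^esub> n)" by blast
  qed
qed

section \<open>Countable tuples suffice\<close>

lemma elem_rel_submodel:
  fixes L :: "('f, 'p, 's) lang"
  assumes "elem_submodel TYPE('v) L M N"
  shows "elem_rel TYPE('v) L M N (Id_on (universe M))"
proof -
  have str: "is_structure L M" and sub: "\<And>s. car M s \<subseteq> car N s"
    and sat: "\<And>(\<phi> :: ('f, 'p, 'v \<times> 's) fm) v. wf_fm L \<phi> \<Longrightarrow> v \<in> assignments M \<Longrightarrow> sat M v \<phi> = sat N v \<phi>"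
    using assms by (auto simp: elem_submodel_def)
  show ?thesis
    unfolding elem_rel_def
  proof (intro conjI allI impI)
    show "\<exists>s. a \<in> car M s \<and> b \<in> car N s" if "(a, b) \<in> Id_on (universe M)" for a b
      using that sub by (fastforce simp: universe_def)
    fix \<phi> :: "('f, 'p, 'v \<times> 's) fm" and v v'
    assume *: "wf_fm L \<phi>" "srt M v (fv \<phi>)" "\<forall>x\<in>fv \<phi>. (v x, v' x) \<in> Id_on (universe M)"
    define u where "u x = (if x \<in> fv \<phi> then v x else some_elem M (snd x))" for x
    have "u \<in> assignments M"
      unfolding assignments_def
    proof (intro CollectI allI)
      show "u x \<in> car M (snd x)" for x
        using *(2) some_elem_in[OF str] by (simp add: u_def srt_def)
    qed
    then have "sat M u \<phi> = sat N u \<phi>" by (rule sat[OF *(1)])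
    moreover have "sat M v \<phi> = sat M u \<phi>" "sat N v' \<phi> = sat N u \<phi>"
      using *(3) by (auto intro!: sat_cong simp: u_def)
    ultimately show "sat M v \<phi> = sat N v' \<phi>" by simp
  qed
qed

lemma words_mono: "S \<subseteq> S' \<Longrightarrow> words G S n \<subseteq> words G S' n"
  by (induction n) auto

lemma conj_fixers_fixers:
  fixes L :: "('f, 'p, 's) lang"
  assumes M: "is_structure L M" and C: "elem_subset TYPE('v) L M C" "small M C"
  shows "conj_fixers L M C \<subseteq> fixers TYPE('v) L M"
proof
  fix \<sigma> assume "\<sigma> \<in> conj_fixers L M C"
  then obtain \<rho> where \<sigma>: "\<sigma> \<in> auts L M" and \<rho>: "\<rho> \<in> auts L M" "\<forall>c\<in>C. \<sigma> (\<rho> c) = \<rho> c"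
    by (auto simp: conj_fixers_def)
  note CU = C(1)[unfolded elem_subset_def, THEN conjunct1]
  have "elem_subset TYPE('v) L M ({(a, \<rho> a) | a. a \<in> universe M} `` C)"
    by (rule elem_subset_image[OF M M elem_rel_aut[OF M \<rho>(1)] C(1)]) (use CU in auto)
  moreover have "{(a, \<rho> a) | a. a \<in> universe M} `` C = \<rho> ` C" using CU by auto
  ultimately show "\<sigma> \<in> fixers TYPE('v) L M"
    unfolding fixers_def using \<sigma> \<rho>(2) small_image[OF C(2), of \<rho>] by auto
qed

text \<open>
  If an automorphism moves every countable tuple of realizations within its Lascar type, then
  the number of factors needed is bounded: otherwise countably many finite tuples requiring
  more and more factors could be combined to a countable one.
\<close>

lemma bounded_Lascar_distance:
  fixes \<Sigma> :: "('f, 'p, 'v \<times> 's) fm set"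
  assumes inf: "infinite (UNIV :: 'v set)" and M: "is_structure L M"
    and \<sigma>: "\<sigma> \<in> fix_auts \<infinity> L M X \<Sigma>"
  shows "\<exists>n. \<forall>F. finite F \<longrightarrow> F \<subseteq> {a x | a x. a \<in> realizations M X \<Sigma> \<and> x \<in> X} \<longrightarrow>
    (\<exists>\<tau>\<in>words (Aut L M) (fixers TYPE('v) L M) n. \<forall>b\<in>F. \<tau> b = \<sigma> b)"
proof (rule ccontr)
  let ?B = "{a x | a x. a \<in> realizations M X \<Sigma> \<and> x \<in> X}"
  let ?W = "words (Aut L M) (fixers TYPE('v) L M)"
  assume "\<not> ?thesis"
  then have "\<forall>n. \<exists>F. finite F \<and> F \<subseteq> ?B \<and> \<not> (\<exists>\<tau>\<in>?W n. \<forall>b\<in>F. \<tau> b = \<sigma> b)"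
    by (simp only: not_ex not_all not_imp simp_thms)
  then have "\<exists>F. \<forall>n. finite (F n) \<and> F n \<subseteq> ?B \<and> \<not> (\<exists>\<tau>\<in>?W n. \<forall>b\<in>F n. \<tau> b = \<sigma> b)"
    by (rule choice)
  then obtain F where F: "\<And>n. finite (F n)" "\<And>n. F n \<subseteq> ?B" "\<And>n. \<not> (\<exists>\<tau>\<in>?W n. \<forall>b\<in>F n. \<tau> b = \<sigma> b)"
    by blast
  \<comment> \<open>All sets \<open>F n\<close> are covered by a single countable tuple of realizations.\<close>
  define U where "U = (\<Union>n. F n)"
  have "countable U" using F(1) by (auto simp: U_def intro: countable_finite)
  moreover have "U \<noteq> {}" using F(3)[of 0] by (auto simp: U_def)
  ultimately have U: "range (from_nat_into U) = U" by (rule range_from_nat_into[rotated])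
  have "\<forall>i. \<exists>a. a \<in> realizations M X \<Sigma> \<and> from_nat_into U i \<in> a ` X"
    using U F(2) by (fastforce simp: U_def)
  then have "\<exists>a. \<forall>i. a i \<in> realizations M X \<Sigma> \<and> from_nat_into U i \<in> a i ` X" by (rule choice)
  then obtain a where a: "\<And>i. a i \<in> realizations M X \<Sigma>" "\<And>i. from_nat_into U i \<in> a i ` X" by blast
  obtain \<tau> where \<tau>: "\<tau> \<in> Autf TYPE('v) L M" "\<And>b. b \<in> points X \<infinity> a \<Longrightarrow> \<sigma> b = \<tau> b"
    by (rule fix_autsD[OF \<sigma>, of a]) (use a(1) in blast)+
  obtain n where n: "\<tau> \<in> ?W n" using \<tau>(1) unfolding Autf_eq_words[OF inf M] by blast
  have "\<tau> b = \<sigma> b" if "b \<in> F n" for b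
  proof -
    have "b \<in> U" using that by (auto simp: U_def)
    then have "b \<in> range (from_nat_into U)" by (simp only: U)
    then have "b \<in> points X \<infinity> a" using a(2) by (fastforce simp: points_def)
    then show ?thesis using \<tau>(2) by simp
  qed
  then show False using F(3) n by blast
qed

text \<open>
  Over a larger monster model \<open>N\<close>, the Lascar type of the enumeration of all realizations in \<open>M\<close>
  is determined by the Lascar types in \<open>M\<close> of the countable tuples of realizations.
\<close>

lemma Autf_fix_eq_upto:
  fixes T :: "('f, 'p, 'v \<times> 's) fm set" and M N :: "('f, 'p, 's, 'm) struct"
    and \<Sigma> :: "('f, 'p, 'v \<times> 's) fm set"
  assumes inf: "infinite (UNIV :: 'v set)"
    and M: "monster L T M" and N: "monster L T N" and MN: "elem_submodel TYPE('v) L M N"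
    and small: "small N (universe M)" and X: "small M X"
  shows "Autf_fix L M N X \<Sigma> = Autf_fix_upto \<infinity> L M X \<Sigma>"
proof -
  note strM = monsterD(1)[OF M] and strN = monsterD(1)[OF N]
  define B where "B = {a x | a x. a \<in> realizations M X \<Sigma> \<and> x \<in> X}"
  have BM: "B \<subseteq> universe M" using realizations_universe by (fastforce simp: B_def)
  note Id = elem_rel_submodel[OF MN]
  have MN': "universe M \<subseteq> universe N" using elem_rel_universe[OF Id] by auto
  have "(\<exists>\<tau>\<in>Autf TYPE('v) L N. \<forall>b\<in>B. \<sigma> b = \<tau> b) \<longleftrightarrow> \<sigma> \<in> fix_auts \<infinity> L M X \<Sigma>"
    if \<sigma>: "\<sigma> \<in> auts L M" for \<sigma>
  proof
    assume "\<exists>\<tau>\<in>Autf TYPE('v) L N. \<forall>b\<in>B. \<sigma> b = \<tau> b"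
    then obtain \<tau> where \<tau>: "\<tau> \<in> Autf TYPE('v) L N" "\<forall>b\<in>B. \<sigma> b = \<tau> b" by blast
    show "\<sigma> \<in> fix_auts \<infinity> L M X \<Sigma>"
      unfolding fix_auts_def
    proof (intro CollectI conjI allI impI \<sigma>)
      fix a assume a: "\<forall>i. enat i < \<infinity> \<longrightarrow> a i \<in> realizations M X \<Sigma>"
      define A where "A = points X \<infinity> a"
      have AB: "A \<subseteq> B" using a by (fastforce simp: A_def B_def points_def)
      have "small M (UNIV :: nat set)" using M by (simp add: monster_def)
      then have smallM: "small M A" unfolding A_def by (intro small_points monsterD(2)[OF M] X)
      have smallN: "small N A" using small AB BM by (blast intro: small_mono)
      have AN: "A \<subseteq> universe N" using AB BM MN' by blast
      obtain \<tau>' where \<tau>': "\<tau>' \<in> Autf TYPE('v) L M"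
          "\<forall>a\<in>A. \<forall>b c. (a, b) \<in> (Id_on (universe M))\<inverse> \<longrightarrow> (\<tau> a, c) \<in> (Id_on (universe M))\<inverse> \<longrightarrow> \<tau>' b = c"
        using transfer_Autf[OF inf N M \<tau>(1) elem_rel_converse[OF Id] AN smallN smallM] by blast
      have "\<sigma> b = \<tau>' b" if b: "b \<in> A" for b
      proof -
        have "b \<in> universe M" "\<tau> b = \<sigma> b" using b AB BM \<tau>(2) by auto
        then have "(b, b) \<in> Id_on (universe M)" "(\<tau> b, \<sigma> b) \<in> Id_on (universe M)"
          using auts_universe[OF \<sigma>] by auto
        then have "\<tau>' b = \<sigma> b" by (rule \<tau>'(2)[unfolded converse_Id_on, rule_format, OF b])
        then show ?thesis by simp
      qed
      then show "\<exists>\<tau>\<in>Autf TYPE('v) L M. \<forall>b\<in>points X \<infinity> a. \<sigma> b = \<tau> b"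
        using \<tau>'(1) unfolding A_def by blast
    qed
  next
    assume "\<sigma> \<in> fix_auts \<infinity> L M X \<Sigma>"
    from bounded_Lascar_distance[OF inf strM this] obtain n where n: "\<And>F. finite F \<Longrightarrow> F \<subseteq> B \<Longrightarrow>
        \<exists>\<tau>\<in>words (Aut L M) (fixers TYPE('v) L M) n. \<forall>b\<in>F. \<tau> b = \<sigma> b"
      unfolding B_def[symmetric] by blast
    obtain C where C: "elem_subset TYPE('v) L N C" "|C| \<le>o |symbols L|"
      using ex_elem_subset[OF strN] by blast
    have CU: "C \<subseteq> universe N" using C(1) by (simp add: elem_subset_def)
    have smallC: "small N C" using small_card[OF C(2)] small_symbols[OF N] by blast
    have "\<exists>\<tau>\<in>words (Aut L N) (conj_fixers L N C) n. \<forall>b\<in>B. \<tau> b = \<sigma> b"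
    proof (rule realize_words[OF inf N _ _ CU smallC])
      show "B \<subseteq> universe N" using BM MN' by blast
      show "small N B" using small BM by (rule small_mono)
      fix F assume F: "finite F" "F \<subseteq> B"
      then obtain \<tau> where \<tau>: "\<tau> \<in> words (Aut L M) (fixers TYPE('v) L M) n" "\<forall>b\<in>F. \<tau> b = \<sigma> b"
        using n by blast
      have FM: "F \<subseteq> universe M" using F(2) BM by blast
      obtain \<tau>' where \<tau>': "\<tau>' \<in> words (Aut L N) (fixers TYPE('v) L N) n"
          "\<forall>a\<in>F. \<forall>b c. (a, b) \<in> Id_on (universe M) \<longrightarrow> (\<tau> a, c) \<in> Id_on (universe M) \<longrightarrow> \<tau>' b = c"
        using transfer_words[OF inf M N \<tau>(1) Id FM small_finite[OF monsterD(2)[OF M] F(1)]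
            small_finite[OF monsterD(2)[OF N] F(1)]] by blast
      have "\<tau>' b = \<sigma> b" if b: "b \<in> F" for b
        using \<tau>(2) \<tau>'(2) b FM auts_universe[OF \<sigma>] by (auto simp: Id_on_def)
      then show "\<exists>\<tau>\<in>words (Aut L N) (fixers TYPE('v) L N) n. \<forall>b\<in>F. \<tau> b = \<sigma> b" using \<tau>'(1) by blast
    qed
    then obtain \<tau> where \<tau>: "\<tau> \<in> words (Aut L N) (conj_fixers L N C) n" "\<forall>b\<in>B. \<tau> b = \<sigma> b" by blast
    have "\<tau> \<in> words (Aut L N) (fixers TYPE('v) L N) n"
      using \<tau>(1) words_mono[OF conj_fixers_fixers[OF strN C(1) smallC]] by blast
    then have "\<tau> \<in> Autf TYPE('v) L N" unfolding Autf_eq_words[OF inf strN] by blast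
    then show "\<exists>\<tau>\<in>Autf TYPE('v) L N. \<forall>b\<in>B. \<sigma> b = \<tau> b" using \<tau>(2) by (metis (no_types))
  qed
  moreover have "(\<forall>a\<in>realizations M X \<Sigma>. \<forall>x\<in>X. \<sigma> (a x) = \<tau> (a x)) \<longleftrightarrow> (\<forall>b\<in>B. \<sigma> b = \<tau> b)" for \<sigma> \<tau> :: "'m \<Rightarrow> 'm"
    by (auto simp: B_def)
  ultimately have "{\<sigma> \<in> auts L M. lascar_eq L N X (realizations M X \<Sigma>) (\<lambda>a. a) (\<lambda>a. compose X \<sigma> a)} =
      fix_auts \<infinity> L M X \<Sigma>"
    unfolding lascar_eq_image using fix_auts_auts[of _ \<infinity> L M X \<Sigma>] by auto
  then show ?thesis unfolding Autf_fix_def Autf_fix_upto_eq by blast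
qed

theorem proposition3p6:
  fixes L :: "('f, 'p, 's) lang"
    and T :: "('f, 'p, 'v \<times> 's) fm set"
    and X :: "('v \<times> 's) set"
    and \<Sigma> :: "('f, 'p, 'v \<times> 's) fm set"
    and M :: "('f, 'p, 's, 'm) struct"
    and M' :: "('f, 'p, 's, 'n) struct"
    and l :: enat
  assumes "infinite (UNIV :: 'v set)"
    and "complete_theory L T"
    and "monster L T M" and "small M X"
    and "monster L T M'" and "small M' X"
    and "partial_type L M X \<Sigma>"
    and "0 < l"
  shows "Gal_fix_upto l L M X \<Sigma> \<cong> Gal_fix_upto l L M' X \<Sigma> \<and>
    (\<forall>N N'.
       monster L T N \<and> elem_submodel TYPE('v) L M N \<and> small N (universe M) \<and>
       monster L T N' \<and> elem_submodel TYPE('v) L M' N' \<and> small N' (universe M') \<longrightarrow>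
       Gal_fix L M N X \<Sigma> \<cong> Gal_fix L M' N' X \<Sigma>)"
proof (intro conjI allI impI)
  have \<Sigma>: "\<forall>\<phi>\<in>\<Sigma>. wf_fm L \<phi> \<and> fv \<phi> \<subseteq> X" using assms(7) by (simp add: partial_type_def)
  have iso: "Gal_fix_upto k L M X \<Sigma> \<cong> Gal_fix_upto k L M' X \<Sigma>" for k
    by (rule Gal_fix_upto_iso[OF assms(1-3,5,4,6) \<Sigma>])
  show "Gal_fix_upto l L M X \<Sigma> \<cong> Gal_fix_upto l L M' X \<Sigma>" by (rule iso)
  fix N N'
  assume "monster L T N \<and> elem_submodel TYPE('v) L M N \<and> small N (universe M) \<and>
       monster L T N' \<and> elem_submodel TYPE('v) L M' N' \<and> small N' (universe M')"
  then have "Autf_fix L M N X \<Sigma> = Autf_fix_upto \<infinity> L M X \<Sigma>"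
    "Autf_fix L M' N' X \<Sigma> = Autf_fix_upto \<infinity> L M' X \<Sigma>"
    using Autf_fix_eq_upto assms(1,3-6) by blast+
  then show "Gal_fix L M N X \<Sigma> \<cong> Gal_fix L M' N' X \<Sigma>"
    using iso[of \<infinity>] by (simp add: Gal_fix_def Gal_fix_upto_def)
qed

end
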